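(* Let $K$ be a field, let $L$ be a finite distributive lattice with at least two elements, and let $A$ be the incidence algebra of $L$ over $K$. Then for each $x\in L$, $$g_A(S_x)\cong S_{\operatorname{row}(x)},$$ where $g_A$ is the grade bijection of $A$ and $\operatorname{row}$ is the rowmotion bijection of $L$.
   Context: The incidence algebra of a finite poset $P$ over a field $K$ is the $K$-algebra with $K$-basis $\{p_y^x \mid x,y\in P,\ x\le y\}$ and multiplication $p_{x_2}^{x_1}p_{y_2}^{y_1}=p_{y_2}^{x_1}$ if $x_2=y_1$ and $0$ otherwise. Write $e_x=p_x^x$. All modules are finitely generated right modules. $S_x$ denotes the simple $A$-module corresponding to $x$, i.e. the top of $e_xA$. $D=\operatorname{Hom}_K(-,K)$. A finite dimensional algebra $A$ is Auslander regular if it has finite global dimension and the minimal injective coresolution $0\to A\to I^0\to I^1\to\cdots$ of the right module $A$ satisfies $\operatorname{pdim}I^i\le i$ for all $i\ge 0$. The incidence algebra of a finite distributive lattice is Auslander regular. The grade of a module $N$ is $\operatorname{grade}N=\inf\{\ell\ge0\mid\operatorname{Ext}_A^\ell(N,A)\ne0\}$. For an Auslander regular algebra $A$, the grade bijection $g_A$ is the permutation of the (isomorphism classes of) simple right $A$-modules given by $g_A(S)=\operatorname{top}(D\operatorname{Ext}_A^g(S,A))$ where $g=\operatorname{grade}S$. (It is a known result that this is a well-defined bijection.) Here $\operatorname{top}$ denotes the quotient of a module by its radical, and $D\operatorname{Ext}^g_A(S,A)$ is regarded as a right $A$-module. Write $L=\mathcal{O}_P$, the lattice of order ideals (down-sets)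 of a finite poset $P$ ordered by inclusion, as is possible for any finite distributive lattice with $P$ the poset of join-irreducible elements of $L$. For $p\in P$ let $\mathcal{I}(p)=\{q\in P\mid q\le p\}$. The rowmotion bijection $\operatorname{row}:L\to L$ is defined for an order ideal $x$ of $P$ by $\operatorname{row}(x)=\bigcup_{p\in\min(P\setminus x)}\mathcal{I}(p)$, where $\min(X)$ is the set of minimal elements of $X$. *)

theory Defs
  imports "HOL-Algebra.Module" "HOL-Algebra.AbelCoset" "HOL-Library.Extended_Nat"
begin

section \<open>Modules over a not necessarily commutative ring\<close>

text \<open>
  The library locale \<^locale>\<open>module\<close> requires a commutative ring of scalars, but the record type
  \<open>('a, 'm) module\<close> is usable for one-sided modules.  For a right module \<open>M\<close>, the term
  \<open>a \<odot>\<^bsub>M\<^esub> m\<close> stands for the product usually written \<open>m a\<close>; for a left module it stands for \<open>a m\<close>.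
  The multiplicative fields of the record carry no meaning for modules.
\<close>

locale right_module = A?: ring A + M?: abelian_group M for A (structure) and M (structure) +
  assumes smult_closed: "\<lbrakk>a \<in> carrier A; m \<in> carrier M\<rbrakk> \<Longrightarrow> a \<odot>\<^bsub>M\<^esub> m \<in> carrier M"
    and smult_l_distr: "\<lbrakk>a \<in> carrier A; b \<in> carrier A; m \<in> carrier M\<rbrakk> \<Longrightarrow>
      (a \<oplus>\<^bsub>A\<^esub> b) \<odot>\<^bsub>M\<^esub> m = a \<odot>\<^bsub>M\<^esub> m \<oplus>\<^bsub>M\<^esub> b \<odot>\<^bsub>M\<^esub> m"
    and smult_r_distr: "\<lbrakk>a \<in> carrier A; m \<in> carrier M; n \<in> carrier M\<rbrakk> \<Longrightarrow>
      a \<odot>\<^bsub>M\<^esub> (m \<oplus>\<^bsub>M\<^esub> n) = a \<odot>\<^bsub>M\<^esub> m \<oplus>\<^bsub>M\<^esub> a \<odot>\<^bsub>M\<^esub> n"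
    and smult_assoc: "\<lbrakk>a \<in> carrier A; b \<in> carrier A; m \<in> carrier M\<rbrakk> \<Longrightarrow>
      (a \<otimes>\<^bsub>A\<^esub> b) \<odot>\<^bsub>M\<^esub> m = b \<odot>\<^bsub>M\<^esub> (a \<odot>\<^bsub>M\<^esub> m)"
    and smult_one: "m \<in> carrier M \<Longrightarrow> \<one>\<^bsub>A\<^esub> \<odot>\<^bsub>M\<^esub> m = m"

definition right_regular :: "('a, 'r) ring_scheme \<Rightarrow> ('a, 'a) module" where
  "right_regular A =
    \<lparr>carrier = carrier A, mult = undefined, one = undefined, zero = \<zero>\<^bsub>A\<^esub>,
     add = (\<lambda>m n. m \<oplus>\<^bsub>A\<^esub> n), smult = (\<lambda>a m. m \<otimes>\<^bsub>A\<^esub> a)\<rparr>"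

text \<open>The free right module \<open>A\<^sup>n\<close>; vectors are extended by zero beyond their \<open>n\<close> entries.\<close>

definition right_free :: "('a, 'r) ring_scheme \<Rightarrow> nat \<Rightarrow> ('a, nat \<Rightarrow> 'a) module" where
  "right_free A n =
    \<lparr>carrier = {v. (\<forall>i<n. v i \<in> carrier A) \<and> (\<forall>i\<ge>n. v i = \<zero>\<^bsub>A\<^esub>)},
     mult = undefined, one = undefined, zero = (\<lambda>i. \<zero>\<^bsub>A\<^esub>),
     add = (\<lambda>v w i. v i \<oplus>\<^bsub>A\<^esub> w i), smult = (\<lambda>a v i. v i \<otimes>\<^bsub>A\<^esub> a)\<rparr>"

text \<open>Homomorphisms are extensional functions, so that \<open>Hom\<^sub>A(M, N)\<close> is a genuine set of maps.\<close>

definition module_hom ::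
    "('a, 'r) ring_scheme \<Rightarrow> ('a, 'm, 'x) module_scheme \<Rightarrow> ('a, 'n, 'y) module_scheme \<Rightarrow> ('m \<Rightarrow> 'n) set"
  where
  "module_hom A M N =
    {f \<in> carrier M \<rightarrow>\<^sub>E carrier N.
       (\<forall>m\<in>carrier M. \<forall>n\<in>carrier M. f (m \<oplus>\<^bsub>M\<^esub> n) = f m \<oplus>\<^bsub>N\<^esub> f n) \<and>
       (\<forall>a\<in>carrier A. \<forall>m\<in>carrier M. f (a \<odot>\<^bsub>M\<^esub> m) = a \<odot>\<^bsub>N\<^esub> f m)}"

definition module_isomorphic ::
    "('a, 'r) ring_scheme \<Rightarrow> ('a, 'm, 'x) module_scheme \<Rightarrow> ('a, 'n, 'y) module_scheme \<Rightarrow> bool"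
  where
  "module_isomorphic A M N \<longleftrightarrow> (\<exists>f\<in>module_hom A M N. bij_betw f (carrier M) (carrier N))"

definition quotient_module ::
    "('a, 'm, 'x) module_scheme \<Rightarrow> 'm set \<Rightarrow> ('a, 'm set) module" where
  "quotient_module M N =
    \<lparr>carrier = a_rcosets\<^bsub>M\<^esub> N, mult = undefined, one = undefined, zero = N,
     add = set_add M, smult = (\<lambda>a X. \<Union>x\<in>X. N +>\<^bsub>M\<^esub> (a \<odot>\<^bsub>M\<^esub> x))\<rparr>"

definition maximal_submodule ::
    "'m set \<Rightarrow> ('a, 'r) ring_scheme \<Rightarrow> ('a, 'm, 'x) module_scheme \<Rightarrow> bool" where
  "maximal_submodule N A M \<longleftrightarrow>
     submodule N A M \<and> N \<noteq> carrier M \<and>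
     (\<forall>N'. submodule N' A M \<and> N \<subseteq> N' \<longrightarrow> N' = N \<or> N' = carrier M)"

definition module_radical ::
    "('a, 'r) ring_scheme \<Rightarrow> ('a, 'm, 'x) module_scheme \<Rightarrow> 'm set" where
  "module_radical A M = carrier M \<inter> \<Inter>{N. maximal_submodule N A M}"

definition module_top ::
    "('a, 'r) ring_scheme \<Rightarrow> ('a, 'm, 'x) module_scheme \<Rightarrow> ('a, 'm set) module" where
  "module_top A M = quotient_module M (module_radical A M)"


section \<open>Ext and grade\<close>

definition fg_projective ::
    "('a, 'r) ring_scheme \<Rightarrow> ('a, 'm, 'x) module_scheme \<Rightarrow> bool" where
  "fg_projective A P \<longleftrightarrow> right_module A P \<and>
     (\<exists>n. \<exists>s\<in>module_hom A P (right_free A n). \<exists>r\<in>module_hom A (right_free A n) P.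
        \<forall>p\<in>carrier P. r (s p) = p)"

text \<open>
  \<open>\<cdots> \<rightarrow> P 2 \<rightarrow> P 1 \<rightarrow> P 0 \<rightarrow> N \<rightarrow> 0\<close> with \<open>d i : P (i + 1) \<rightarrow> P i\<close> and augmentation \<open>\<epsilon> : P 0 \<rightarrow> N\<close>.
\<close>

definition projective_resolution ::
    "('a, 'r) ring_scheme \<Rightarrow> ('a, 'm, 'x) module_scheme \<Rightarrow>
     (nat \<Rightarrow> ('a, 'p) module) \<Rightarrow> (nat \<Rightarrow> 'p \<Rightarrow> 'p) \<Rightarrow> ('p \<Rightarrow> 'm) \<Rightarrow> bool" where
  "projective_resolution A N P d \<epsilon> \<longleftrightarrow>
     (\<forall>i. fg_projective A (P i)) \<and>
     (\<forall>i. d i \<in> module_hom A (P (Suc i)) (P i)) \<and>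
     \<epsilon> \<in> module_hom A (P 0) N \<and>
     \<epsilon> ` carrier (P 0) = carrier N \<and>
     d 0 ` carrier (P 1) = a_kernel (P 0) N \<epsilon> \<and>
     (\<forall>i. d (Suc i) ` carrier (P (Suc (Suc i))) = a_kernel (P (Suc i)) (P i) (d i))"

text \<open>
  A choice of resolution.  Every finitely generated projective module is isomorphic to a submodule
  of some \<open>A\<^sup>n\<close>, so it is no restriction that the elements of the \<open>P i\<close> have type \<open>nat \<Rightarrow> 'a\<close>.
\<close>

definition chosen_resolution ::
    "('a, 'r) ring_scheme \<Rightarrow> ('a, 'm, 'x) module_scheme \<Rightarrow>
     (nat \<Rightarrow> ('a, nat \<Rightarrow> 'a) module) \<times> (nat \<Rightarrow> (nat \<Rightarrow> 'a) \<Rightarrow> nat \<Rightarrow> 'a)" where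
  "chosen_resolution A N = (SOME (P, d). \<exists>\<epsilon>. projective_resolution A N P d \<epsilon>)"

text \<open>\<open>Hom\<^sub>A(P, A)\<close> for a right module \<open>P\<close>, as a left module via \<open>(a f)(p) = a f(p)\<close>.\<close>

definition hom_to_ring ::
    "('a, 'r) ring_scheme \<Rightarrow> ('a, 'p, 'x) module_scheme \<Rightarrow> ('a, 'p \<Rightarrow> 'a) module" where
  "hom_to_ring A P =
    \<lparr>carrier = module_hom A P (right_regular A), mult = undefined, one = undefined,
     zero = (\<lambda>p\<in>carrier P. \<zero>\<^bsub>A\<^esub>),
     add = (\<lambda>f g. \<lambda>p\<in>carrier P. f p \<oplus>\<^bsub>A\<^esub> g p),
     smult = (\<lambda>a f. \<lambda>p\<in>carrier P. a \<otimes>\<^bsub>A\<^esub> f p)\<rparr>"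

text \<open>Cohomology of \<open>Hom\<^sub>A(P 0, A) \<rightarrow> Hom\<^sub>A(P 1, A) \<rightarrow> \<cdots>\<close>.\<close>

definition cochain_map ::
    "(nat \<Rightarrow> ('a, 'p) module) \<Rightarrow> (nat \<Rightarrow> 'p \<Rightarrow> 'p) \<Rightarrow> nat \<Rightarrow> ('p \<Rightarrow> 'a) \<Rightarrow> 'p \<Rightarrow> 'a" where
  "cochain_map P d i f = compose (carrier (P (Suc i))) f (d i)"

definition cocycles ::
    "('a, 'r) ring_scheme \<Rightarrow> (nat \<Rightarrow> ('a, 'p) module) \<Rightarrow> (nat \<Rightarrow> 'p \<Rightarrow> 'p) \<Rightarrow> nat \<Rightarrow> ('p \<Rightarrow> 'a) set" where
  "cocycles A P d i =
     a_kernel (hom_to_ring A (P i)) (hom_to_ring A (P (Suc i))) (cochain_map P d i)"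

fun coboundaries ::
    "('a, 'r) ring_scheme \<Rightarrow> (nat \<Rightarrow> ('a, 'p) module) \<Rightarrow> (nat \<Rightarrow> 'p \<Rightarrow> 'p) \<Rightarrow> nat \<Rightarrow> ('p \<Rightarrow> 'a) set" where
  "coboundaries A P d 0 = {\<zero>\<^bsub>hom_to_ring A (P 0)\<^esub>}"
| "coboundaries A P d (Suc i) = cochain_map P d i ` carrier (hom_to_ring A (P i))"

definition cohomology ::
    "('a, 'r) ring_scheme \<Rightarrow> (nat \<Rightarrow> ('a, 'p) module) \<Rightarrow> (nat \<Rightarrow> 'p \<Rightarrow> 'p) \<Rightarrow> nat \<Rightarrow>
     ('a, ('p \<Rightarrow> 'a) set) module" where
  "cohomology A P d i =
     quotient_module ((hom_to_ring A (P i))\<lparr>carrier := cocycles A P d i\<rparr>) (coboundaries A P d i)"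

text \<open>The left module \<open>Ext\<^sub>A\<^sup>i(N, A)\<close> of a right module \<open>N\<close>.\<close>

definition Ext ::
    "('a, 'r) ring_scheme \<Rightarrow> nat \<Rightarrow> ('a, 'm, 'x) module_scheme \<Rightarrow>
     ('a, ((nat \<Rightarrow> 'a) \<Rightarrow> 'a) set) module" where
  "Ext A i N = (case chosen_resolution A N of (P, d) \<Rightarrow> cohomology A P d i)"

definition grade :: "('a, 'r) ring_scheme \<Rightarrow> ('a, 'm, 'x) module_scheme \<Rightarrow> enat" where
  "grade A N = Inf {enat i | i. carrier (Ext A i N) \<noteq> {\<zero>\<^bsub>Ext A i N\<^esub>}}"


section \<open>Duality and the grade bijection\<close>

text \<open>
  A \<open>K\<close>-algebra \<open>A\<close> is given by a record of type \<open>('k, 'a) module\<close>: its ring structure together with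
  the scalar multiplication \<open>\<odot>\<^bsub>A\<^esub>\<close>.  A scalar \<open>c\<close> acts on an \<open>A\<close>-module through \<open>c \<odot>\<^bsub>A\<^esub> \<one>\<^bsub>A\<^esub>\<close>.
  The dual \<open>Hom\<^sub>K(M, K)\<close> of a left module \<open>M\<close> is a right module via \<open>(\<phi> a)(m) = \<phi>(a m)\<close>.
\<close>

definition dual_module ::
    "('k::field, 'a, 'r) module_scheme \<Rightarrow> ('a, 'm, 'x) module_scheme \<Rightarrow> ('a, 'm \<Rightarrow> 'k) module" where
  "dual_module A M =
    \<lparr>carrier =
       {\<phi> \<in> extensional (carrier M).
          (\<forall>m\<in>carrier M. \<forall>n\<in>carrier M. \<phi> (m \<oplus>\<^bsub>M\<^esub> n) = \<phi> m + \<phi> n) \<and>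
          (\<forall>c. \<forall>m\<in>carrier M. \<phi> ((c \<odot>\<^bsub>A\<^esub> \<one>\<^bsub>A\<^esub>) \<odot>\<^bsub>M\<^esub> m) = c * \<phi> m)},
     mult = undefined, one = undefined,
     zero = (\<lambda>m\<in>carrier M. 0),
     add = (\<lambda>\<phi> \<psi>. \<lambda>m\<in>carrier M. \<phi> m + \<psi> m),
     smult = (\<lambda>a \<phi>. \<lambda>m\<in>carrier M. \<phi> (a \<odot>\<^bsub>M\<^esub> m))\<rparr>"

text \<open>
  The grade bijection on representatives: the class of \<open>S\<close> is sent to the class of
  \<open>grade_bijection A S\<close>.
\<close>

definition grade_bijection ::
    "('k::field, 'a, 'r) module_scheme \<Rightarrow> ('a, 'm, 'x) module_scheme \<Rightarrow>
     ('a, (((nat \<Rightarrow> 'a) \<Rightarrow> 'a) set \<Rightarrow> 'k) set) module" where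
  "grade_bijection A S = module_top A (dual_module A (Ext A (the_enat (grade A S)) S))"


section \<open>Incidence algebras\<close>

text \<open>The function \<open>f\<close> stands for the linear combination of the \<open>p\<^sup>x\<^sub>y\<close> with coefficients \<open>f x y\<close>.\<close>

definition incidence_algebra ::
    "('k::field, 'l::{finite,order} \<Rightarrow> 'l \<Rightarrow> 'k) module" where
  "incidence_algebra =
    \<lparr>carrier = {f. \<forall>x y. \<not> x \<le> y \<longrightarrow> f x y = 0},
     mult = (\<lambda>f g x y. \<Sum>z\<in>{x..y}. f x z * g z y),
     one = (\<lambda>x y. if x = y then 1 else 0),
     zero = (\<lambda>x y. 0),
     add = (\<lambda>f g x y. f x y + g x y),
     smult = (\<lambda>c f x y. c * f x y)\<rparr>"

definition incidence_basis :: "'l::{finite,order} \<Rightarrow> 'l \<Rightarrow> 'l \<Rightarrow> 'l \<Rightarrow> 'k::field" where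
  "incidence_basis x y = (\<lambda>u v. if u = x \<and> v = y then 1 else 0)"

lemma incidence_basis_mult:
  assumes "x1 \<le> x2" "y1 \<le> y2"
  shows "incidence_basis x1 x2 \<otimes>\<^bsub>incidence_algebra\<^esub> incidence_basis y1 y2 =
    (if x2 = y1 then incidence_basis x1 y2 else (\<zero>\<^bsub>incidence_algebra\<^esub> :: _ \<Rightarrow> _ \<Rightarrow> 'k::field))"
proof (intro ext)
  fix u v
  have "(\<Sum>z\<in>{u..v}. incidence_basis x1 x2 u z * (incidence_basis y1 y2 z v :: 'k)) =
        (\<Sum>z\<in>{u..v}. if z = x2 then (if u = x1 \<and> x2 = y1 \<and> v = y2 then 1 else 0) else 0)"
    by (rule sum.cong) (auto simp: incidence_basis_def)
  also have "\<dots> = (if x2 \<in> {u..v} then (if u = x1 \<and> x2 = y1 \<and> v = y2 then 1 else 0) else 0)"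
    by (subst sum.delta) auto
  finally show "(incidence_basis x1 x2 \<otimes>\<^bsub>incidence_algebra\<^esub> incidence_basis y1 y2) u v =
    (if x2 = y1 then incidence_basis x1 y2 else (\<zero>\<^bsub>incidence_algebra\<^esub> :: _ \<Rightarrow> _ \<Rightarrow> 'k)) u v"
    using assms by (auto simp: incidence_algebra_def incidence_basis_def)
qed

lemma ring_incidence_algebra:
  "ring (incidence_algebra :: ('k::field, 'l::{finite,order} \<Rightarrow> 'l \<Rightarrow> 'k) module)"
    (is "ring ?A")
proof (rule ringI)
  show "abelian_group ?A"
  proof (rule abelian_groupI)
    fix f assume "f \<in> carrier ?A"
    then show "\<exists>g\<in>carrier ?A. g \<oplus>\<^bsub>?A\<^esub> f = \<zero>\<^bsub>?A\<^esub>"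
      by (intro bexI[of _ "\<lambda>x y. - f x y"]) (auto simp: incidence_algebra_def)
  qed (auto simp: incidence_algebra_def add_ac)
  show "monoid ?A"
  proof (rule monoidI)
    fix f g h :: "'l \<Rightarrow> 'l \<Rightarrow> 'k"
    show "f \<otimes>\<^bsub>?A\<^esub> g \<otimes>\<^bsub>?A\<^esub> h = f \<otimes>\<^bsub>?A\<^esub> (g \<otimes>\<^bsub>?A\<^esub> h)"
    proof (intro ext)
      fix x y
      have "(\<Sum>z\<in>{x..y}. (\<Sum>w\<in>{x..z}. f x w * g w z) * h z y) =
            (\<Sum>z\<in>{x..y}. \<Sum>w\<in>{w. w \<in> {x..y} \<and> w \<le> z}. f x w * g w z * h z y)"
        by (rule sum.cong, simp, subst sum_distrib_right, rule sum.cong) auto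
      also have "\<dots> = (\<Sum>w\<in>{x..y}. \<Sum>z\<in>{z. z \<in> {x..y} \<and> w \<le> z}. f x w * g w z * h z y)"
        by (rule sum.swap_restrict) auto
      also have "\<dots> = (\<Sum>w\<in>{x..y}. f x w * (\<Sum>z\<in>{w..y}. g w z * h z y))"
        by (rule sum.cong, simp, subst sum_distrib_left, rule sum.cong) (auto simp: mult.assoc)
      finally show "(f \<otimes>\<^bsub>?A\<^esub> g \<otimes>\<^bsub>?A\<^esub> h) x y = (f \<otimes>\<^bsub>?A\<^esub> (g \<otimes>\<^bsub>?A\<^esub> h)) x y"
        by (simp add: incidence_algebra_def)
    qed
  next
    fix f assume f: "f \<in> carrier ?A"
    have "(\<Sum>z\<in>{x..y}. (if x = z then 1 else 0) * f z y) = f x y" for x y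
    proof -
      have "(\<Sum>z\<in>{x..y}. (if x = z then 1 else 0) * f z y) =
            (\<Sum>z\<in>{x..y}. if x = z then f z y else 0)"
        by (rule sum.cong) auto
      then show ?thesis
        using f by (auto simp: incidence_algebra_def)
    qed
    then show "\<one>\<^bsub>?A\<^esub> \<otimes>\<^bsub>?A\<^esub> f = f"
      by (auto simp: incidence_algebra_def)
    have "(\<Sum>z\<in>{x..y}. f x z * (if z = y then 1 else 0)) = f x y" for x y
    proof -
      have "(\<Sum>z\<in>{x..y}. f x z * (if z = y then 1 else 0)) =
            (\<Sum>z\<in>{x..y}. if z = y then f x z else 0)"
        by (rule sum.cong) auto
      then show ?thesis
        using f by (auto simp: incidence_algebra_def)
    qed
    then show "f \<otimes>\<^bsub>?A\<^esub> \<one>\<^bsub>?A\<^esub> = f"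
      by (auto simp: incidence_algebra_def)
  qed (auto simp: incidence_algebra_def)
qed (auto simp: incidence_algebra_def algebra_simps sum.distrib fun_eq_iff)

text \<open>The simple module \<open>S\<^sub>x = top(e\<^sub>x A)\<close> with \<open>e\<^sub>x = p\<^sup>x\<^sub>x\<close>.\<close>

definition incidence_projective ::
    "'l::{finite,order} \<Rightarrow> ('l \<Rightarrow> 'l \<Rightarrow> 'k::field, 'l \<Rightarrow> 'l \<Rightarrow> 'k) module" where
  "incidence_projective x =
     (right_regular incidence_algebra)
       \<lparr>carrier := {incidence_basis x x \<otimes>\<^bsub>incidence_algebra\<^esub> a | a.
                     a \<in> carrier incidence_algebra}\<rparr>"

definition incidence_simple ::
    "'l::{finite,order} \<Rightarrow> ('l \<Rightarrow> 'l \<Rightarrow> 'k::field, ('l \<Rightarrow> 'l \<Rightarrow> 'k) set) module" where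
  "incidence_simple x = module_top incidence_algebra (incidence_projective x)"


section \<open>Rowmotion\<close>

definition min_elements :: "'p::order set \<Rightarrow> 'p set" where
  "min_elements X = {p \<in> X. \<forall>q\<in>X. \<not> q < p}"

definition order_ideals :: "'p::order set \<Rightarrow> 'p set set" where
  "order_ideals P = {I. I \<subseteq> P \<and> (\<forall>p\<in>I. \<forall>q\<in>P. q \<le> p \<longrightarrow> q \<in> I)}"

definition ideal_rowmotion :: "'p::order set \<Rightarrow> 'p set \<Rightarrow> 'p set" where
  "ideal_rowmotion P I = (\<Union>p\<in>min_elements (P - I). {q \<in> P. q \<le> p})"

text \<open>The least element is not join-irreducible.\<close>

definition join_irreducible :: "'l::lattice \<Rightarrow> bool" where
  "join_irreducible p \<longleftrightarrow> (\<exists>z. \<not> p \<le> z) \<and> (\<forall>a b. p = sup a b \<longrightarrow> p = a \<or> p = b)"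

definition birkhoff :: "'l::lattice \<Rightarrow> 'l set" where
  "birkhoff x = {p. join_irreducible p \<and> p \<le> x}"

text \<open>Rowmotion on a finite distributive lattice \<open>L\<close>, through the identification of \<open>L\<close> with the order
  ideals of its poset of join-irreducible elements.\<close>

definition row :: "'l::{finite,distrib_lattice} \<Rightarrow> 'l" where
  "row x = inv_into UNIV birkhoff (ideal_rowmotion {p. join_irreducible p} (birkhoff x))"

lemma birkhoff_le_iff:
  fixes x y :: "'l::{finite,lattice}"
  shows "birkhoff x \<subseteq> birkhoff y \<longleftrightarrow> x \<le> y"
proof
  assume sub: "birkhoff x \<subseteq> birkhoff y"
  show "x \<le> y"
  proof (rule ccontr)
    assume "\<not> x \<le> y"
    then have "{z. z \<le> x \<and> \<not> z \<le> y} \<noteq> {}"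
      by auto
    from finite_has_minimal[OF _ this] obtain p where
      p: "p \<le> x" "\<not> p \<le> y" and
      min: "\<And>q. q \<le> x \<Longrightarrow> \<not> q \<le> y \<Longrightarrow> q \<le> p \<Longrightarrow> p = q"
      by auto
    have "p = a \<or> p = b" if "p = sup a b" for a b
    proof (rule ccontr)
      assume "\<not> (p = a \<or> p = b)"
      then have "a \<le> y" "b \<le> y"
        using that p min[of a] min[of b] by (auto intro: order_trans[of _ p x])
      then show False
        using that p by auto
    qed
    then have "p \<in> birkhoff x"
      using p by (auto simp: birkhoff_def join_irreducible_def)
    then show False
      using sub p by (auto simp: birkhoff_def)
  qed
qed (auto simp: birkhoff_def)

lemma bij_betw_birkhoff:
  "bij_betw birkhoff (UNIV :: 'l::{finite,distrib_lattice} set)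
     (order_ideals {p. join_irreducible p})"
proof (rule bij_betw_imageI)
  show "inj (birkhoff :: 'l \<Rightarrow> 'l set)"
    by (rule injI) (metis birkhoff_le_iff order_antisym order_refl)
  have prime: "\<exists>i\<in>I. p \<le> i"
    if p: "join_irreducible p" "p \<le> Sup_fin I" and I: "I \<noteq> {}" for p :: 'l and I
    using finite[of I] I p(2)
  proof (induction rule: finite_ne_induct)
    case (insert i I)
    then have "p = sup (inf p i) (inf p (Sup_fin I))"
      by (simp add: inf_sup_distrib1[symmetric] inf_absorb1)
    then have "p = inf p i \<or> p = inf p (Sup_fin I)"
      using p(1) unfolding join_irreducible_def by blast
    then show ?case
      using insert.IH by (metis inf.cobounded2 insertCI)
  qed simp
  show "range birkhoff = order_ideals {p :: 'l. join_irreducible p}"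
  proof (intro equalityI subsetI)
    fix I :: "'l set" assume I: "I \<in> order_ideals {p. join_irreducible p}"
    show "I \<in> range birkhoff"
    proof (cases "I = {}")
      case True
      have "birkhoff (Inf_fin (UNIV :: 'l set)) = {}"
        by (auto simp: birkhoff_def join_irreducible_def)
           (meson Inf_fin.coboundedI UNIV_I finite order_trans)
      then show ?thesis
        using True by blast
    next
      case False
      have "birkhoff (Sup_fin I) = I"
        using prime[OF _ _ False] I Sup_fin.coboundedI[OF finite[of I]]
        unfolding birkhoff_def order_ideals_def by blast
      then show ?thesis
        by blast
    qed
  qed (auto simp: birkhoff_def order_ideals_def)
qed

lemma birkhoff_row:
  "birkhoff (row x) = ideal_rowmotion {p. join_irreducible p} (birkhoff x)"
proof -
  have "ideal_rowmotion {p. join_irreducible p} (birkhoff x) \<in> order_ideals {p. join_irreducible p}"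
    by (auto simp: ideal_rowmotion_def order_ideals_def intro: order_trans)
  then have "ideal_rowmotion {p. join_irreducible p} (birkhoff x) \<in> range birkhoff"
    using bij_betw_imp_surj_on[OF bij_betw_birkhoff] by blast
  then show ?thesis
    unfolding row_def by (rule f_inv_into_f)
qed

end

theory Submission
  imports Defs
begin

text \<open>
  Let \<open>y\<^sub>1, \<dots>, y\<^sub>k\<close> be the covers of \<open>x\<close>, and let \<open>y\<^sub>I\<close> be the join of \<open>x\<close> and the \<open>y\<^sub>i\<close> with \<open>i \<in> I\<close>.  The
  modules \<open>e\<^bsub>y\<^sub>I\<^esub> A\<close> form a Koszul complex: its part at \<open>z\<close> involves the \<open>I\<close> with \<open>y\<^sub>I \<le> z\<close>, a full simplex
  unless \<open>z = x\<close>, so it resolves \<open>S\<^sub>x\<close>.  After applying \<open>Hom\<^sub>A(-, A)\<close>, the part at \<open>u\<close> involves the \<open>I\<close> with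
  \<open>u \<le> y\<^sub>I\<close>.  Distributivity makes these \<open>I\<close> stable under the removal of some fixed \<open>i\<close>, hence the part at
  \<open>u\<close> exact, unless \<open>I = {1, \<dots>, k}\<close> is the only one, which happens exactly when \<open>row x \<le> u \<le> y\<^bsub>{1,\<dots>,k}\<^esub>\<close>.
  So the grade of \<open>S\<^sub>x\<close> is \<open>k\<close>, and the dual of \<open>Ext\<^sup>k(S\<^sub>x, A)\<close> has a basis indexed by an interval with least
  element \<open>row x\<close>, which generates it and gives its top.
\<close>

section \<open>Groups with operators\<close>

text \<open>\<open>Ext\<close> is defined through an unspecified resolution inside free modules, and
  the simple modules are modules of cosets, so the Koszul complex and the ground field are objects
  of other types. An explicit computation therefore has to be accompanied by the comparison theorem,
  by invariance of cohomology and by a transport of resolutions between types. All identifications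
  are bijective homomorphisms onto concrete models: functions on an interval for Ext, the field with
  one diagonal entry acting for a simple module.

  The removable index comes from Birkhoff duality. Each cover is \<open>sup x p\<close> for a
  minimal join-irreducible \<open>p\<close> not below \<open>x\<close>, and \<open>row x\<close> is
  the join of these \<open>p\<close>. If \<open>u\<close> is above \<open>row x\<close>, each
  \<open>p\<close> is below \<open>joins x I\<close>, and primeness of \<open>p\<close> forces its
  cover into \<open>I\<close>.\<close>

text \<open>Left and right modules are treated uniformly by ignoring the multiplication of the scalars.\<close>

locale operator_group = abelian_group M for A :: "('a, 'r) ring_scheme"
    and M :: "('a, 'm, 'x) module_scheme" (structure) +
  assumes op_closed: "\<lbrakk>a \<in> carrier A; m \<in> carrier M\<rbrakk> \<Longrightarrow> a \<odot> m \<in> carrier M"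
    and op_distr: "\<lbrakk>a \<in> carrier A; m \<in> carrier M; n \<in> carrier M\<rbrakk> \<Longrightarrow>
      a \<odot> (m \<oplus> n) = a \<odot> m \<oplus> a \<odot> n"

text \<open>Unlike in \<open>module_hom\<close>, the maps need not be extensional, so they compose
  as plain functions; \<open>module_hom_iff\<close> and \<open>restrict_module_hom\<close> pass
  between the two notions.\<close>

definition operator_hom ::
    "('a, 'r) ring_scheme \<Rightarrow> ('a, 'm, 'x) module_scheme \<Rightarrow> ('a, 'n, 'y) module_scheme \<Rightarrow> ('m \<Rightarrow> 'n) \<Rightarrow> bool"
  where
  "operator_hom A M N f \<longleftrightarrow> f \<in> carrier M \<rightarrow> carrier N \<and>
     (\<forall>m\<in>carrier M. \<forall>n\<in>carrier M. f (m \<oplus>\<^bsub>M\<^esub> n) = f m \<oplus>\<^bsub>N\<^esub> f n) \<and>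
     (\<forall>a\<in>carrier A. \<forall>m\<in>carrier M. f (a \<odot>\<^bsub>M\<^esub> m) = a \<odot>\<^bsub>N\<^esub> f m)"

lemma operator_homI:
  assumes "\<And>m. m \<in> carrier M \<Longrightarrow> f m \<in> carrier N"
    and "\<And>m n. m \<in> carrier M \<Longrightarrow> n \<in> carrier M \<Longrightarrow> f (m \<oplus>\<^bsub>M\<^esub> n) = f m \<oplus>\<^bsub>N\<^esub> f n"
    and "\<And>a m. a \<in> carrier A \<Longrightarrow> m \<in> carrier M \<Longrightarrow> f (a \<odot>\<^bsub>M\<^esub> m) = a \<odot>\<^bsub>N\<^esub> f m"
  shows "operator_hom A M N f"
  using assms by (auto simp: operator_hom_def)

lemma
  assumes "operator_hom A M N f"
  shows operator_hom_closed: "m \<in> carrier M \<Longrightarrow> f m \<in> carrier N"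
    and operator_hom_add: "m \<in> carrier M \<Longrightarrow> n \<in> carrier M \<Longrightarrow> f (m \<oplus>\<^bsub>M\<^esub> n) = f m \<oplus>\<^bsub>N\<^esub> f n"
    and operator_hom_smult: "a \<in> carrier A \<Longrightarrow> m \<in> carrier M \<Longrightarrow> f (a \<odot>\<^bsub>M\<^esub> m) = a \<odot>\<^bsub>N\<^esub> f m"
  using assms by (auto simp: operator_hom_def)

lemma module_hom_iff:
  "f \<in> module_hom A M N \<longleftrightarrow> operator_hom A M N f \<and> f \<in> extensional (carrier M)"
  by (auto simp: module_hom_def operator_hom_def PiE_def)

lemma operator_hom_comp:
  assumes "operator_hom A M N f" "operator_hom A N Q g"
  shows "operator_hom A M Q (\<lambda>m. g (f m))"
  using assms by (auto simp: operator_hom_def Pi_iff)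

lemma operator_hom_cong:
  assumes "operator_group A M" "\<And>m. m \<in> carrier M \<Longrightarrow> f m = g m"
  shows "operator_hom A M N f = operator_hom A M N g"
proof -
  interpret operator_group A M by fact
  show ?thesis
    by (simp add: operator_hom_def assms(2) op_closed Pi_iff)
qed

lemma restrict_module_hom:
  assumes "operator_group A M" "operator_hom A M N f"
  shows "restrict f (carrier M) \<in> module_hom A M N"
  using assms operator_hom_cong[OF assms(1), of f "restrict f (carrier M)" N]
  by (simp add: module_hom_iff)

lemma operator_hom_abelian_group_hom:
  assumes "abelian_group M" "abelian_group N" "operator_hom A M N f"
  shows "abelian_group_hom M N f"
proof -
  interpret M: abelian_group M by fact
  interpret N: abelian_group N by fact
  show ?thesis
    using assms(3) M.a_group N.a_group
    by (intro abelian_group_homI assms)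
       (auto simp: operator_hom_def group_hom_def group_hom_axioms_def hom_def)
qed

lemma operator_hom_zero:
  assumes "abelian_group M" "abelian_group N" "operator_hom A M N f"
  shows "f \<zero>\<^bsub>M\<^esub> = \<zero>\<^bsub>N\<^esub>"
  by (rule abelian_group_hom.hom_zero[OF operator_hom_abelian_group_hom[OF assms]])

lemma operator_hom_minus:
  assumes "abelian_group M" "abelian_group N" "operator_hom A M N f" "m \<in> carrier M" "n \<in> carrier M"
  shows "f (m \<ominus>\<^bsub>M\<^esub> n) = f m \<ominus>\<^bsub>N\<^esub> f n"
proof -
  interpret abelian_group_hom M N f
    by (rule operator_hom_abelian_group_hom[OF assms(1-3)])
  show ?thesis
    using assms by (simp add: G.minus_eq H.minus_eq)
qed

lemma operator_hom_inv_into: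
  assumes M: "operator_group A M" and f: "operator_hom A M N f"
    and bij: "bij_betw f (carrier M) (carrier N)"
  shows "operator_hom A N M (inv_into (carrier M) f)"
proof -
  interpret operator_group A M by fact
  let ?g = "inv_into (carrier M) f"
  have g: "?g n \<in> carrier M" "f (?g n) = n" if "n \<in> carrier N" for n
    using that bij by (auto simp: bij_betw_def inv_into_into f_inv_into_f)
  have eq: "?g n = m" if "m \<in> carrier M" "f m = n" for m n
    using that bij by (auto simp: bij_betw_def)
  show ?thesis
    by (intro operator_homI eq)
       (auto simp: g op_closed operator_hom_add[OF f] operator_hom_smult[OF f])
qed

text \<open>\<open>Q\<close> is a common model. In the end it is
  \<open>incidence_line (row x)\<close>, so that two modules of cosets are never compared
  directly.\<close>

lemma module_isomorphicI:
  assumes M: "operator_group A M" and N: "operator_group A N"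
    and f: "operator_hom A M Q f" "bij_betw f (carrier M) (carrier Q)"
    and g: "operator_hom A N Q g" "bij_betw g (carrier N) (carrier Q)"
  shows "module_isomorphic A M N"
proof -
  let ?h = "\<lambda>m. inv_into (carrier N) g (f m)"
  have "operator_hom A M N ?h"
    by (rule operator_hom_comp[OF f(1) operator_hom_inv_into[OF N g]])
  moreover have "bij_betw ?h (carrier M) (carrier N)"
    using bij_betw_trans[OF f(2) bij_betw_inv_into[OF g(2)]] by (simp add: o_def)
  moreover have "bij_betw (restrict ?h (carrier M)) (carrier M) (carrier N) = bij_betw ?h (carrier M) (carrier N)"
    by (rule bij_betw_cong) simp
  ultimately show ?thesis
    unfolding module_isomorphic_def by (metis restrict_module_hom[OF M])
qed

lemma submodule_kernel:
  assumes M: "operator_group A M" and N: "operator_group A N" and f: "operator_hom A M N f"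
  shows "submodule (a_kernel M N f) A M"
proof -
  interpret M: operator_group A M by fact
  interpret N: operator_group A N by fact
  interpret abelian_group_hom M N f
    by (rule operator_hom_abelian_group_hom[OF M.abelian_group_axioms N.abelian_group_axioms f])
  have "a \<odot>\<^bsub>N\<^esub> \<zero>\<^bsub>N\<^esub> = \<zero>\<^bsub>N\<^esub>" if "a \<in> carrier A" for a
  proof -
    have "a \<odot>\<^bsub>N\<^esub> \<zero>\<^bsub>N\<^esub> \<oplus>\<^bsub>N\<^esub> a \<odot>\<^bsub>N\<^esub> \<zero>\<^bsub>N\<^esub> = a \<odot>\<^bsub>N\<^esub> \<zero>\<^bsub>N\<^esub>"
      using N.op_distr[OF that N.zero_closed N.zero_closed] by simp
    then show ?thesis
      using N.op_closed[OF that N.zero_closed] N.add.r_cancel_one' by metis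
  qed
  then show ?thesis
    using additive_subgroup.a_subgroup[OF additive_subgroup_a_kernel]
    by (intro submodule.intro submodule_axioms.intro)
       (auto simp: a_kernel_def' M.op_closed operator_hom_smult[OF f])
qed

text \<open>The scalar action of \<open>quotient_module\<close> is a union over all representatives
  of a coset. Since \<open>N\<close> is stable under scalars, each representative contributes the
  same coset, and the union collapses to it.\<close>

lemma quotient_operator_group:
  assumes M: "operator_group A M" and S: "submodule N A M"
  shows "operator_group A (quotient_module M N)"
    and "\<lbrakk>a \<in> carrier A; m \<in> carrier M\<rbrakk> \<Longrightarrow>
      a \<odot>\<^bsub>quotient_module M N\<^esub> (N +>\<^bsub>M\<^esub> m) = N +>\<^bsub>M\<^esub> (a \<odot>\<^bsub>M\<^esub> m)"
proof -
  interpret M: operator_group A M by fact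
  interpret abelian_subgroup N M
    by (rule abelian_subgroupI3)
       (simp_all add: additive_subgroupI submodule.axioms(1)[OF S] M.abelian_group_axioms)
  let ?Q = "quotient_module M N"
  interpret F: comm_group "M A_Mod N"
    by (rule a_factorgroup_is_comm_group)
  \<comment> \<open>The additive structure is borrowed from the library's factor group, which is
    written multiplicatively.\<close>
  have Q: "carrier ?Q = carrier (M A_Mod N)" "(\<oplus>\<^bsub>?Q\<^esub>) = (\<otimes>\<^bsub>M A_Mod N\<^esub>)" "\<zero>\<^bsub>?Q\<^esub> = \<one>\<^bsub>M A_Mod N\<^esub>"
    by (simp_all add: quotient_module_def A_FactGroup_def FactGroup_def A_RCOSETS_def set_add_def)
  interpret Q: abelian_group ?Q
    using F.l_inv_ex by (intro abelian_groupI) (simp_all add: Q F.m_assoc F.m_ac del: add_A_FactGroup)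
  have sm: "a \<odot>\<^bsub>?Q\<^esub> (N +>\<^bsub>M\<^esub> m) = N +>\<^bsub>M\<^esub> (a \<odot>\<^bsub>M\<^esub> m)"
    if a: "a \<in> carrier A" and m: "m \<in> carrier M" for a m
  proof -
    have "N +>\<^bsub>M\<^esub> (a \<odot>\<^bsub>M\<^esub> x) = N +>\<^bsub>M\<^esub> (a \<odot>\<^bsub>M\<^esub> m)" if x: "x \<in> N +>\<^bsub>M\<^esub> m" for x
    proof -
      obtain n where n: "n \<in> N" "x = n \<oplus>\<^bsub>M\<^esub> m"
        using x by (auto simp: a_r_coset_def')
      have "a \<odot>\<^bsub>M\<^esub> n \<in> N"
        using n a submodule.smult_closed[OF S] by auto
      moreover have "a \<odot>\<^bsub>M\<^esub> x = a \<odot>\<^bsub>M\<^esub> n \<oplus>\<^bsub>M\<^esub> a \<odot>\<^bsub>M\<^esub> m"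
        using n a m by (simp add: M.op_distr)
      ultimately have "a \<odot>\<^bsub>M\<^esub> x \<in> N +>\<^bsub>M\<^esub> (a \<odot>\<^bsub>M\<^esub> m)"
        by (auto simp: a_r_coset_def')
      then show ?thesis
        using a_repr_independence'[of "a \<odot>\<^bsub>M\<^esub> x" "a \<odot>\<^bsub>M\<^esub> m"] a m M.op_closed by simp
    qed
    moreover have "N +>\<^bsub>M\<^esub> m \<noteq> {}"
      using a_rcos_self[OF m] by auto
    ultimately show ?thesis
      by (auto simp: quotient_module_def)
  qed
  have rep: "\<exists>m\<in>carrier M. X = N +>\<^bsub>M\<^esub> m" if "X \<in> carrier ?Q" for X
    using that by (auto simp: quotient_module_def A_RCOSETS_def')
  have carr: "N +>\<^bsub>M\<^esub> m \<in> carrier ?Q" if "m \<in> carrier M" for m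
    using that by (auto simp: quotient_module_def A_RCOSETS_def')
  have add: "(N +>\<^bsub>M\<^esub> m) \<oplus>\<^bsub>?Q\<^esub> (N +>\<^bsub>M\<^esub> n) = N +>\<^bsub>M\<^esub> (m \<oplus>\<^bsub>M\<^esub> n)"
    if "m \<in> carrier M" "n \<in> carrier M" for m n
    using a_rcos_sum[OF that] by (simp add: quotient_module_def)
  show "operator_group A ?Q"
  proof
    show "a \<odot>\<^bsub>?Q\<^esub> X \<in> carrier ?Q" if "a \<in> carrier A" "X \<in> carrier ?Q" for a X
      using rep[OF that(2)] that(1) by (auto simp: sm carr M.op_closed)
    show "a \<odot>\<^bsub>?Q\<^esub> (X \<oplus>\<^bsub>?Q\<^esub> Y) = a \<odot>\<^bsub>?Q\<^esub> X \<oplus>\<^bsub>?Q\<^esub> a \<odot>\<^bsub>?Q\<^esub> Y"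
      if "a \<in> carrier A" "X \<in> carrier ?Q" "Y \<in> carrier ?Q" for a X Y
      using rep[OF that(2)] rep[OF that(3)] that(1)
      by (auto simp: sm add M.op_closed M.op_distr)
  qed
  show "\<lbrakk>a \<in> carrier A; m \<in> carrier M\<rbrakk> \<Longrightarrow> a \<odot>\<^bsub>?Q\<^esub> (N +>\<^bsub>M\<^esub> m) = N +>\<^bsub>M\<^esub> (a \<odot>\<^bsub>M\<^esub> m)"
    by (rule sm)
qed

text \<open>The first isomorphism theorem: \<open>f\<close> is constant on each coset of its kernel,
  so the image of a coset is a singleton and \<open>the_elem\<close> extracts the value.\<close>

lemma quotient_by_kernel:
  assumes M: "operator_group A M" and N: "operator_group A N" and f: "operator_hom A M N f"
    and surj: "f ` carrier M = carrier N"
  shows "\<exists>h. operator_hom A (quotient_module M (a_kernel M N f)) N h \<and>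
    bij_betw h (carrier (quotient_module M (a_kernel M N f))) (carrier N)"
proof -
  interpret M: operator_group A M by fact
  interpret N: operator_group A N by fact
  interpret abelian_group_hom M N f
    by (rule operator_hom_abelian_group_hom[OF M.abelian_group_axioms N.abelian_group_axioms f])
  let ?K = "a_kernel M N f" and ?h = "\<lambda>X. the_elem (f ` X)"
  let ?Q = "quotient_module M ?K"
  interpret K: abelian_subgroup ?K M by (rule abelian_subgroup_a_kernel)
  have carr: "carrier ?Q = carrier (M A_Mod ?K)"
    by (simp add: quotient_module_def A_FactGroup_def FactGroup_def A_RCOSETS_def)
  have val: "?h (?K +>\<^bsub>M\<^esub> m) = f m" if m: "m \<in> carrier M" for m
  proof -
    have "f y = f m" if y: "y \<in> ?K +>\<^bsub>M\<^esub> m" for y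
    proof -
      obtain k where "k \<in> carrier M" "f k = \<zero>\<^bsub>N\<^esub>" "y = k \<oplus>\<^bsub>M\<^esub> m"
        using y unfolding a_r_coset_def' a_kernel_def' by blast
      then show ?thesis
        using m by simp
    qed
    then have "f ` (?K +>\<^bsub>M\<^esub> m) \<subseteq> {f m}"
      by (simp add: image_subset_iff)
    moreover have "f m \<in> f ` (?K +>\<^bsub>M\<^esub> m)"
      using K.a_rcos_self[OF m] by (rule imageI)
    ultimately have "f ` (?K +>\<^bsub>M\<^esub> m) = {f m}"
      by auto
    then show ?thesis by simp
  qed
  have "operator_hom A ?Q N ?h"
  proof (rule operator_homI)
    show "?h X \<in> carrier N" if "X \<in> carrier ?Q" for X
      using that FactGroup_the_elem_mem by (simp add: carr)
    show "?h (X \<oplus>\<^bsub>?Q\<^esub> Y) = ?h X \<oplus>\<^bsub>N\<^esub> ?h Y" if "X \<in> carrier ?Q" "Y \<in> carrier ?Q" for X Y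
    proof -
      have "X \<oplus>\<^bsub>?Q\<^esub> Y = X <+>\<^bsub>M\<^esub> Y"
        by (simp add: quotient_module_def)
      then show ?thesis
        using A_FactGroup_hom that by (auto simp: carr hom_def)
    qed
    show "?h (a \<odot>\<^bsub>?Q\<^esub> X) = a \<odot>\<^bsub>N\<^esub> ?h X" if "a \<in> carrier A" "X \<in> carrier ?Q" for a X
    proof -
      obtain m where m: "m \<in> carrier M" "X = ?K +>\<^bsub>M\<^esub> m"
        using \<open>X \<in> carrier ?Q\<close> by (auto simp: quotient_module_def A_RCOSETS_def')
      then show ?thesis
        using that quotient_operator_group(2)[OF M submodule_kernel[OF M N f]]
        by (simp add: val M.op_closed operator_hom_smult[OF f])
    qed
  qed
  moreover have "bij_betw ?h (carrier ?Q) (carrier N)"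
    using A_FactGroup_inj_on A_FactGroup_onto[OF surj] by (simp add: carr bij_betw_def)
  ultimately show ?thesis by blast
qed

text \<open>By \<open>gen\<close>, every element outside the kernel generates \<open>M\<close>, so a
  submodule not contained in the kernel is all of \<open>M\<close>. The kernel is thus the only
  maximal submodule and equals the radical. Both \<open>e_x A\<close> and the dual of the nonzero
  Ext are treated this way.\<close>

lemma module_top_iso:
  assumes M: "operator_group A M" and N: "operator_group A N" and f: "operator_hom A M N f"
    and surj: "f ` carrier M = carrier N" and nontrivial: "carrier N \<noteq> {\<zero>\<^bsub>N\<^esub>}"
    and gen: "\<And>m n. m \<in> carrier M \<Longrightarrow> f m \<noteq> \<zero>\<^bsub>N\<^esub> \<Longrightarrow> n \<in> carrier M \<Longrightarrow> \<exists>a\<in>carrier A. a \<odot>\<^bsub>M\<^esub> m = n"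
  shows "operator_group A (module_top A M)"
    and "\<exists>h. operator_hom A (module_top A M) N h \<and> bij_betw h (carrier (module_top A M)) (carrier N)"
proof -
  interpret M: operator_group A M by fact
  interpret N: operator_group A N by fact
  let ?K = "a_kernel M N f"
  have sub: "N' \<subseteq> carrier M" if "submodule N' A M" for N'
    using subgroup.subset[OF submodule.axioms(1)[OF that]] by simp
  have big: "N' = carrier M" if N': "submodule N' A M" and m: "m \<in> N'" "m \<notin> ?K" for N' m
  proof -
    have "n \<in> N'" if "n \<in> carrier M" for n
      using gen[of m n] that m sub[OF N'] submodule.smult_closed[OF N', of _ m]
      by (auto simp: a_kernel_def')
    then show ?thesis using sub[OF N'] by auto
  qed
  obtain n where "n \<in> carrier N" "n \<noteq> \<zero>\<^bsub>N\<^esub>"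
    using nontrivial N.zero_closed by auto
  moreover from this obtain m where "m \<in> carrier M" "f m = n"
    unfolding surj[symmetric] by blast
  ultimately have "m \<in> carrier M - ?K"
    by (simp add: a_kernel_def')
  then have "?K \<noteq> carrier M"
    by blast
  then have K: "maximal_submodule ?K A M"
    using submodule_kernel[OF M N f] big unfolding maximal_submodule_def by blast
  have "N' = ?K" if "maximal_submodule N' A M" for N'
    using that K big unfolding maximal_submodule_def by blast
  then have "{N'. maximal_submodule N' A M} = {?K}"
    using K by blast
  then have rad: "module_radical A M = ?K"
    by (auto simp: module_radical_def a_kernel_def')
  show "operator_group A (module_top A M)"
    unfolding module_top_def rad by (rule quotient_operator_group(1)[OF M submodule_kernel[OF M N f]])
  show "\<exists>h. operator_hom A (module_top A M) N h \<and> bij_betw h (carrier (module_top A M)) (carrier N)"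
    unfolding module_top_def rad by (rule quotient_by_kernel[OF M N f surj])
qed

section \<open>Comparison of projective resolutions\<close>

lemma right_module_operator_group: "right_module A M \<Longrightarrow> operator_group A M"
  by (simp add: right_module_def right_module_axioms_def operator_group_def operator_group_axioms_def)

lemma (in operator_group) op_minus:
  assumes "a \<in> carrier A" "m \<in> carrier M"
  shows "a \<odot> (\<ominus> m) = \<ominus> (a \<odot> m)"
proof -
  have "a \<odot> \<zero> \<oplus> a \<odot> \<zero> = a \<odot> \<zero>"
    using op_distr[OF assms(1) zero_closed zero_closed] by simp
  then have "a \<odot> \<zero> = \<zero>"
    using op_closed[OF assms(1) zero_closed] add.r_cancel_one' by metis
  then have "a \<odot> (\<ominus> m) \<oplus> a \<odot> m = \<zero>"
    using op_distr[OF assms(1), of "\<ominus> m" m] assms by (simp add: l_neg)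
  then show ?thesis
    using assms by (intro minus_equality[symmetric]) (auto simp: op_closed)
qed

lemma operator_hom_diff:
  assumes N: "operator_group A N" and f: "operator_hom A M N f" and g: "operator_hom A M N g"
  shows "operator_hom A M N (\<lambda>m. f m \<ominus>\<^bsub>N\<^esub> g m)"
proof -
  interpret N: operator_group A N by fact
  note c = operator_hom_closed[OF f] operator_hom_closed[OF g]
  show ?thesis
    by (rule operator_homI)
       (simp_all add: c operator_hom_add[OF f] operator_hom_add[OF g] operator_hom_smult[OF f]
         operator_hom_smult[OF g] N.op_distr N.op_minus N.minus_eq N.minus_add N.a_ac N.op_closed)
qed

lemma right_module_right_free:
  assumes "ring A"
  shows "right_module A (right_free A n)"
proof -
  interpret ring A by fact
  let ?F = "right_free A n"
  have coord: "v i \<in> carrier A" if "v \<in> carrier ?F" for v i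
    using that by (cases "i < n") (auto simp: right_free_def)
  have "abelian_group ?F"
  proof (rule abelian_groupI)
    show "\<exists>w\<in>carrier ?F. w \<oplus>\<^bsub>?F\<^esub> v = \<zero>\<^bsub>?F\<^esub>" if "v \<in> carrier ?F" for v
      using that by (intro bexI[of _ "\<lambda>i. if i < n then \<ominus>\<^bsub>A\<^esub> v i else \<zero>\<^bsub>A\<^esub>"])
        (auto simp: right_free_def l_neg fun_eq_iff not_less)
    show "u \<oplus>\<^bsub>?F\<^esub> v \<oplus>\<^bsub>?F\<^esub> w = u \<oplus>\<^bsub>?F\<^esub> (v \<oplus>\<^bsub>?F\<^esub> w)"
      if "u \<in> carrier ?F" "v \<in> carrier ?F" "w \<in> carrier ?F" for u v w
      using that[THEN coord] by (simp add: right_free_def a_assoc)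
    show "u \<oplus>\<^bsub>?F\<^esub> v = v \<oplus>\<^bsub>?F\<^esub> u" if "u \<in> carrier ?F" "v \<in> carrier ?F" for u v
      using that[THEN coord] by (simp add: right_free_def a_comm)
    show "\<zero>\<^bsub>?F\<^esub> \<oplus>\<^bsub>?F\<^esub> u = u" if "u \<in> carrier ?F" for u
      using that[THEN coord] by (simp add: right_free_def)
  qed (auto simp: right_free_def)
  moreover have "right_module_axioms A ?F"
  proof
    show "(a \<otimes>\<^bsub>A\<^esub> b) \<odot>\<^bsub>?F\<^esub> u = b \<odot>\<^bsub>?F\<^esub> (a \<odot>\<^bsub>?F\<^esub> u)"
      if "a \<in> carrier A" "b \<in> carrier A" "u \<in> carrier ?F" for a b u
      using that(1,2) that(3)[THEN coord] by (simp add: right_free_def m_assoc)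
    show "(a \<oplus>\<^bsub>A\<^esub> b) \<odot>\<^bsub>?F\<^esub> u = a \<odot>\<^bsub>?F\<^esub> u \<oplus>\<^bsub>?F\<^esub> b \<odot>\<^bsub>?F\<^esub> u"
      if "a \<in> carrier A" "b \<in> carrier A" "u \<in> carrier ?F" for a b u
      using that(1,2) that(3)[THEN coord] by (simp add: right_free_def r_distr)
    show "a \<odot>\<^bsub>?F\<^esub> (u \<oplus>\<^bsub>?F\<^esub> v) = a \<odot>\<^bsub>?F\<^esub> u \<oplus>\<^bsub>?F\<^esub> a \<odot>\<^bsub>?F\<^esub> v"
      if "a \<in> carrier A" "u \<in> carrier ?F" "v \<in> carrier ?F" for a u v
      using that(1) that(2,3)[THEN coord] by (simp add: right_free_def l_distr)
    show "\<one>\<^bsub>A\<^esub> \<odot>\<^bsub>?F\<^esub> u = u" if "u \<in> carrier ?F" for u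
      using that[THEN coord] by (simp add: right_free_def)
  qed (auto simp: right_free_def)
  ultimately show ?thesis
    by (simp add: right_module_def ring_axioms)
qed

text \<open>A homomorphism out of a free module may be prescribed on the basis: each basis vector
  goes to a chosen preimage under \<open>g\<close> of its image under \<open>f\<close>.\<close>

lemma lift_free:
  assumes M: "right_module A M" and N: "abelian_group N" and g: "operator_hom A M N g"
    and f: "operator_hom A (right_free A n) N f" and im: "f ` carrier (right_free A n) \<subseteq> g ` carrier M"
  shows "\<exists>h. operator_hom A (right_free A n) M h \<and> (\<forall>v\<in>carrier (right_free A n). g (h v) = f v)"
proof -
  interpret M: right_module A M by fact
  interpret N: abelian_group N by fact
  interpret F: right_module A "right_free A n" by (rule right_module_right_free[OF M.A.ring_axioms])
  let ?F = "right_free A n"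
  define b where "b i = (\<lambda>j. if j = i then \<one>\<^bsub>A\<^esub> else \<zero>\<^bsub>A\<^esub>)" for i :: nat
  have b: "b i \<in> carrier ?F" if "i < n" for i
    using that by (auto simp: b_def right_free_def)
  \<comment> \<open>For indices from \<open>n\<close> on, zero is a witness, so that
    \<open>m\<close> can be total with all values in the carrier.\<close>
  have "\<exists>m. m \<in> carrier M \<and> (i < n \<longrightarrow> g m = f (b i))" for i
    using im b[of i] M.M.zero_closed by (cases "i < n") (auto simp: image_subset_iff, metis imageE)
  then obtain m where m: "\<And>i. m i \<in> carrier M" "\<And>i. i < n \<Longrightarrow> g (m i) = f (b i)"
    by metis
  have coord: "v i \<in> carrier A" if "v \<in> carrier ?F" for v i
    using that by (cases "i < n") (auto simp: right_free_def)
  \<comment> \<open>Partial sums, so that additivity, linearity and the lifting identity all follow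
    by induction on the number \<open>j\<close> of terms.\<close>
  define h where "h j v = (\<Oplus>\<^bsub>M\<^esub>i\<in>{..<j}. v i \<odot>\<^bsub>M\<^esub> m i)" for j :: nat and v
  have t: "(\<lambda>i. v i \<odot>\<^bsub>M\<^esub> m i) \<in> I \<rightarrow> carrier M" if "v \<in> carrier ?F" for v I
    using that m coord by (auto intro: M.smult_closed)
  have h_closed: "h j v \<in> carrier M" if "v \<in> carrier ?F" for j v
    unfolding h_def by (rule M.finsum_closed[OF t[OF that]])
  have h_Suc: "h (Suc j) v = h j v \<oplus>\<^bsub>M\<^esub> v j \<odot>\<^bsub>M\<^esub> m j" if "v \<in> carrier ?F" for j v
    unfolding h_def lessThan_Suc using that m coord
    by (subst M.finsum_insert) (auto intro!: M.smult_closed M.finsum_closed M.a_comm)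
  have h0: "h 0 v = \<zero>\<^bsub>M\<^esub>" for v
    by (simp add: h_def)
  have "operator_hom A ?F M (h j)" for j
  proof (rule operator_homI[OF h_closed])
    show "h j (v \<oplus>\<^bsub>?F\<^esub> w) = h j v \<oplus>\<^bsub>M\<^esub> h j w" if "v \<in> carrier ?F" "w \<in> carrier ?F" for v w
    proof (induction j)
      case (Suc j)
      have "(v \<oplus>\<^bsub>?F\<^esub> w) j = v j \<oplus>\<^bsub>A\<^esub> w j"
        by (simp add: right_free_def)
      then show ?case
        using that coord m h_closed
        by (simp add: h_Suc Suc M.smult_l_distr M.smult_closed M.M.add.m_ac)
    qed (simp add: h0)
    show "h j (a \<odot>\<^bsub>?F\<^esub> v) = a \<odot>\<^bsub>M\<^esub> h j v" if "a \<in> carrier A" "v \<in> carrier ?F" for a v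
    proof (induction j)
      case 0
      have "a \<odot>\<^bsub>M\<^esub> \<zero>\<^bsub>M\<^esub> \<oplus>\<^bsub>M\<^esub> a \<odot>\<^bsub>M\<^esub> \<zero>\<^bsub>M\<^esub> = a \<odot>\<^bsub>M\<^esub> \<zero>\<^bsub>M\<^esub>"
        using M.smult_r_distr[OF that(1) M.M.zero_closed M.M.zero_closed] by simp
      then have "a \<odot>\<^bsub>M\<^esub> \<zero>\<^bsub>M\<^esub> = \<zero>\<^bsub>M\<^esub>"
        using M.smult_closed[OF that(1) M.M.zero_closed] M.M.add.r_cancel_one' by metis
      then show ?case by (simp add: h0)
    next
      case (Suc j)
      have "(a \<odot>\<^bsub>?F\<^esub> v) j = v j \<otimes>\<^bsub>A\<^esub> a"
        by (simp add: right_free_def)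
      then show ?case
        using that coord m h_closed
        by (simp add: h_Suc Suc F.smult_closed M.smult_r_distr M.smult_closed M.smult_assoc)
    qed
  qed
  moreover have "g (h n v) = f v" if v: "v \<in> carrier ?F" for v
  proof -
    have g0: "g \<zero>\<^bsub>M\<^esub> = \<zero>\<^bsub>N\<^esub>" and f0: "f \<zero>\<^bsub>?F\<^esub> = \<zero>\<^bsub>N\<^esub>"
      by (rule operator_hom_zero[OF M.M.abelian_group_axioms N g],
          rule operator_hom_zero[OF F.M.abelian_group_axioms N f])
    \<comment> \<open>Truncations of \<open>v\<close>: the induction compares \<open>h j v\<close>
      with \<open>c j\<close>, and \<open>c n\<close> is \<open>v\<close> because vectors vanish
      from \<open>n\<close> on.\<close>
    define c where "c j = (\<lambda>i. if i < j then v i else \<zero>\<^bsub>A\<^esub>)" for j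
    have c: "c j \<in> carrier ?F" for j
      using v by (auto simp: c_def right_free_def)
    have "g (h j v) = f (c j)" if "j \<le> n" for j
      using that
    proof (induction j)
      case 0
      have "c 0 = \<zero>\<^bsub>?F\<^esub>"
        by (simp add: c_def right_free_def)
      then show ?case by (simp add: h0 g0 f0)
    next
      case (Suc j)
      have "c (Suc j) = c j \<oplus>\<^bsub>?F\<^esub> v j \<odot>\<^bsub>?F\<^esub> b j"
        using coord[OF v] by (auto simp: c_def b_def right_free_def fun_eq_iff less_Suc_eq)
      then show ?case
        using Suc coord[OF v] b[of j] m
        by (simp add: h_Suc[OF v] operator_hom_add[OF g] operator_hom_add[OF f] h_closed[OF v] c
            M.smult_closed F.smult_closed operator_hom_smult[OF g] operator_hom_smult[OF f])
    qed
    moreover have "c n = v"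
      using v by (auto simp: c_def right_free_def)
    ultimately show ?thesis by auto
  qed
  ultimately show ?thesis by blast
qed

text \<open>\<open>P\<close> is a retract of a free module: compose \<open>f\<close> with
  \<open>r\<close>, lift there, and restrict along \<open>s\<close>.\<close>

lemma lift_projective:
  assumes P: "fg_projective A P" and M: "right_module A M" and N: "abelian_group N"
    and g: "operator_hom A M N g" and f: "operator_hom A P N f" and im: "f ` carrier P \<subseteq> g ` carrier M"
  shows "\<exists>h. operator_hom A P M h \<and> (\<forall>p\<in>carrier P. g (h p) = f p)"
proof -
  obtain n s r where s: "operator_hom A P (right_free A n) s" and r: "operator_hom A (right_free A n) P r"
    and rs: "\<And>p. p \<in> carrier P \<Longrightarrow> r (s p) = p"
    using P by (auto simp: fg_projective_def module_hom_iff)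
  have "(\<lambda>v. f (r v)) ` carrier (right_free A n) \<subseteq> g ` carrier M"
    using im operator_hom_closed[OF r] by auto
  then obtain h where h: "operator_hom A (right_free A n) M h"
      "\<And>v. v \<in> carrier (right_free A n) \<Longrightarrow> g (h v) = f (r v)"
    using lift_free[OF M N g operator_hom_comp[OF r f]] by auto
  then show ?thesis
    using operator_hom_comp[OF s h(1)] operator_hom_closed[OF s] rs
    by (intro exI[of _ "\<lambda>p. h (s p)"]) auto
qed

text \<open>The type of the elements of \<open>P\<close> is left free, so that both the chosen
  resolution inside free modules and the Koszul complex are instances.\<close>

locale resolution = A: ring A + N: abelian_group N
  for A :: "('a, 'r) ring_scheme" and N :: "('a, 'm, 'x) module_scheme" and P :: "nat \<Rightarrow> ('a, 'p) module"
    and d :: "nat \<Rightarrow> 'p \<Rightarrow> 'p" and \<epsilon> :: "'p \<Rightarrow> 'm" +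
  assumes projective_resolution: "projective_resolution A N P d \<epsilon>"
begin

lemma fg_projective: "fg_projective A (P i)"
  using projective_resolution by (simp add: projective_resolution_def)

lemma right_module: "right_module A (P i)"
  using fg_projective by (simp add: fg_projective_def)

lemma operator_group: "operator_group A (P i)"
  by (rule right_module_operator_group[OF right_module])

sublocale P: operator_group A "P i" for i
  by (rule operator_group)

lemma hom: "operator_hom A (P (Suc i)) (P i) (d i)"
  using projective_resolution by (simp add: projective_resolution_def module_hom_iff)

lemma hom_aug: "operator_hom A (P 0) N \<epsilon>"
  using projective_resolution by (simp add: projective_resolution_def module_hom_iff)

lemma aug_surj: "\<epsilon> ` carrier (P 0) = carrier N"
  using projective_resolution by (simp add: projective_resolution_def)

lemma exact_0: "d 0 ` carrier (P 1) = {p \<in> carrier (P 0). \<epsilon> p = \<zero>\<^bsub>N\<^esub>}"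
  using projective_resolution by (simp add: projective_resolution_def a_kernel_def')

lemma exact_Suc: "d (Suc i) ` carrier (P (Suc (Suc i))) = {p \<in> carrier (P (Suc i)). d i p = \<zero>\<^bsub>P i\<^esub>}"
  using projective_resolution by (simp add: projective_resolution_def a_kernel_def')

lemma closed: "p \<in> carrier (P (Suc i)) \<Longrightarrow> d i p \<in> carrier (P i)"
  by (rule operator_hom_closed[OF hom])

lemma square_zero: "p \<in> carrier (P (Suc (Suc i))) \<Longrightarrow> d i (d (Suc i) p) = \<zero>\<^bsub>P i\<^esub>"
  using exact_Suc[of i] by blast

lemma aug_zero: "p \<in> carrier (P 1) \<Longrightarrow> \<epsilon> (d 0 p) = \<zero>\<^bsub>N\<^esub>"
  using exact_0 by blast

end

definition chain_map ::
    "('a, 'r) ring_scheme \<Rightarrow> (nat \<Rightarrow> ('a, 'p) module) \<Rightarrow> (nat \<Rightarrow> 'p \<Rightarrow> 'p) \<Rightarrow>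
     (nat \<Rightarrow> ('a, 'q) module) \<Rightarrow> (nat \<Rightarrow> 'q \<Rightarrow> 'q) \<Rightarrow> (nat \<Rightarrow> 'p \<Rightarrow> 'q) \<Rightarrow> bool" where
  "chain_map A P d Q e F \<longleftrightarrow> (\<forall>i. operator_hom A (P i) (Q i) (F i)) \<and>
     (\<forall>i. \<forall>p\<in>carrier (P (Suc i)). e i (F (Suc i) p) = F i (d i p))"

text \<open>The comparison theorem: exactness of the target turns the vanishing of consecutive
  composites into a lifting problem, which projectivity of the source solves degree by
  degree.\<close>

lemma chain_map_exists:
  assumes "resolution A N P d \<epsilon>" and "resolution A N Q e \<eta>"
  shows "\<exists>F. chain_map A P d Q e F \<and> (\<forall>p\<in>carrier (P 0). \<eta> (F 0 p) = \<epsilon> p)"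
proof -
  interpret P: resolution A N P d \<epsilon> by fact
  interpret Q: resolution A N Q e \<eta> by fact
  obtain F0 where F0: "operator_hom A (P 0) (Q 0) F0" "\<And>p. p \<in> carrier (P 0) \<Longrightarrow> \<eta> (F0 p) = \<epsilon> p"
    using lift_projective[OF P.fg_projective Q.right_module P.N.abelian_group_axioms Q.hom_aug P.hom_aug]
      P.aug_surj Q.aug_surj by auto
  \<comment> \<open>The invariant carries the inclusion of images that the next lift needs; its last
    conjunct pins the start to the lift compatible with the augmentations.\<close>
  let ?R = "\<lambda>i f. operator_hom A (P i) (Q i) f \<and>
      (\<lambda>p. f (d i p)) ` carrier (P (Suc i)) \<subseteq> e i ` carrier (Q (Suc i)) \<and>
      (i = 0 \<longrightarrow> f = F0)"
  have "\<exists>F. \<forall>i. ?R i (F i) \<and> (\<forall>p\<in>carrier (P (Suc i)). e i (F (Suc i) p) = F i (d i p))"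
  proof (rule dependent_nat_choice)
    have "(\<lambda>p. F0 (d 0 p)) ` carrier (P (Suc 0)) \<subseteq> e 0 ` carrier (Q 1)"
      unfolding Q.exact_0
      using F0 P.closed[of _ 0] P.aug_zero operator_hom_closed[OF F0(1)] by auto
    then show "\<exists>f. ?R 0 f"
      using F0 by auto
  next
    fix f i assume f: "?R i f"
    obtain f' where f': "operator_hom A (P (Suc i)) (Q (Suc i)) f'"
        "\<And>p. p \<in> carrier (P (Suc i)) \<Longrightarrow> e i (f' p) = f (d i p)"
      using lift_projective[OF P.fg_projective Q.right_module Q.P.abelian_group_axioms Q.hom
          operator_hom_comp[OF P.hom conjunct1[OF f]]] f by auto
    have "f \<zero>\<^bsub>P i\<^esub> = \<zero>\<^bsub>Q i\<^esub>"
      using f by (intro operator_hom_zero[OF P.P.abelian_group_axioms Q.P.abelian_group_axioms]) auto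
    then have "(\<lambda>p. f' (d (Suc i) p)) ` carrier (P (Suc (Suc i))) \<subseteq> e (Suc i) ` carrier (Q (Suc (Suc i)))"
      unfolding Q.exact_Suc
      using f' P.closed P.square_zero operator_hom_closed[OF f'(1)] by auto
    then show "\<exists>f'. ?R (Suc i) f' \<and> (\<forall>p\<in>carrier (P (Suc i)). e i (f' p) = f (d i p))"
      using f' by blast
  qed
  then obtain F where F: "\<And>i. ?R i (F i)" "\<And>i. \<forall>p\<in>carrier (P (Suc i)). e i (F (Suc i) p) = F i (d i p)"
    by blast
  have "F 0 = F0" using F(1)[of 0] by simp
  then show ?thesis
    using F F0 by (intro exI[of _ F]) (auto simp: chain_map_def)
qed

text \<open>Lifts of the identity of \<open>N\<close> are unique up to homotopy, here for
  \<open>F\<close> against the identity. The identity is kept as a summand instead of being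
  subtracted, so that a cocycle can be applied term by term.\<close>

lemma homotopy_exists:
  assumes "resolution A N P d \<epsilon>" and F: "chain_map A P d P d F"
    and aug: "\<forall>p\<in>carrier (P 0). \<epsilon> (F 0 p) = \<epsilon> p"
  shows "\<exists>h. (\<forall>i. operator_hom A (P i) (P (Suc i)) (h i)) \<and>
    (\<forall>p\<in>carrier (P 0). F 0 p = d 0 (h 0 p) \<oplus>\<^bsub>P 0\<^esub> p) \<and>
    (\<forall>i. \<forall>p\<in>carrier (P (Suc i)).
      F (Suc i) p = d (Suc i) (h (Suc i) p) \<oplus>\<^bsub>P (Suc i)\<^esub> h i (d i p) \<oplus>\<^bsub>P (Suc i)\<^esub> p)"
proof -
  interpret P: resolution A N P d \<epsilon> by fact
  have F_hom: "operator_hom A (P i) (P i) (F i)" for i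
    using F by (simp add: chain_map_def)
  have F_comm: "d i (F (Suc i) p) = F i (d i p)" if "p \<in> carrier (P (Suc i))" for i p
    using F that by (simp add: chain_map_def)
  have id: "operator_hom A (P i) (P i) (\<lambda>p. p)" for i
    by (simp add: operator_hom_def)
  define D where "D i p = F i p \<ominus>\<^bsub>P i\<^esub> p" for i p
  have D: "operator_hom A (P i) (P i) (D i)" for i
    unfolding D_def by (rule operator_hom_diff[OF P.operator_group F_hom id])
  note D_closed = operator_hom_closed[OF D]
  have D_comm: "d i (D (Suc i) p) = D i (d i p)" if "p \<in> carrier (P (Suc i))" for i p
    using operator_hom_minus[OF P.P.abelian_group_axioms P.P.abelian_group_axioms P.hom] that
      operator_hom_closed[OF F_hom]
    by (simp add: D_def F_comm)
  have "\<epsilon> (D 0 p) = \<zero>\<^bsub>N\<^esub>" if "p \<in> carrier (P 0)" for p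
    using operator_hom_minus[OF P.P.abelian_group_axioms P.N.abelian_group_axioms P.hom_aug] that
      operator_hom_closed[OF F_hom] aug operator_hom_closed[OF P.hom_aug]
    by (simp add: D_def P.N.r_neg P.N.minus_eq)
  then have "D 0 ` carrier (P 0) \<subseteq> d 0 ` carrier (P (Suc 0))"
    using P.exact_0 D_closed by auto
  then obtain h0 where h0: "operator_hom A (P 0) (P 1) h0" "\<And>p. p \<in> carrier (P 0) \<Longrightarrow> d 0 (h0 p) = D 0 p"
    using lift_projective[OF P.fg_projective P.right_module P.P.abelian_group_axioms P.hom D, of 0] by auto
  \<comment> \<open>The second conjunct says \<open>d h d = D d\<close>. It makes the difference of
    \<open>D\<close> and \<open>h d\<close> one degree higher a cycle, hence a boundary by
    exactness.\<close>
  let ?R = "\<lambda>i f. operator_hom A (P i) (P (Suc i)) f \<and>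
      (\<forall>p\<in>carrier (P (Suc i)). d i (f (d i p)) = D i (d i p)) \<and> (i = 0 \<longrightarrow> f = h0)"
  let ?S = "\<lambda>i f f'. \<forall>p\<in>carrier (P (Suc i)). d (Suc i) (f' p) = D (Suc i) p \<ominus>\<^bsub>P (Suc i)\<^esub> f (d i p)"
  have "\<exists>h. \<forall>i. ?R i (h i) \<and> ?S i (h i) (h (Suc i))"
  proof (rule dependent_nat_choice)
    show "\<exists>f. ?R 0 f"
      using h0 P.closed by auto
  next
    fix f i assume f: "?R i f"
    have hom: "operator_hom A (P (Suc i)) (P (Suc i)) (\<lambda>p. D (Suc i) p \<ominus>\<^bsub>P (Suc i)\<^esub> f (d i p))"
      using f by (intro operator_hom_diff[OF P.operator_group D] operator_hom_comp[OF P.hom]) auto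
    have fc: "f (d i p) \<in> carrier (P (Suc i))" if "p \<in> carrier (P (Suc i))" for p
      by (rule operator_hom_closed[OF conjunct1[OF f] P.closed[OF that]])
    have "d i (D (Suc i) p \<ominus>\<^bsub>P (Suc i)\<^esub> f (d i p)) = \<zero>\<^bsub>P i\<^esub>" if p: "p \<in> carrier (P (Suc i))" for p
      using operator_hom_minus[OF P.P.abelian_group_axioms P.P.abelian_group_axioms P.hom D_closed[OF p] fc[OF p]]
        f p P.closed[OF p] D_closed
      by (simp add: D_comm P.P.r_neg P.P.minus_eq)
    then have "(\<lambda>p. D (Suc i) p \<ominus>\<^bsub>P (Suc i)\<^esub> f (d i p)) ` carrier (P (Suc i))
        \<subseteq> d (Suc i) ` carrier (P (Suc (Suc i)))"
      unfolding P.exact_Suc using operator_hom_closed[OF hom] by auto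
    then obtain f' where f': "operator_hom A (P (Suc i)) (P (Suc (Suc i))) f'" "?S i f f'"
      using lift_projective[OF P.fg_projective P.right_module P.P.abelian_group_axioms P.hom hom] by auto
    have "f \<zero>\<^bsub>P i\<^esub> = \<zero>\<^bsub>P (Suc i)\<^esub>"
      using f by (intro operator_hom_zero[OF P.P.abelian_group_axioms P.P.abelian_group_axioms]) auto
    then have "\<forall>p\<in>carrier (P (Suc (Suc i))). d (Suc i) (f' (d (Suc i) p)) = D (Suc i) (d (Suc i) p)"
      using f'(2) P.closed P.square_zero D_closed by (simp add: P.P.minus_eq)
    then show "\<exists>f'. ?R (Suc i) f' \<and> ?S i f f'"
      using f' by blast
  qed
  then obtain h where h: "\<And>i. ?R i (h i)" "\<And>i. ?S i (h i) (h (Suc i))"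
    by blast
  have h_closed: "h i p \<in> carrier (P (Suc i))" if "p \<in> carrier (P i)" for i p
    by (rule operator_hom_closed[OF conjunct1[OF h(1)] that])
  have F_eq: "F i p = D i p \<oplus>\<^bsub>P i\<^esub> p" if "p \<in> carrier (P i)" for i p
    using that operator_hom_closed[OF F_hom]
    by (simp add: D_def P.P.minus_eq P.P.a_assoc P.P.l_neg)
  have "F (Suc i) p = d (Suc i) (h (Suc i) p) \<oplus>\<^bsub>P (Suc i)\<^esub> h i (d i p) \<oplus>\<^bsub>P (Suc i)\<^esub> p"
    if p: "p \<in> carrier (P (Suc i))" for i p
    using h(2)[of i] p P.closed[OF p] h_closed D_closed[OF p]
    by (simp add: F_eq P.P.minus_eq P.P.a_assoc P.P.l_neg)
  moreover have "F 0 p = d 0 (h 0 p) \<oplus>\<^bsub>P 0\<^esub> p" if "p \<in> carrier (P 0)" for p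
    using h(1)[of 0] h0(2)[OF that] F_eq[OF that] by simp
  ultimately show ?thesis
    using h(1) by (intro exI[of _ h]) auto
qed

section \<open>Invariance of cohomology\<close>

lemma right_regular_simps [simp]:
  "carrier (right_regular A) = carrier A"
  "\<zero>\<^bsub>right_regular A\<^esub> = \<zero>\<^bsub>A\<^esub>"
  "m \<oplus>\<^bsub>right_regular A\<^esub> n = m \<oplus>\<^bsub>A\<^esub> n"
  "a \<odot>\<^bsub>right_regular A\<^esub> m = m \<otimes>\<^bsub>A\<^esub> a"
  by (simp_all add: right_regular_def)

lemma hom_to_ring_simps [simp]:
  "carrier (hom_to_ring A M) = module_hom A M (right_regular A)"
  "\<zero>\<^bsub>hom_to_ring A M\<^esub> = (\<lambda>p\<in>carrier M. \<zero>\<^bsub>A\<^esub>)"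
  "f \<oplus>\<^bsub>hom_to_ring A M\<^esub> g = (\<lambda>p\<in>carrier M. f p \<oplus>\<^bsub>A\<^esub> g p)"
  "a \<odot>\<^bsub>hom_to_ring A M\<^esub> f = (\<lambda>p\<in>carrier M. a \<otimes>\<^bsub>A\<^esub> f p)"
  by (simp_all add: hom_to_ring_def)

lemma operator_group_right_regular:
  assumes "ring A"
  shows "operator_group A (right_regular A)"
proof -
  interpret ring A by fact
  have "abelian_group (right_regular A)"
    by (rule abelian_groupI) (auto simp: a_ac l_neg intro: bexI[of _ "\<ominus>\<^bsub>A\<^esub> _"])
  then show ?thesis
    by (auto simp: operator_group_def operator_group_axioms_def l_distr)
qed

text \<open>Multiplying values from the left is compatible with the right action on arguments by
  associativity of \<open>A\<close>.\<close>

lemma hom_to_ring_operator_group: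
  assumes A: "ring A" and M: "operator_group A M"
  shows "operator_group A (hom_to_ring A M)"
proof -
  interpret A: ring A by fact
  interpret M: operator_group A M by fact
  let ?H = "module_hom A M (right_regular A)"
  have mem: "restrict f (carrier M) \<in> ?H" if "operator_hom A M (right_regular A) f" for f
    by (rule restrict_module_hom[OF M that])
  have H: "f \<in> ?H \<Longrightarrow> m \<in> carrier M \<Longrightarrow> n \<in> carrier M \<Longrightarrow> f (m \<oplus>\<^bsub>M\<^esub> n) = f m \<oplus>\<^bsub>A\<^esub> f n"
    "f \<in> ?H \<Longrightarrow> a \<in> carrier A \<Longrightarrow> m \<in> carrier M \<Longrightarrow> f (a \<odot>\<^bsub>M\<^esub> m) = f m \<otimes>\<^bsub>A\<^esub> a" for f m n a
    by (auto simp: module_hom_def)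
  have ext: "f \<in> extensional (carrier M)" if "f \<in> ?H" for f
    using that by (simp add: module_hom_iff)
  have closed: "f m \<in> carrier A" if "f \<in> ?H" "m \<in> carrier M" for f m
    using that by (auto simp: module_hom_def)
  have "abelian_group (hom_to_ring A M)"
  proof (rule abelian_groupI, unfold hom_to_ring_simps)
    show "(\<lambda>p\<in>carrier M. f p \<oplus>\<^bsub>A\<^esub> g p) \<in> ?H" if "f \<in> ?H" "g \<in> ?H" for f g
      using that by (intro mem operator_homI)
        (auto simp: H closed A.l_distr A.a_ac intro: A.a_closed)
    show "(\<lambda>p\<in>carrier M. \<zero>\<^bsub>A\<^esub>) \<in> ?H"
      by (intro mem operator_homI) auto
    show "\<exists>g\<in>?H. (\<lambda>p\<in>carrier M. g p \<oplus>\<^bsub>A\<^esub> f p) = (\<lambda>p\<in>carrier M. \<zero>\<^bsub>A\<^esub>)" if "f \<in> ?H" for f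
    proof
      show "(\<lambda>p\<in>carrier M. \<ominus>\<^bsub>A\<^esub> f p) \<in> ?H"
        using that by (intro mem operator_homI) (auto simp: H closed A.minus_add A.l_minus)
    qed (auto simp: closed[OF that] A.l_neg)
    show "(\<lambda>p\<in>carrier M. (\<lambda>p\<in>carrier M. \<zero>\<^bsub>A\<^esub>) p \<oplus>\<^bsub>A\<^esub> f p) = f" if "f \<in> ?H" for f
      using ext[OF that] closed[OF that] by (auto intro!: extensionalityI[of _ "carrier M"])
  qed (auto simp: closed A.a_ac intro!: restrict_ext)
  moreover have "operator_group_axioms A (hom_to_ring A M)"
  proof
    show "a \<odot>\<^bsub>hom_to_ring A M\<^esub> f \<in> carrier (hom_to_ring A M)"
      if "a \<in> carrier A" "f \<in> carrier (hom_to_ring A M)" for a f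
      using that unfolding hom_to_ring_simps
      by (intro mem operator_homI) (auto simp: H closed A.r_distr A.m_assoc)
    show "a \<odot>\<^bsub>hom_to_ring A M\<^esub> (f \<oplus>\<^bsub>hom_to_ring A M\<^esub> g) =
        a \<odot>\<^bsub>hom_to_ring A M\<^esub> f \<oplus>\<^bsub>hom_to_ring A M\<^esub> a \<odot>\<^bsub>hom_to_ring A M\<^esub> g"
      if "a \<in> carrier A" "f \<in> carrier (hom_to_ring A M)" "g \<in> carrier (hom_to_ring A M)" for a f g
      using that by (auto simp: closed A.r_distr intro!: restrict_ext)
  qed
  ultimately show ?thesis
    by (simp add: operator_group_def)
qed

lemma pullback_operator_hom:
  assumes M: "operator_group A M" and F: "operator_hom A M M' F"
  shows "operator_hom A (hom_to_ring A M') (hom_to_ring A M) (\<lambda>f. compose (carrier M) f F)"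
proof -
  interpret M: operator_group A M by fact
  note c = operator_hom_closed[OF F]
  show ?thesis
  proof (rule operator_homI)
    show "compose (carrier M) f F \<in> carrier (hom_to_ring A M)" if "f \<in> carrier (hom_to_ring A M')" for f
      using restrict_module_hom[OF M operator_hom_comp[OF F, of "right_regular A" f]] that
      by (simp add: compose_def module_hom_iff)
  qed (auto simp: compose_def c intro!: restrict_ext)
qed

lemma restrict_operator_group:
  assumes M: "operator_group A M" and N: "submodule N A M"
  shows "operator_group A (M\<lparr>carrier := N\<rparr>)"
proof -
  interpret M: operator_group A M by fact
  interpret N: additive_subgroup N M
    by (rule additive_subgroupI[OF submodule.axioms(1)[OF N]])
  note sub = N.a_subset[THEN subsetD]
  have "abelian_group (M\<lparr>carrier := N\<rparr>)"
  proof (rule abelian_groupI)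
    show "\<exists>y\<in>carrier (M\<lparr>carrier := N\<rparr>). y \<oplus>\<^bsub>M\<lparr>carrier := N\<rparr>\<^esub> x = \<zero>\<^bsub>M\<lparr>carrier := N\<rparr>\<^esub>"
      if "x \<in> carrier (M\<lparr>carrier := N\<rparr>)" for x
      using that sub by (intro bexI[of _ "\<ominus>\<^bsub>M\<^esub> x"]) (simp_all add: M.l_neg)
  qed (use sub in \<open>simp_all add: M.a_ac\<close>)
  then show ?thesis
    using sub submodule.smult_closed[OF N]
    by (simp add: operator_group_def operator_group_axioms_def M.op_distr)
qed

lemma restrict_right_module:
  assumes M: "right_module A M" and N: "submodule N A M"
  shows "right_module A (M\<lparr>carrier := N\<rparr>)"
proof -
  interpret M: right_module A M by fact
  interpret R: operator_group A "M\<lparr>carrier := N\<rparr>"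
    by (rule restrict_operator_group[OF right_module_operator_group[OF M] N])
  have "x \<in> carrier M" if "x \<in> N" for x
    using that subgroup.subset[OF submodule.axioms(1)[OF N]] by auto
  then show ?thesis
    using R.abelian_group_axioms M.A.ring_axioms submodule.smult_closed[OF N]
    by (simp add: right_module_def right_module_axioms_def M.smult_l_distr M.smult_r_distr
        M.smult_assoc M.smult_one)
qed

section \<open>Cocycles, coboundaries and the effect of homotopies\<close>

context resolution
begin

lemma cocycles_iff:
  "f \<in> cocycles A P d i \<longleftrightarrow>
    f \<in> module_hom A (P i) (right_regular A) \<and> (\<forall>p\<in>carrier (P (Suc i)). f (d i p) = \<zero>\<^bsub>A\<^esub>)"
  by (auto simp: cocycles_def a_kernel_def' cochain_map_def compose_def restrict_def fun_eq_iff)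

lemma coboundaries_iff:
  "f \<in> coboundaries A P d (Suc i) \<longleftrightarrow>
    (\<exists>g\<in>module_hom A (P i) (right_regular A). f = compose (carrier (P (Suc i))) g (d i))"
  by (auto simp: cochain_map_def)

lemma hom_operator_group: "operator_group A (hom_to_ring A (P i))"
  by (rule hom_to_ring_operator_group[OF A.ring_axioms operator_group])

lemma cocycles_submodule: "submodule (cocycles A P d i) A (hom_to_ring A (P i))"
  unfolding cocycles_def cochain_map_def
  by (intro submodule_kernel hom_operator_group pullback_operator_hom operator_group hom)

lemma cocycles_operator_group:
  "operator_group A ((hom_to_ring A (P i))\<lparr>carrier := cocycles A P d i\<rparr>)"
  by (rule restrict_operator_group[OF hom_operator_group cocycles_submodule])

lemma coboundaries_subset: "coboundaries A P d i \<subseteq> cocycles A P d i"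
proof (cases i)
  case 0
  then show ?thesis
    using additive_subgroup.zero_closed[OF additive_subgroupI[OF submodule.axioms(1)[OF cocycles_submodule]]]
    by auto
next
  case (Suc j)
  show ?thesis
  proof
    fix f assume "f \<in> coboundaries A P d i"
    then obtain g where g: "g \<in> module_hom A (P j) (right_regular A)"
        "f = compose (carrier (P i)) g (d j)"
      unfolding Suc coboundaries_iff by auto
    interpret R: operator_group A "right_regular A"
      by (rule operator_group_right_regular[OF A.ring_axioms])
    have "g \<zero>\<^bsub>P j\<^esub> = \<zero>\<^bsub>A\<^esub>"
      using operator_hom_zero[OF P.abelian_group_axioms R.abelian_group_axioms, of A] g(1)
      by (simp add: module_hom_iff)
    moreover have "f \<in> module_hom A (P i) (right_regular A)"
      using operator_hom_closed[OF pullback_operator_hom[OF operator_group hom]] g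
      unfolding Suc by simp
    ultimately show "f \<in> cocycles A P d i"
      using square_zero closed by (simp add: cocycles_iff g(2) Suc compose_def)
  qed
qed

lemma coboundaries_subgroup: "additive_subgroup (coboundaries A P d i) (hom_to_ring A (P i))"
proof (cases i)
  case 0
  interpret H: operator_group A "hom_to_ring A (P 0)" by (rule hom_operator_group)
  show ?thesis
    unfolding 0 coboundaries.simps
    using H.add.triv_subgroup by (intro additive_subgroupI) simp
next
  case (Suc j)
  interpret H: operator_group A "hom_to_ring A (P j)" by (rule hom_operator_group)
  interpret H': operator_group A "hom_to_ring A (P (Suc j))" by (rule hom_operator_group)
  interpret abelian_group_hom "hom_to_ring A (P j)" "hom_to_ring A (P (Suc j))" "cochain_map P d j"
    unfolding cochain_map_def
    by (intro operator_hom_abelian_group_hom[where A = A] H.abelian_group_axioms H'.abelian_group_axioms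
        pullback_operator_hom operator_group hom)
  show ?thesis
    using group_hom.img_is_subgroup[OF a_group_hom]
    by (intro additive_subgroupI) (simp add: Suc)
qed

text \<open>With \<open>F\<close> equal to the sum of \<open>d h\<close>, \<open>h d\<close> and the
  identity, the cocycle \<open>f\<close> kills the first term and turns the second into the
  coboundary of \<open>f h\<close>.\<close>

lemma cocycle_homotopy:
  assumes F: "chain_map A P d P d F" and aug: "\<forall>p\<in>carrier (P 0). \<epsilon> (F 0 p) = \<epsilon> p"
    and f: "f \<in> cocycles A P d i"
  shows "\<exists>b\<in>coboundaries A P d i. compose (carrier (P i)) f (F i) = b \<oplus>\<^bsub>hom_to_ring A (P i)\<^esub> f"
proof -
  obtain h where h_all: "(\<forall>i. operator_hom A (P i) (P (Suc i)) (h i)) \<and>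
      (\<forall>p\<in>carrier (P 0). F 0 p = d 0 (h 0 p) \<oplus>\<^bsub>P 0\<^esub> p) \<and>
      (\<forall>i. \<forall>p\<in>carrier (P (Suc i)).
        F (Suc i) p = d (Suc i) (h (Suc i) p) \<oplus>\<^bsub>P (Suc i)\<^esub> h i (d i p) \<oplus>\<^bsub>P (Suc i)\<^esub> p)"
    using homotopy_exists[OF resolution_axioms F aug] by (elim exE)
  have h: "operator_hom A (P i) (P (Suc i)) (h i)" for i
    using h_all by (elim conjE) (erule spec)
  have h0: "F 0 p = d 0 (h 0 p) \<oplus>\<^bsub>P 0\<^esub> p" if "p \<in> carrier (P 0)" for p
    using h_all that by (elim conjE) (erule bspec)
  have hS: "F (Suc i) p = d (Suc i) (h (Suc i) p) \<oplus>\<^bsub>P (Suc i)\<^esub> h i (d i p) \<oplus>\<^bsub>P (Suc i)\<^esub> p"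
    if "p \<in> carrier (P (Suc i))" for i p
    using h_all that by (elim conjE) (erule allE, erule bspec)
  note hc = operator_hom_closed[OF h]
  have fh: "f \<in> module_hom A (P i) (right_regular A)" and fd: "\<And>p. p \<in> carrier (P (Suc i)) \<Longrightarrow> f (d i p) = \<zero>\<^bsub>A\<^esub>"
    using f by (auto simp: cocycles_iff)
  have f': "operator_hom A (P i) (right_regular A) f"
    using fh by (simp add: module_hom_iff)
  have fc: "f p \<in> carrier A" if "p \<in> carrier (P i)" for p
    using operator_hom_closed[OF f' that] by simp
  show ?thesis
  proof (cases i)
    \<comment> \<open>In degree zero the term \<open>h d\<close> is absent, in accordance with
      \<open>coboundaries\<close>, which contain only zero there.\<close>
    case 0
    have "compose (carrier (P i)) f (F i) = \<zero>\<^bsub>hom_to_ring A (P i)\<^esub> \<oplus>\<^bsub>hom_to_ring A (P i)\<^esub> f"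
      using h0 hc[of _ 0] closed[of _ 0] fd fc operator_hom_add[OF f']
      by (auto simp: compose_def 0 intro!: restrict_ext)
    then show ?thesis
      by (auto simp: 0)
  next
    case (Suc j)
    let ?g = "\<lambda>p\<in>carrier (P j). f (h j p)"
    have "?g \<in> module_hom A (P j) (right_regular A)"
      using restrict_module_hom[OF operator_group operator_hom_comp[OF h[of j]]] f' Suc by simp
    then have "compose (carrier (P (Suc j))) ?g (d j) \<in> coboundaries A P d (Suc j)"
      unfolding coboundaries_iff by blast
    moreover have "f (F (Suc j) p) = f (h j (d j p)) \<oplus>\<^bsub>A\<^esub> f p" if p: "p \<in> carrier (P (Suc j))" for p
    proof -
      note c = closed[OF p] closed[OF hc[OF p]] hc[OF closed[OF p]]
      show ?thesis
        using fd[unfolded Suc, OF hc[OF p]] p c fc[unfolded Suc]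
        by (simp add: hS operator_hom_add[OF f'[unfolded Suc]])
    qed
    then have "compose (carrier (P i)) f (F i) =
        compose (carrier (P (Suc j))) ?g (d j) \<oplus>\<^bsub>hom_to_ring A (P i)\<^esub> f"
      using closed by (auto simp: compose_def Suc intro!: restrict_ext)
    ultimately show ?thesis
      using Suc by blast
  qed
qed

end

section \<open>Comparing the cohomology of two resolutions\<close>

lemma cocycles_pullback:
  assumes "resolution A N P d \<epsilon>" "resolution A N Q e \<eta>" "chain_map A Q e P d G" "f \<in> cocycles A P d i"
  shows "compose (carrier (Q i)) f (G i) \<in> cocycles A Q e i"
proof -
  interpret P: resolution A N P d \<epsilon> by fact
  interpret Q: resolution A N Q e \<eta> by fact
  have G: "operator_hom A (Q i) (P i) (G i)" for i
    using assms(3) by (simp add: chain_map_def)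
  have GS: "d i (G (Suc i) q) = G i (e i q)" if "q \<in> carrier (Q (Suc i))" for q
    using assms(3) that by (simp add: chain_map_def)
  show ?thesis
    using operator_hom_closed[OF pullback_operator_hom[OF Q.operator_group G]] assms(4)
      GS[symmetric] Q.closed operator_hom_closed[OF G]
    by (auto simp: P.cocycles_iff Q.cocycles_iff compose_def)
qed

lemma coboundaries_pullback:
  assumes "resolution A N P d \<epsilon>" "resolution A N Q e \<eta>" "chain_map A Q e P d G" "f \<in> coboundaries A P d i"
  shows "compose (carrier (Q i)) f (G i) \<in> coboundaries A Q e i"
proof -
  interpret P: resolution A N P d \<epsilon> by fact
  interpret Q: resolution A N Q e \<eta> by fact
  have G: "operator_hom A (Q i) (P i) (G i)" for i
    using assms(3) by (simp add: chain_map_def)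
  have GS: "d i (G (Suc i) q) = G i (e i q)" if "q \<in> carrier (Q (Suc i))" for i q
    using assms(3) that by (simp add: chain_map_def)
  show ?thesis
  proof (cases i)
    case 0
    then show ?thesis
      using assms(4) operator_hom_closed[OF G] by (auto simp: compose_def intro!: restrict_ext)
  next
    case (Suc j)
    obtain g where g: "g \<in> module_hom A (P j) (right_regular A)" "f = compose (carrier (P i)) g (d j)"
      using assms(4) unfolding Suc P.coboundaries_iff by auto
    have "compose (carrier (Q j)) g (G j) \<in> module_hom A (Q j) (right_regular A)"
      using operator_hom_closed[OF pullback_operator_hom[OF Q.operator_group G]] g by simp
    moreover have "compose (carrier (Q i)) f (G i) = compose (carrier (Q i)) (compose (carrier (Q j)) g (G j)) (e j)"
      using Q.closed operator_hom_closed[OF G] GS by (auto simp: compose_def g(2) Suc intro!: restrict_ext)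
    ultimately show ?thesis
      unfolding Suc Q.coboundaries_iff by blast
  qed
qed

text \<open>The cohomology of \<open>Q\<close> is known in the form of an epimorphism
  \<open>\<gamma>\<close> from its cocycles onto \<open>C\<close> with the coboundaries as kernel.
  Pulling back along comparison maps gives such an epimorphism for any other resolution
  \<open>P\<close>, because both composites of the comparison maps are homotopic to the
  identity.\<close>

lemma cohomology_iso:
  assumes "resolution A N P d \<epsilon>" "resolution A N Q e \<eta>" and C: "operator_group A C"
    and \<gamma>: "operator_hom A ((hom_to_ring A (Q i))\<lparr>carrier := cocycles A Q e i\<rparr>) C \<gamma>"
    and surj: "\<gamma> ` cocycles A Q e i = carrier C"
    and ker: "\<And>f. f \<in> cocycles A Q e i \<Longrightarrow> \<gamma> f = \<zero>\<^bsub>C\<^esub> \<longleftrightarrow> f \<in> coboundaries A Q e i"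
  shows "operator_group A (cohomology A P d i)"
    and "\<exists>h. operator_hom A (cohomology A P d i) C h \<and> bij_betw h (carrier (cohomology A P d i)) (carrier C)"
proof -
  interpret P: resolution A N P d \<epsilon> by fact
  interpret Q: resolution A N Q e \<eta> by fact
  interpret C: operator_group A C by fact
  obtain F where F: "chain_map A P d Q e F" "\<And>p. p \<in> carrier (P 0) \<Longrightarrow> \<eta> (F 0 p) = \<epsilon> p"
    using chain_map_exists[OF assms(1,2)] by auto
  obtain G where G: "chain_map A Q e P d G" "\<And>q. q \<in> carrier (Q 0) \<Longrightarrow> \<epsilon> (G 0 q) = \<eta> q"
    using chain_map_exists[OF assms(2,1)] by auto
  have Fh: "operator_hom A (P i) (Q i) (F i)" and Gh: "operator_hom A (Q i) (P i) (G i)" for i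
    using F G by (simp_all add: chain_map_def)
  note Fc = operator_hom_closed[OF Fh] and Gc = operator_hom_closed[OF Gh]
  have FG: "chain_map A Q e Q e (\<lambda>i q. F i (G i q))" and GF: "chain_map A P d P d (\<lambda>i p. G i (F i p))"
    using F(1) G(1) Fc Gc operator_hom_comp[OF Fh Gh] operator_hom_comp[OF Gh Fh]
    by (simp_all add: chain_map_def)
  let ?Z = "(hom_to_ring A (P i))\<lparr>carrier := cocycles A P d i\<rparr>"
  let ?p = "\<lambda>f. compose (carrier (Q i)) f (G i)" and ?q = "\<lambda>f. compose (carrier (P i)) f (F i)"
  define \<Phi> where "\<Phi> f = \<gamma> (?p f)" for f
  have p: "?p f \<in> cocycles A Q e i" if "f \<in> cocycles A P d i" for f
    by (rule cocycles_pullback[OF assms(1,2) G(1) that])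
  have q: "?q f \<in> cocycles A P d i" if "f \<in> cocycles A Q e i" for f
    by (rule cocycles_pullback[OF assms(2,1) F(1) that])
  have hZ: "cocycles A P d i \<subseteq> carrier (hom_to_ring A (P i))"
    by (auto simp: P.cocycles_iff)
  have "operator_hom A (hom_to_ring A (P i)) (hom_to_ring A (Q i)) ?p"
    by (rule pullback_operator_hom[OF Q.operator_group Gh])
  then have "operator_hom A ?Z ((hom_to_ring A (Q i))\<lparr>carrier := cocycles A Q e i\<rparr>) ?p"
    using p hZ by (simp add: operator_hom_def subset_iff)
  from operator_hom_comp[OF this \<gamma>] have \<Phi>: "operator_hom A ?Z C \<Phi>"
    unfolding \<Phi>_def .
  have \<gamma>_add: "\<gamma> (b \<oplus>\<^bsub>hom_to_ring A (Q i)\<^esub> f) = \<gamma> f"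
    if "b \<in> coboundaries A Q e i" "f \<in> cocycles A Q e i" for b f
  proof -
    have "b \<in> cocycles A Q e i"
      using that Q.coboundaries_subset by auto
    then show ?thesis
      using operator_hom_add[OF \<gamma>, of b f] ker[of b] that operator_hom_closed[OF \<gamma>, of f] by simp
  qed
  have "a_kernel ?Z C \<Phi> = coboundaries A P d i"
  proof (intro equalityI subsetI)
    fix f assume "f \<in> a_kernel ?Z C \<Phi>"
    then have f: "f \<in> cocycles A P d i" "\<gamma> (?p f) = \<zero>\<^bsub>C\<^esub>"
      by (auto simp: a_kernel_def' \<Phi>_def)
    then have "?p f \<in> coboundaries A Q e i"
      using ker p by blast
    then have "?q (?p f) \<in> coboundaries A P d i"
      by (rule coboundaries_pullback[OF assms(2,1) F(1)])
    moreover obtain b where b: "b \<in> coboundaries A P d i"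
        "compose (carrier (P i)) f (\<lambda>p. G i (F i p)) = b \<oplus>\<^bsub>hom_to_ring A (P i)\<^esub> f"
      using P.cocycle_homotopy[OF GF _ f(1)] F(2) G(2) Fc by auto
    moreover have "?q (?p f) = compose (carrier (P i)) f (\<lambda>p. G i (F i p))"
      using Fc by (auto simp: compose_def intro!: restrict_ext)
    \<comment> \<open>Pulling back along both maps changes \<open>f\<close> only by the coboundary
      \<open>b\<close>; as the result is a coboundary, so is \<open>f\<close>.\<close>
    ultimately have bf: "b \<oplus>\<^bsub>hom_to_ring A (P i)\<^esub> f \<in> coboundaries A P d i"
      by simp
    show "f \<in> coboundaries A P d i"
    proof -
      interpret H: operator_group A "hom_to_ring A (P i)" by (rule P.hom_operator_group)
      interpret B: additive_subgroup "coboundaries A P d i" "hom_to_ring A (P i)"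
        by (rule P.coboundaries_subgroup)
      have "\<ominus>\<^bsub>hom_to_ring A (P i)\<^esub> b \<oplus>\<^bsub>hom_to_ring A (P i)\<^esub> (b \<oplus>\<^bsub>hom_to_ring A (P i)\<^esub> f) = f"
        using b(1) f(1) hZ B.a_subset by (intro H.r_neg1) auto
      then show ?thesis
        using B.a_closed[OF B.a_inv_closed[OF b(1)] bf] by simp
    qed
  next
    fix f assume f: "f \<in> coboundaries A P d i"
    then have "f \<in> cocycles A P d i"
      using P.coboundaries_subset by auto
    moreover have "?p f \<in> coboundaries A Q e i"
      by (rule coboundaries_pullback[OF assms(1,2) G(1) f])
    ultimately show "f \<in> a_kernel ?Z C \<Phi>"
      using ker p by (simp add: a_kernel_def' \<Phi>_def)
  qed
  then have coh: "cohomology A P d i = quotient_module ?Z (a_kernel ?Z C \<Phi>)"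
    by (simp add: cohomology_def)
  have "c \<in> \<Phi> ` cocycles A P d i" if "c \<in> carrier C" for c
  proof -
    \<comment> \<open>A preimage of \<open>c\<close> in \<open>Q\<close> is pulled back to
      \<open>P\<close>. Returning to \<open>Q\<close> changes it by a coboundary, which
      \<open>\<gamma>\<close> ignores.\<close>
    obtain f where f: "f \<in> cocycles A Q e i" "\<gamma> f = c"
      using \<open>c \<in> carrier C\<close> surj by (metis imageE)
    obtain b where b: "b \<in> coboundaries A Q e i"
        "compose (carrier (Q i)) f (\<lambda>p. F i (G i p)) = b \<oplus>\<^bsub>hom_to_ring A (Q i)\<^esub> f"
      using Q.cocycle_homotopy[OF FG _ f(1)] F(2) G(2) Gc by auto
    moreover have "?p (?q f) = compose (carrier (Q i)) f (\<lambda>p. F i (G i p))"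
      using Gc by (auto simp: compose_def intro!: restrict_ext)
    ultimately have "\<Phi> (?q f) = c"
      using \<gamma>_add[OF b(1) f(1)] f(2) by (simp add: \<Phi>_def)
    then show ?thesis
      using q[OF f(1)] by blast
  qed
  then have surj': "\<Phi> ` carrier ?Z = carrier C"
    using operator_hom_closed[OF \<Phi>] by auto
  show "operator_group A (cohomology A P d i)"
    unfolding coh by (rule quotient_operator_group(1)[OF P.cocycles_operator_group
        submodule_kernel[OF P.cocycles_operator_group C \<Phi>]])
  show "\<exists>h. operator_hom A (cohomology A P d i) C h \<and> bij_betw h (carrier (cohomology A P d i)) (carrier C)"
    unfolding coh by (rule quotient_by_kernel[OF P.cocycles_operator_group C \<Phi> surj'])
qed

text \<open>\<open>chosen_resolution\<close> ranges over modules of vectors over \<open>A\<close>,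
  so a resolution with elements of another type does not yet show that the choice is meaningful.
  Each \<open>P i\<close> is replaced by its image under a split embedding \<open>s i\<close> into a
  free module, and the differentials are carried along by \<open>s\<close> and
  \<open>r\<close>.\<close>

lemma resolution_transport:
  assumes "resolution A N P d \<epsilon>"
  shows "\<exists>(P' :: nat \<Rightarrow> ('a, nat \<Rightarrow> 'a) module) d' \<epsilon>'. projective_resolution (A :: ('a, 'r) ring_scheme) N P' d' \<epsilon>'"
proof -
  interpret resolution A N P d \<epsilon> by fact
  have "\<exists>n s r. operator_hom A (P i) (right_free A n) s \<and> operator_hom A (right_free A n) (P i) r \<and>
      (\<forall>p\<in>carrier (P i). r (s p) = p)" for i
    using fg_projective[of i] unfolding fg_projective_def Bex_def module_hom_iff by blast
  then obtain n s r where s: "\<And>i. operator_hom A (P i) (right_free A (n i)) (s i)"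
    and r: "\<And>i. operator_hom A (right_free A (n i)) (P i) (r i)"
    and rs: "\<And>i p. p \<in> carrier (P i) \<Longrightarrow> r i (s i p) = p"
    by metis
  let ?F = "\<lambda>i. right_free A (n i)"
  interpret F: operator_group A "?F i" for i
    by (rule right_module_operator_group[OF right_module_right_free[OF A.ring_axioms]])
  note sc = operator_hom_closed[OF s] and rc = operator_hom_closed[OF r]
  define P' where "P' i = (?F i)\<lparr>carrier := s i ` carrier (P i)\<rparr>" for i
  have P'_simps: "carrier (P' i) = s i ` carrier (P i)" "\<zero>\<^bsub>P' i\<^esub> = \<zero>\<^bsub>?F i\<^esub>"
    "v \<oplus>\<^bsub>P' i\<^esub> w = v \<oplus>\<^bsub>?F i\<^esub> w" "a \<odot>\<^bsub>P' i\<^esub> v = a \<odot>\<^bsub>?F i\<^esub> v" for i v w a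
    by (simp_all add: P'_def)
  have id: "operator_hom A M M (\<lambda>m. m)" for M :: "('a, 'z) module"
    by (simp add: operator_hom_def)
  \<comment> \<open>The image of the idempotent \<open>s r\<close> is the kernel of the
    complementary idempotent, which makes it a submodule.\<close>
  have "a_kernel (?F i) (?F i) (\<lambda>v. v \<ominus>\<^bsub>?F i\<^esub> s i (r i v)) = s i ` carrier (P i)" for i
  proof -
    have "v = s i (r i v)" if "v \<in> carrier (?F i)" "v \<ominus>\<^bsub>?F i\<^esub> s i (r i v) = \<zero>\<^bsub>?F i\<^esub>" for v
    proof -
      have "v = (v \<ominus>\<^bsub>?F i\<^esub> s i (r i v)) \<oplus>\<^bsub>?F i\<^esub> s i (r i v)"
        using that(1) sc rc by (simp add: F.minus_eq F.a_assoc F.l_neg)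
      then show ?thesis
        using that sc rc by simp
    qed
    then have "v \<in> s i ` carrier (P i)"
      if "v \<in> carrier (?F i)" "v \<ominus>\<^bsub>?F i\<^esub> s i (r i v) = \<zero>\<^bsub>?F i\<^esub>" for v
      using that rc by (intro image_eqI[of _ _ "r i v"]) auto
    then show ?thesis
      using sc rs by (auto simp: a_kernel_def' F.minus_eq F.r_neg)
  qed
  moreover have "operator_hom A (?F i) (?F i) (\<lambda>v. v \<ominus>\<^bsub>?F i\<^esub> s i (r i v))" for i
    by (intro operator_hom_diff F.operator_group_axioms id operator_hom_comp[OF r s])
  ultimately have "submodule (s i ` carrier (P i)) A (?F i)" for i
    using submodule_kernel[OF F.operator_group_axioms F.operator_group_axioms] by metis
  then have P': "right_module A (P' i)" for i
    unfolding P'_def by (intro restrict_right_module right_module_right_free A.ring_axioms)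
  interpret P': right_module A "P' i" for i by (rule P')
  note P'_og = right_module_operator_group[OF P']
  have s': "operator_hom A (P i) (P' i) (s i)" for i
    using s[of i] by (auto simp: operator_hom_def P'_simps)
  have incl: "operator_hom A (P' i) (?F i) (\<lambda>v. v)" for i
    using sc by (auto simp: operator_hom_def P'_simps)
  have r': "operator_hom A (P' i) (P i) (r i)" for i
    by (rule operator_hom_comp[OF incl r])
  have proj: "fg_projective A (P' i)" for i
    unfolding fg_projective_def
  proof (intro conjI P' exI bexI ballI)
    show "restrict (\<lambda>v. v) (carrier (P' i)) \<in> module_hom A (P' i) (?F i)"
      by (rule restrict_module_hom[OF P'_og incl])
    show "restrict (\<lambda>v. s i (r i v)) (carrier (?F i)) \<in> module_hom A (?F i) (P' i)"
      by (rule restrict_module_hom[OF F.operator_group_axioms operator_hom_comp[OF r s']])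
    show "restrict (\<lambda>v. s i (r i v)) (carrier (?F i)) (restrict (\<lambda>v. v) (carrier (P' i)) v) = v"
      if "v \<in> carrier (P' i)" for v
      using that sc by (auto simp: P'_simps rs)
  qed
  define d' where "d' i = restrict (\<lambda>v. s i (d i (r (Suc i) v))) (carrier (P' (Suc i)))" for i
  define \<epsilon>' where "\<epsilon>' = restrict (\<lambda>v. \<epsilon> (r 0 v)) (carrier (P' 0))"
  have d': "d' i \<in> module_hom A (P' (Suc i)) (P' i)" for i
    unfolding d'_def
    by (intro restrict_module_hom[OF P'_og] operator_hom_comp[OF operator_hom_comp[OF r' hom] s'])
  have \<epsilon>': "\<epsilon>' \<in> module_hom A (P' 0) N"
    unfolding \<epsilon>'_def by (intro restrict_module_hom[OF P'_og] operator_hom_comp[OF r' hom_aug])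
  have d'_s: "d' i (s (Suc i) p) = s i (d i p)" if "p \<in> carrier (P (Suc i))" for i p
    using that by (simp add: d'_def P'_simps rs)
  have \<epsilon>'_s: "\<epsilon>' (s 0 p) = \<epsilon> p" if "p \<in> carrier (P 0)" for p
    using that by (simp add: \<epsilon>'_def P'_simps rs)
  have s_zero: "s i p = \<zero>\<^bsub>P' i\<^esub> \<longleftrightarrow> p = \<zero>\<^bsub>P i\<^esub>" if "p \<in> carrier (P i)" for i p
  proof -
    have "s i \<zero>\<^bsub>P i\<^esub> = \<zero>\<^bsub>P' i\<^esub>"
      unfolding P'_simps(2) by (rule operator_hom_zero[OF P.abelian_group_axioms F.abelian_group_axioms s])
    then show ?thesis
      using rs[OF that] rs[OF P.zero_closed[of i]] by metis
  qed
  have "projective_resolution A N P' d' \<epsilon>'"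
    unfolding projective_resolution_def
  proof (intro conjI allI proj d' \<epsilon>')
    show "\<epsilon>' ` carrier (P' 0) = carrier N"
      unfolding aug_surj[symmetric] P'_simps(1) image_image using \<epsilon>'_s by simp
    have "d' 0 ` carrier (P' 1) = s 0 ` d 0 ` carrier (P 1)"
      unfolding P'_simps(1) image_image using d'_s[of _ 0] by simp
    then show "d' 0 ` carrier (P' 1) = a_kernel (P' 0) N \<epsilon>'"
      unfolding exact_0 a_kernel_def' P'_simps(1) using \<epsilon>'_s by auto
    show "d' (Suc i) ` carrier (P' (Suc (Suc i))) = a_kernel (P' (Suc i)) (P' i) (d' i)" for i
    proof -
      have "d' (Suc i) ` carrier (P' (Suc (Suc i))) = s (Suc i) ` d (Suc i) ` carrier (P (Suc (Suc i)))"
        unfolding P'_simps(1) image_image using d'_s[of _ "Suc i"] by simp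
      also have "\<dots> = a_kernel (P' (Suc i)) (P' i) (d' i)"
        unfolding exact_Suc a_kernel_def' P'_simps(1)
        using d'_s[of _ i] s_zero[OF closed, of _ i] s_zero[OF P.zero_closed, of i] by auto
      finally show ?thesis .
    qed
  qed
  then show ?thesis by blast
qed

text \<open>Only the augmentation changes. Hence the pair chosen for \<open>N\<close>, in which no
  augmentation is recorded, also serves an isomorphic module.\<close>

lemma projective_resolution_iso:
  assumes N: "operator_group A N" and N': "operator_group A N'" and f: "operator_hom A N N' f"
    and bij: "bij_betw f (carrier N) (carrier N')" and P: "projective_resolution A N P d \<epsilon>"
  shows "\<exists>\<epsilon>'. projective_resolution A N' P d \<epsilon>'"
proof -
  interpret N: operator_group A N by fact
  interpret N': operator_group A N' by fact
  define \<epsilon>' where "\<epsilon>' = restrict (\<lambda>p. f (\<epsilon> p)) (carrier (P 0))"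
  have og: "operator_group A (P 0)"
    using P by (auto simp: projective_resolution_def fg_projective_def intro: right_module_operator_group)
  have \<epsilon>: "operator_hom A (P 0) N \<epsilon>"
    using P by (simp add: projective_resolution_def module_hom_iff)
  have "\<epsilon>' \<in> module_hom A (P 0) N'"
    unfolding \<epsilon>'_def by (rule restrict_module_hom[OF og operator_hom_comp[OF \<epsilon> f]])
  moreover have "\<epsilon>' ` carrier (P 0) = carrier N'"
  proof -
    have "\<epsilon>' ` carrier (P 0) = f ` \<epsilon> ` carrier (P 0)"
      by (auto simp: \<epsilon>'_def)
    then show ?thesis
      using P bij by (simp add: projective_resolution_def bij_betw_def)
  qed
  moreover have "a_kernel (P 0) N' \<epsilon>' = a_kernel (P 0) N \<epsilon>"
  proof -
    have f0: "f \<zero>\<^bsub>N\<^esub> = \<zero>\<^bsub>N'\<^esub>"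
      by (rule operator_hom_zero[OF N.abelian_group_axioms N'.abelian_group_axioms f])
    have "f n = \<zero>\<^bsub>N'\<^esub> \<longleftrightarrow> n = \<zero>\<^bsub>N\<^esub>" if "n \<in> carrier N" for n
      using bij that inj_on_eq_iff[of f "carrier N" n "\<zero>\<^bsub>N\<^esub>"] by (simp add: bij_betw_def f0)
    then show ?thesis
      using operator_hom_closed[OF \<epsilon>] by (auto simp: a_kernel_def' \<epsilon>'_def)
  qed
  ultimately show ?thesis
    using P by (intro exI[of _ \<epsilon>']) (simp add: projective_resolution_def)
qed

text \<open>\<open>N'\<close> is a convenient model of \<open>N\<close>. The resolution
  \<open>Q\<close> is moved to the right type and then to \<open>N\<close>, so the choice behind
  \<open>Ext\<close> yields a genuine resolution; the chosen pair resolves \<open>N'\<close> as well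
  and can be compared with \<open>Q\<close>.\<close>

lemma Ext_iso:
  assumes A: "ring A" and N: "operator_group A N" and N': "operator_group A N'"
    and f: "operator_hom A N N' f" "bij_betw f (carrier N) (carrier N')"
    and Q: "resolution A N' Q e \<eta>" and C: "operator_group A C"
    and \<gamma>: "operator_hom A ((hom_to_ring A (Q i))\<lparr>carrier := cocycles A Q e i\<rparr>) C \<gamma>"
    and surj: "\<gamma> ` cocycles A Q e i = carrier C"
    and ker: "\<And>f. f \<in> cocycles A Q e i \<Longrightarrow> \<gamma> f = \<zero>\<^bsub>C\<^esub> \<longleftrightarrow> f \<in> coboundaries A Q e i"
  shows "operator_group A (Ext A i N)"
    and "\<exists>h. operator_hom A (Ext A i N) C h \<and> bij_betw h (carrier (Ext A i N)) (carrier C)"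
proof -
  interpret N': operator_group A N' by fact
  obtain P0 :: "nat \<Rightarrow> ('a, nat \<Rightarrow> 'a) module" and d0 \<epsilon>0 where "projective_resolution A N' P0 d0 \<epsilon>0"
    using resolution_transport[OF Q] by blast
  then obtain \<epsilon>1 where "projective_resolution A N P0 d0 \<epsilon>1"
    using projective_resolution_iso[OF N' N operator_hom_inv_into[OF N f] bij_betw_inv_into[OF f(2)]] by blast
  then have ex: "\<exists>X. case X of (P, d) \<Rightarrow> \<exists>\<epsilon>. projective_resolution A N P (d :: nat \<Rightarrow> (nat \<Rightarrow> 'a) \<Rightarrow> nat \<Rightarrow> 'a) \<epsilon>"
    by (intro exI[of _ "(P0, d0)"]) auto
  obtain P d where Pd: "chosen_resolution A N = (P, d)"
    by (cases "chosen_resolution A N")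
  obtain \<epsilon> where "projective_resolution A N P d \<epsilon>"
    using someI_ex[OF ex] unfolding chosen_resolution_def[symmetric] Pd by auto
  then obtain \<epsilon>' where "projective_resolution A N' P d \<epsilon>'"
    using projective_resolution_iso[OF N N' f] by blast
  then have P: "resolution A N' P d \<epsilon>'"
    by (simp add: resolution_def resolution_axioms_def A N'.abelian_group_axioms)
  have "Ext A i N = cohomology A P d i"
    by (simp add: Ext_def Pd)
  then show "operator_group A (Ext A i N)"
    and "\<exists>h. operator_hom A (Ext A i N) C h \<and> bij_betw h (carrier (Ext A i N)) (carrier C)"
    using cohomology_iso[OF P Q C \<gamma> surj ker] by simp_all
qed

section \<open>The Koszul complex\<close>

text \<open>The index set comes without a linear order, so the usual sign of the exterior algebra is
  taken with respect to a numbering \<open>e\<close>.\<close>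

definition koszul_sign :: "('a \<Rightarrow> nat) \<Rightarrow> 'a \<Rightarrow> 'a set \<Rightarrow> 'k::field" where
  "koszul_sign e i J = (-1) ^ card {j \<in> J. e j < e i}"

text \<open>A function on sets is a coefficient vector in the exterior algebra; this is contraction
  with the dual of the basis vector \<open>i\<close>.\<close>

definition contract :: "('a \<Rightarrow> nat) \<Rightarrow> 'a \<Rightarrow> ('a set \<Rightarrow> 'k::field) \<Rightarrow> 'a set \<Rightarrow> 'k" where
  "contract e i c J = (if i \<in> J then 0 else koszul_sign e i J * c (insert i J))"

text \<open>Exterior multiplication by the basis vector \<open>i\<close>, written on
  coefficients.\<close>

definition expand :: "('a \<Rightarrow> nat) \<Rightarrow> 'a \<Rightarrow> ('a set \<Rightarrow> 'k::field) \<Rightarrow> 'a set \<Rightarrow> 'k" where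
  "expand e i c J = (if i \<in> J then koszul_sign e i (J - {i}) * c (J - {i}) else 0)"

definition koszul_boundary :: "('a \<Rightarrow> nat) \<Rightarrow> 'a set \<Rightarrow> ('a set \<Rightarrow> 'k::field) \<Rightarrow> 'a set \<Rightarrow> 'k" where
  "koszul_boundary e S c J = (\<Sum>i\<in>S. contract e i c J)"

definition koszul_coboundary :: "('a \<Rightarrow> nat) \<Rightarrow> 'a set \<Rightarrow> ('a set \<Rightarrow> 'k::field) \<Rightarrow> 'a set \<Rightarrow> 'k" where
  "koszul_coboundary e S c J = (\<Sum>i\<in>S. expand e i c J)"

lemma koszul_sign_square: "koszul_sign e i J * koszul_sign e i J = (1 :: 'k::field)"
  by (simp add: koszul_sign_def power_mult_distrib[symmetric])

lemma koszul_sign_insert: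
  fixes J :: "'a::finite set"
  assumes "j \<notin> J"
  shows "koszul_sign e i (insert j J) = (if e j < e i then - koszul_sign e i J else koszul_sign e i J)"
proof -
  have "{k \<in> insert j J. e k < e i} = (if e j < e i then insert j {k \<in> J. e k < e i} else {k \<in> J. e k < e i})"
    by auto
  then show ?thesis
    using assms by (simp add: koszul_sign_def)
qed

lemma contract_contract:
  fixes c :: "'a::finite set \<Rightarrow> 'k::field"
  assumes "inj e"
  shows "contract e i (contract e j c) J = - contract e j (contract e i c) J"
proof (cases "i = j")
  case False
  then have "e i < e j \<or> e j < e i"
    using assms by (metis inj_eq linorder_neqE_nat)
  then show ?thesis
    using False by (auto simp: contract_def koszul_sign_insert insert_commute)
qed (simp add: contract_def)

lemma contract_self: "contract e i (contract e i c) J = 0"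
  by (simp add: contract_def)

text \<open>The anticommutation relation of the exterior algebra. For distinct indices both terms
  vanish unless \<open>i \<notin> J\<close> and \<open>j \<in> J\<close>; in that case exactly one
  of \<open>e i < e j\<close> and \<open>e j < e i\<close> holds, so exactly one sign flips and the
  terms cancel.\<close>

lemma contract_expand:
  fixes c :: "'a::finite set \<Rightarrow> 'k::field"
  assumes "inj e"
  shows "contract e i (expand e j c) J + expand e j (contract e i c) J = (if i = j then c J else 0)"
proof (cases "i = j")
  case True
  then show ?thesis
    by (auto simp: contract_def expand_def koszul_sign_square mult.assoc[symmetric] insert_absorb)
next
  case False
  then have lt: "e i < e j \<longleftrightarrow> \<not> e j < e i"
    using assms by (metis inj_eq linorder_neqE_nat not_less_iff_gr_or_eq)
  have eq: "insert i (J - {j}) = insert i J - {j}" "insert j (J - {j}) = insert j J"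
    using False by auto
  show ?thesis
  proof (cases "i \<notin> J \<and> j \<in> J")
    case True
    then have J: "J = insert j (J - {j})" by auto
    have "koszul_sign e i J = (if e j < e i then - koszul_sign e i (J - {j}) else (koszul_sign e i (J - {j}) :: 'k))"
      by (subst J, subst koszul_sign_insert) auto
    moreover have "koszul_sign e j (insert i (J - {j})) =
        (if e i < e j then - koszul_sign e j (J - {j}) else (koszul_sign e j (J - {j}) :: 'k))"
      using True by (subst koszul_sign_insert) auto
    ultimately show ?thesis
      using True False lt by (auto simp: contract_def expand_def eq)
  qed (use False in \<open>auto simp: contract_def expand_def\<close>)
qed

text \<open>Off-diagonal terms cancel in pairs. In characteristic two antisymmetry says nothing
  about the diagonal, whence the separate assumption, met by \<open>contract_self\<close>.\<close>

lemma sum_alternating: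
  fixes a :: "'i \<Rightarrow> 'i \<Rightarrow> 'k::ab_group_add"
  assumes "finite S" "\<And>i j. a i j = - a j i" "\<And>i. a i i = 0"
  shows "(\<Sum>i\<in>S. \<Sum>j\<in>S. a i j) = 0"
  using assms(1)
proof induction
  case (insert x S)
  have "(\<Sum>j\<in>S. a x j) = - (\<Sum>j\<in>S. a j x)"
    unfolding sum_negf[symmetric] by (rule sum.cong[OF refl assms(2)])
  then show ?case
    using insert by (simp add: sum.distrib assms(3))
qed simp

lemma contract_sum: "contract e i (\<lambda>J. \<Sum>j\<in>S. f j J) J = (\<Sum>j\<in>S. contract e i (f j) J)"
  by (simp add: contract_def sum_distrib_left)

lemma expand_sum: "expand e i (\<lambda>J. \<Sum>j\<in>S. f j J) J = (\<Sum>j\<in>S. expand e i (f j) J)"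
  by (simp add: expand_def sum_distrib_left)

lemma koszul_boundary_square:
  fixes c :: "'a::finite set \<Rightarrow> 'k::field"
  assumes "inj e"
  shows "koszul_boundary e S (koszul_boundary e S c) J = 0"
  unfolding koszul_boundary_def contract_sum
  by (rule sum_alternating) (simp, rule contract_contract[OF assms], rule contract_self)

text \<open>Summed over \<open>S\<close>, the anticommutators leave only the one at
  \<open>i\<close>: multiplication by any single \<open>i\<close> contracts the full simplex on
  \<open>S\<close>.\<close>

lemma koszul_boundary_homotopy:
  fixes c :: "'a::finite set \<Rightarrow> 'k::field"
  assumes "inj e" "i \<in> S"
  shows "koszul_boundary e S (expand e i c) J + expand e i (koszul_boundary e S c) J = c J"
  unfolding koszul_boundary_def expand_sum sum.distrib[symmetric] contract_expand[OF assms(1)]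
  using assms(2) by simp

text \<open>The dual contraction. Now the removal of \<open>i\<close>, not its insertion, has to
  preserve supports, which is where distributivity will enter.\<close>

lemma koszul_coboundary_homotopy:
  fixes c :: "'a::finite set \<Rightarrow> 'k::field"
  assumes "inj e" "i \<in> S"
  shows "koszul_coboundary e S (contract e i c) J + contract e i (koszul_coboundary e S c) J = c J"
proof -
  have "expand e j (contract e i c) J + contract e i (expand e j c) J = (if i = j then c J else 0)" for j
    using contract_expand[OF assms(1), of i j c J] by (simp add: add.commute)
  then show ?thesis
    unfolding koszul_coboundary_def contract_sum sum.distrib[symmetric] using assms(2) by simp
qed

text \<open>For each \<open>i\<close> the two operators are transposes of each other, by the
  bijection \<open>insert i\<close> from the sets without \<open>i\<close> to those containing
  it.\<close>

lemma koszul_adjoint: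
  fixes c f :: "'a::finite set \<Rightarrow> 'k::field"
  shows "(\<Sum>J\<in>UNIV. koszul_boundary e S c J * f J) = (\<Sum>J\<in>UNIV. c J * koszul_coboundary e S f J)"
proof -
  have "(\<Sum>J\<in>UNIV. contract e i c J * f J) = (\<Sum>J\<in>UNIV. c J * expand e i f J)" for i
  proof -
    have "(\<Sum>J\<in>UNIV. contract e i c J * f J) = (\<Sum>J\<in>{J. i \<notin> J}. koszul_sign e i J * c (insert i J) * f J)"
      by (rule sum.mono_neutral_cong_right) (auto simp: contract_def)
    also have "\<dots> = (\<Sum>J\<in>{J. i \<in> J}. c J * (koszul_sign e i (J - {i}) * f (J - {i})))"
      by (rule sum.reindex_bij_witness[of _ "\<lambda>J. J - {i}" "insert i"]) (auto simp: insert_absorb)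
    also have "\<dots> = (\<Sum>J\<in>UNIV. c J * expand e i f J)"
      by (rule sum.mono_neutral_cong_left) (auto simp: expand_def)
    finally show ?thesis .
  qed
  then show ?thesis
    unfolding koszul_boundary_def koszul_coboundary_def sum_distrib_left sum_distrib_right
    by (subst (1 2) sum.swap) simp
qed

section \<open>Covers in a finite distributive lattice\<close>

definition covers :: "'l::order \<Rightarrow> 'l set" where
  "covers x = min_elements {y. x < y}"

text \<open>Inserting \<open>x\<close> gives \<open>Sup_fin\<close> the nonempty set that it
  requires and makes the empty join equal to \<open>x\<close>.\<close>

definition joins :: "'l::{finite,lattice} \<Rightarrow> 'l set \<Rightarrow> 'l" where
  "joins x I = Sup_fin (insert x I)"

lemma joins_le_iff: "joins x I \<le> z \<longleftrightarrow> x \<le> z \<and> (\<forall>i\<in>I. i \<le> z)"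
  by (simp add: joins_def Sup_fin.bounded_iff)

lemma joins_empty [simp]: "joins x {} = x"
  by (simp add: joins_def)

lemma le_joins: "x \<le> joins x I" "i \<in> I \<Longrightarrow> i \<le> joins x I"
  using joins_le_iff[of x I "joins x I"] by auto

lemma covers_less: "i \<in> covers x \<Longrightarrow> x < i"
  by (simp add: covers_def min_elements_def)

lemma cover_below:
  fixes x z :: "'l::{finite,order}"
  assumes "x < z"
  obtains i where "i \<in> covers x" "i \<le> z"
proof -
  obtain i where i: "x < i" "i \<le> z" "\<And>j. x < j \<Longrightarrow> j \<le> z \<Longrightarrow> j \<le> i \<Longrightarrow> i = j"
    using finite_has_minimal[of "{y. x < y \<and> y \<le> z}"] assms by auto
  have "\<not> j < i" if "x < j" for j
    using i(3)[OF that] i(2) unfolding less_le by (blast intro: order_trans)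
  then have "i \<in> covers x"
    using i(1) by (simp add: covers_def min_elements_def)
  then show ?thesis
    using i that by blast
qed

text \<open>Distributivity writes \<open>p\<close> as the join of its meets with the two parts, and
  irreducibility picks one of them; induction extends this to \<open>joins\<close>.\<close>

lemma join_irreducible_prime:
  fixes p :: "'l::{finite,distrib_lattice}"
  assumes p: "join_irreducible p" and le: "p \<le> joins x I"
  shows "p \<le> x \<or> (\<exists>i\<in>I. p \<le> i)"
proof -
  have two: "p \<le> a \<or> p \<le> b" if "p \<le> sup a b" for a b
  proof -
    have "p = sup (inf p a) (inf p b)"
      using that by (simp add: inf_sup_distrib1[symmetric] inf_absorb1)
    then show ?thesis
      using p unfolding join_irreducible_def by (metis inf.cobounded2)
  qed
  have "finite I" by simp
  then show ?thesis
    using le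
  proof (induction I)
    case (insert i I)
    have "joins x (insert i I) = sup i (joins x I)"
      by (simp add: joins_def insert_commute)
    then show ?case
      using insert two[of i "joins x I"] by auto
  qed (simp add: joins_def)
qed

text \<open>\<open>row x\<close> is the join of \<open>minimal_new x\<close>, and the covers of \<open>x\<close> are the elements \<open>sup x p\<close> with \<open>p\<close> in this set.\<close>

definition minimal_new :: "'l::{finite,lattice} \<Rightarrow> 'l set" where
  "minimal_new x = min_elements ({p. join_irreducible p} - birkhoff x)"

lemma minimal_newD:
  assumes "p \<in> minimal_new x"
  shows "join_irreducible p" "\<not> p \<le> x" "\<And>q. join_irreducible q \<Longrightarrow> q \<le> p \<Longrightarrow> q = p \<or> q \<le> x"
  using assms by (auto simp: minimal_new_def min_elements_def birkhoff_def order.order_iff_strict)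

lemma le_by_join_irreducibles:
  fixes x y :: "'l::{finite,lattice}"
  assumes "\<And>q. join_irreducible q \<Longrightarrow> q \<le> x \<Longrightarrow> q \<le> y"
  shows "x \<le> y"
  using assms by (subst birkhoff_le_iff[symmetric]) (auto simp: birkhoff_def)

lemma row_le_iff:
  fixes x u :: "'l::{finite,distrib_lattice}"
  shows "row x \<le> u \<longleftrightarrow> (\<forall>p\<in>minimal_new x. p \<le> u)"
  unfolding birkhoff_le_iff[symmetric, of "row x"] birkhoff_row
proof (intro iffI ballI)
  fix p assume "ideal_rowmotion {p. join_irreducible p} (birkhoff x) \<subseteq> birkhoff u" "p \<in> minimal_new x"
  then show "p \<le> u"
    using minimal_newD(1)[of p x] unfolding ideal_rowmotion_def minimal_new_def birkhoff_def by blast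
next
  assume "\<forall>p\<in>minimal_new x. p \<le> u"
  then show "ideal_rowmotion {p. join_irreducible p} (birkhoff x) \<subseteq> birkhoff u"
    unfolding ideal_rowmotion_def minimal_new_def birkhoff_def by (auto intro: order_trans)
qed

text \<open>If \<open>z\<close> lay strictly between, a join-irreducible \<open>q\<close> below
  \<open>z\<close> but not below \<open>x\<close> would be below \<open>p\<close> by primeness,
  hence equal to \<open>p\<close> by minimality, and \<open>z\<close> would be above
  \<open>sup x p\<close>.\<close>

lemma sup_minimal_new:
  fixes x p :: "'l::{finite,distrib_lattice}"
  assumes p: "p \<in> minimal_new x"
  shows "sup x p \<in> covers x"
proof -
  have "\<not> z < sup x p" if "x < z" for z
  proof
    assume z: "z < sup x p"
    obtain q where q: "join_irreducible q" "q \<le> z" "\<not> q \<le> x"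
      using le_by_join_irreducibles[of z x] \<open>x < z\<close> by (meson leD)
    have "sup x p = joins x {p}"
      by (simp add: joins_def)
    then have "q \<le> p"
      using join_irreducible_prime[of q x "{p}"] q z by (metis order.strict_implies_order order_trans singletonD)
    then have "q = p"
      using minimal_newD(3)[OF p] q by blast
    then show False
      using q z \<open>x < z\<close> by (meson le_sup_iff less_le_not_le)
  qed
  moreover have "x < sup x p"
    using minimal_newD(2)[OF p] by (simp add: less_le_not_le)
  ultimately show ?thesis
    by (auto simp: covers_def min_elements_def)
qed

text \<open>Some join-irreducible is below \<open>i\<close> but not below \<open>x\<close>. A
  minimal one is minimal among all those not below \<open>x\<close>, and its join with
  \<open>x\<close> is strictly above \<open>x\<close> and at most \<open>i\<close>.\<close>

lemma covers_minimal_new: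
  fixes x i :: "'l::{finite,distrib_lattice}"
  assumes i: "i \<in> covers x"
  obtains p where "p \<in> minimal_new x" "sup x p = i"
proof -
  have "x < i" and imin: "\<And>z. x < z \<Longrightarrow> \<not> z < i"
    using i by (auto simp: covers_def min_elements_def)
  then obtain q where "join_irreducible q" "q \<le> i" "\<not> q \<le> x"
    using le_by_join_irreducibles[of i x] by (meson leD)
  then obtain p where p: "join_irreducible p" "p \<le> i" "\<not> p \<le> x"
      "\<And>r. join_irreducible r \<Longrightarrow> r \<le> i \<Longrightarrow> \<not> r \<le> x \<Longrightarrow> r \<le> p \<Longrightarrow> p = r"
    using finite_has_minimal[of "{q. join_irreducible q \<and> q \<le> i \<and> \<not> q \<le> x}"] by auto
  have "\<not> r < p" if "join_irreducible r" "\<not> r \<le> x" for r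
    using p(4)[OF that(1) _ that(2)] p(2) unfolding less_le by (blast intro: order_trans)
  then have "p \<in> minimal_new x"
    using p(1,3) by (simp add: minimal_new_def min_elements_def birkhoff_def)
  moreover have "sup x p = i"
  proof -
    have "x < sup x p" "sup x p \<le> i"
      using p(2,3) \<open>x < i\<close> by (simp_all add: less_le_not_le)
    then show ?thesis
      using imin by (auto simp: order.order_iff_strict)
  qed
  ultimately show ?thesis
    using that by blast
qed

text \<open>Let a join-irreducible \<open>q\<close> below \<open>u\<close> use the cover
  \<open>sup x p\<close>. Then \<open>q\<close> is below \<open>x\<close> or below \<open>p\<close>;
  it cannot equal \<open>p\<close>, which is not below \<open>u\<close>, so minimality of
  \<open>p\<close> puts \<open>q\<close> below \<open>x\<close> after all.\<close>

lemma le_joins_remove: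
  fixes x u p :: "'l::{finite,distrib_lattice}"
  assumes p: "p \<in> minimal_new x" and u: "\<not> p \<le> u" "u \<le> joins x I"
  shows "u \<le> joins x (I - {sup x p})"
proof (rule le_by_join_irreducibles)
  fix q assume q: "join_irreducible q" "q \<le> u"
  then consider "q \<le> x" | i where "i \<in> I" "q \<le> i"
    using join_irreducible_prime[of q x I] u(2) by (meson order_trans)
  then show "q \<le> joins x (I - {sup x p})"
  proof cases
    case 1
    then show ?thesis
      using le_joins(1) by (rule order_trans)
  next
    case (2 i)
    show ?thesis
    proof (cases "i = sup x p")
      case True
      then have "q \<le> x \<or> q \<le> p"
        using join_irreducible_prime[of q x "{p}"] q 2 by (simp add: joins_def)
      then have "q \<le> x"
        using minimal_newD(3)[OF p] q u(1) by blast
      then show ?thesis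
        using le_joins(1) by (rule order_trans)
    next
      case False
      then show ?thesis
        using 2 le_joins(2)[of i "I - {sup x p}" x] by (auto intro: order_trans)
    qed
  qed
qed

text \<open>Each cover is \<open>sup x p\<close> with \<open>p\<close> below \<open>row x\<close>,
  hence below \<open>joins x I\<close>. By primeness \<open>p\<close> is below some
  \<open>j \<in> I\<close>, so \<open>sup x p\<close> is below \<open>j\<close>, and comparable
  covers coincide.\<close>

lemma joins_eq_covers:
  fixes x u :: "'l::{finite,distrib_lattice}"
  assumes u: "row x \<le> u" "u \<le> joins x I" and I: "I \<subseteq> covers x"
  shows "I = covers x"
proof (intro equalityI I subsetI)
  fix i assume i: "i \<in> covers x"
  then obtain p where p: "p \<in> minimal_new x" "sup x p = i"
    by (rule covers_minimal_new)
  then have "p \<le> joins x I"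
    using u by (auto simp: row_le_iff intro: order_trans)
  then obtain j where j: "j \<in> I" "p \<le> j"
    using join_irreducible_prime[of p x I] minimal_newD(1,2)[OF p(1)] by blast
  then have "x < j" "i \<le> j"
    using I p(2) by (auto simp: covers_def min_elements_def)
  then have "i = j"
    using i j I by (auto simp: covers_def min_elements_def order.order_iff_strict)
  then show "i \<in> I"
    using j by simp
qed

text \<open>This makes the interval that indexes the nonzero Ext nonempty.\<close>

lemma row_le_joins: "row x \<le> joins x (covers x)"
  for x :: "'l::{finite,distrib_lattice}"
  unfolding row_le_iff using sup_minimal_new le_joins(2) by (metis le_sup_iff)

section \<open>The Koszul resolution of a simple module\<close>

lemma incidence_algebra_simps [simp]:
  "\<zero>\<^bsub>incidence_algebra\<^esub> = (\<lambda>x y. 0)"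
  "f \<oplus>\<^bsub>incidence_algebra\<^esub> g = (\<lambda>x y. f x y + g x y)"
  "c \<odot>\<^bsub>incidence_algebra\<^esub> f = (\<lambda>x y. c * f x y)"
  by (simp_all add: incidence_algebra_def)

lemma incidence_carrier: "f \<in> carrier incidence_algebra \<longleftrightarrow> (\<forall>x y. f x y \<noteq> 0 \<longrightarrow> x \<le> y)"
  by (auto simp: incidence_algebra_def)

text \<open>Sums over the whole poset are easier to interchange than sums over intervals; the added
  terms vanish because both factors are supported on comparable pairs.\<close>

lemma incidence_mult:
  assumes "f \<in> carrier incidence_algebra" "g \<in> carrier incidence_algebra"
  shows "(f \<otimes>\<^bsub>incidence_algebra\<^esub> g) x y = (\<Sum>z\<in>UNIV. f x z * g z y)"
  unfolding incidence_algebra_def using assms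
  by (auto simp: incidence_carrier intro!: sum.mono_neutral_left) (metis mult_eq_0_iff)

lemma incidence_one: "\<one>\<^bsub>incidence_algebra\<^esub> x y = (if x = y then 1 else 0)"
  by (simp add: incidence_algebra_def)

text \<open>
  \<open>koszul_module x i\<close> is the direct sum of the modules \<open>e\<^sub>y A\<close> with \<open>y = joins x I\<close>, over the sets \<open>I\<close> of
  \<open>i\<close> covers of \<open>x\<close>; \<open>c I z\<close> is the coefficient of \<open>p\<^sup>y\<^sub>z\<close> in the summand of \<open>I\<close>.
\<close>

definition koszul_module ::
    "'l::{finite,distrib_lattice} \<Rightarrow> nat \<Rightarrow> ('l \<Rightarrow> 'l \<Rightarrow> 'k::field, 'l set \<Rightarrow> 'l \<Rightarrow> 'k) module" where
  "koszul_module x i =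
    \<lparr>carrier = {c. \<forall>I z. c I z \<noteq> 0 \<longrightarrow> I \<subseteq> covers x \<and> card I = i \<and> joins x I \<le> z},
     mult = undefined, one = undefined, zero = (\<lambda>I z. 0),
     add = (\<lambda>c d I z. c I z + d I z), smult = (\<lambda>a c I z. \<Sum>w\<in>UNIV. c I w * a w z)\<rparr>"

text \<open>For \<open>J\<close> contained in \<open>I\<close>, the inclusion between the summands
  of \<open>I\<close> and \<open>J\<close> keeps the coefficient at \<open>z\<close>. Different
  \<open>z\<close> therefore never mix, and the signed simplicial boundary acts for each
  \<open>z\<close> separately.\<close>

definition koszul_diff ::
    "('l::{finite,distrib_lattice} \<Rightarrow> nat) \<Rightarrow> 'l \<Rightarrow> nat \<Rightarrow> ('l set \<Rightarrow> 'l \<Rightarrow> 'k::field) \<Rightarrow> 'l set \<Rightarrow> 'l \<Rightarrow> 'k" where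
  "koszul_diff e x i = (\<lambda>c\<in>carrier (koszul_module x (Suc i)).
     \<lambda>J z. koszul_boundary e (covers x) (\<lambda>I. c I z) J)"

text \<open>A model of the simple module \<open>S\<^sub>r\<close> on the ground field.\<close>

definition incidence_line :: "'l::{finite,order} \<Rightarrow> ('l \<Rightarrow> 'l \<Rightarrow> 'k::field, 'k) module" where
  "incidence_line r =
    \<lparr>carrier = UNIV, mult = undefined, one = undefined, zero = 0,
     add = (+), smult = (\<lambda>a c. c * a r r)\<rparr>"

definition koszul_aug ::
    "'l::{finite,distrib_lattice} \<Rightarrow> ('l set \<Rightarrow> 'l \<Rightarrow> 'k::field) \<Rightarrow> 'k" where
  "koszul_aug x = (\<lambda>c\<in>carrier (koszul_module x 0). c {} x)"

lemma koszul_module_simps [simp]: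
  "\<zero>\<^bsub>koszul_module x i\<^esub> = (\<lambda>I z. 0)"
  "c \<oplus>\<^bsub>koszul_module x i\<^esub> d = (\<lambda>I z. c I z + d I z)"
  "a \<odot>\<^bsub>koszul_module x i\<^esub> c = (\<lambda>I z. \<Sum>w\<in>UNIV. c I w * a w z)"
  by (simp_all add: koszul_module_def)

lemma koszul_carrier:
  "c \<in> carrier (koszul_module x i) \<longleftrightarrow>
    (\<forall>I z. c I z \<noteq> 0 \<longrightarrow> I \<subseteq> covers x \<and> card I = i \<and> joins x I \<le> z)"
  by (simp add: koszul_module_def)

lemma koszul_carrierD:
  assumes "c \<in> carrier (koszul_module x i)" "c I z \<noteq> 0"
  shows "I \<subseteq> covers x" "card I = i" "joins x I \<le> z"
  using assms by (simp_all add: koszul_carrier)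

lemma incidence_line_simps [simp]:
  "carrier (incidence_line r) = UNIV"
  "\<zero>\<^bsub>incidence_line r\<^esub> = 0"
  "c \<oplus>\<^bsub>incidence_line r\<^esub> d = c + d"
  "a \<odot>\<^bsub>incidence_line r\<^esub> c = c * a r r"
  by (simp_all add: incidence_line_def)

lemma incidence_line_operator_group: "operator_group A (incidence_line r)"
proof -
  have "abelian_group (incidence_line r)"
    by (rule abelian_groupI) (auto intro: exI[of _ "- _"])
  then show ?thesis
    by (simp add: operator_group_def operator_group_axioms_def distrib_right)
qed

lemma koszul_right_module:
  "right_module incidence_algebra (koszul_module x i :: (_ \<Rightarrow> _ \<Rightarrow> 'k::field, _) module)"
proof -
  let ?Q = "koszul_module x i :: (_ \<Rightarrow> _ \<Rightarrow> 'k, _) module"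
  have "abelian_group ?Q"
  proof (rule abelian_groupI)
    show "\<exists>d\<in>carrier ?Q. d \<oplus>\<^bsub>?Q\<^esub> c = \<zero>\<^bsub>?Q\<^esub>" if "c \<in> carrier ?Q" for c
      using that by (intro bexI[of _ "\<lambda>I z. - c I z"]) (auto simp: koszul_carrier)
    show "c \<oplus>\<^bsub>?Q\<^esub> d \<in> carrier ?Q" if "c \<in> carrier ?Q" "d \<in> carrier ?Q" for c d
      using that unfolding koszul_carrier koszul_module_simps by (metis add_0)
  qed (auto simp: koszul_carrier ac_simps)
  moreover have "right_module_axioms incidence_algebra ?Q"
  proof
    show "a \<odot>\<^bsub>?Q\<^esub> c \<in> carrier ?Q" if "a \<in> carrier incidence_algebra" "c \<in> carrier ?Q" for a c
      unfolding koszul_carrier koszul_module_simps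
    proof (intro allI impI)
      fix I z assume "(\<Sum>w\<in>UNIV. c I w * a w z) \<noteq> 0"
      then obtain w where "c I w * a w z \<noteq> 0"
        by (meson sum.not_neutral_contains_not_neutral)
      then show "I \<subseteq> covers x \<and> card I = i \<and> joins x I \<le> z"
        using koszul_carrierD[OF that(2), of I w] that(1) by (auto simp: incidence_carrier intro: order_trans)
    qed
    show "(a \<otimes>\<^bsub>incidence_algebra\<^esub> b) \<odot>\<^bsub>?Q\<^esub> c = b \<odot>\<^bsub>?Q\<^esub> (a \<odot>\<^bsub>?Q\<^esub> c)"
      if "a \<in> carrier incidence_algebra" "b \<in> carrier incidence_algebra" for a b c
    proof (intro ext)
      fix I z
      have "(\<Sum>w\<in>UNIV. \<Sum>v\<in>UNIV. c I w * (a w v * b v z)) = (\<Sum>v\<in>UNIV. \<Sum>w\<in>UNIV. c I w * (a w v * b v z))"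
        by (rule sum.swap)
      then show "((a \<otimes>\<^bsub>incidence_algebra\<^esub> b) \<odot>\<^bsub>?Q\<^esub> c) I z = (b \<odot>\<^bsub>?Q\<^esub> (a \<odot>\<^bsub>?Q\<^esub> c)) I z"
        by (simp add: incidence_mult[OF that] sum_distrib_left sum_distrib_right mult.assoc)
    qed
    show "\<one>\<^bsub>incidence_algebra\<^esub> \<odot>\<^bsub>?Q\<^esub> c = c" for c
      by (simp add: incidence_one if_distrib[of "(*) _"] cong: if_cong)
  qed (auto simp: sum.distrib distrib_left distrib_right)
  ultimately show ?thesis
    by (simp add: right_module_def ring_incidence_algebra)
qed

lemma koszul_operator_group: "operator_group incidence_algebra (koszul_module x i)"
  by (rule right_module_operator_group[OF koszul_right_module])

lemma right_free_simps [simp]: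
  "\<zero>\<^bsub>right_free A n\<^esub> = (\<lambda>i. \<zero>\<^bsub>A\<^esub>)"
  "v \<oplus>\<^bsub>right_free A n\<^esub> w = (\<lambda>i. v i \<oplus>\<^bsub>A\<^esub> w i)"
  "a \<odot>\<^bsub>right_free A n\<^esub> v = (\<lambda>i. v i \<otimes>\<^bsub>A\<^esub> a)"
  "v \<in> carrier (right_free A n) \<longleftrightarrow> (\<forall>i<n. v i \<in> carrier A) \<and> (\<forall>i\<ge>n. v i = \<zero>\<^bsub>A\<^esub>)"
  by (simp_all add: right_free_def)

text \<open>The free module has one copy of the algebra for each subset of the lattice, numbered by
  \<open>idx\<close>. The map \<open>s\<close> writes the coefficients of the summand of
  \<open>I\<close> into row \<open>joins x I\<close> of the matrix in its copy, and \<open>r\<close>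
  reads that row off again.\<close>

lemma koszul_fg_projective:
  "fg_projective incidence_algebra (koszul_module x i :: (_ \<Rightarrow> _ \<Rightarrow> 'k::field, _) module)"
proof -
  let ?A = "incidence_algebra :: ('k, 'a \<Rightarrow> 'a \<Rightarrow> 'k) module"
  let ?Q = "koszul_module x i :: (_ \<Rightarrow> _ \<Rightarrow> 'k, _) module"
  interpret A: ring ?A by (rule ring_incidence_algebra)
  obtain idx :: "'a set \<Rightarrow> nat" and n where "bij_betw idx UNIV {0..<n}"
    using ex_bij_betw_finite_nat[of "UNIV :: 'a set set"] by auto
  then have inj: "inj idx" and lt: "\<And>I. idx I < n"
    by (auto simp: bij_betw_def)
  define s where "s c j = (\<lambda>u z. if j < n \<and> u = joins x (inv_into UNIV idx j) then c (inv_into UNIV idx j) z else 0)"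
    for c :: "'a set \<Rightarrow> 'a \<Rightarrow> 'k" and j
  define r where "r v = (\<lambda>I z. if I \<subseteq> covers x \<and> card I = i then v (idx I) (joins x I) z else 0)"
    for v :: "nat \<Rightarrow> 'a \<Rightarrow> 'a \<Rightarrow> 'k"
  have sc: "s c j \<in> carrier ?A" if "c \<in> carrier ?Q" for c j
    using that by (auto simp: s_def incidence_carrier koszul_carrier)
  have coord: "v j \<in> carrier ?A" if "v \<in> carrier (right_free ?A n)" for v j
    using that by (cases "j < n") (auto simp: incidence_carrier)
  have s: "operator_hom ?A ?Q (right_free ?A n) s"
  proof (rule operator_homI)
    show "s c \<in> carrier (right_free ?A n)" if "c \<in> carrier ?Q" for c
    proof -
      have "s c j = (\<lambda>x y. 0)" if "j \<ge> n" for j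
        using that by (auto simp: s_def)
      then show ?thesis
        using sc[OF that] by simp
    qed
    show "s (a \<odot>\<^bsub>?Q\<^esub> c) = a \<odot>\<^bsub>right_free ?A n\<^esub> s c" if "a \<in> carrier ?A" "c \<in> carrier ?Q" for a c
      using that by (auto simp: fun_eq_iff incidence_mult sc) (auto simp: s_def)
  qed (auto simp: s_def fun_eq_iff)
  have r: "operator_hom ?A (right_free ?A n) ?Q r"
  proof (rule operator_homI)
    show "r v \<in> carrier ?Q" if "v \<in> carrier (right_free ?A n)" for v
      using coord[OF that] by (auto simp: r_def koszul_carrier incidence_carrier)
    show "r (a \<odot>\<^bsub>right_free ?A n\<^esub> v) = a \<odot>\<^bsub>?Q\<^esub> r v"
      if "a \<in> carrier ?A" "v \<in> carrier (right_free ?A n)" for a v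
    proof (intro ext)
      fix I z
      show "r (a \<odot>\<^bsub>right_free ?A n\<^esub> v) I z = (a \<odot>\<^bsub>?Q\<^esub> r v) I z"
        by (cases "I \<subseteq> covers x \<and> card I = i")
           (simp_all add: r_def incidence_mult[OF coord[OF that(2)] that(1)] del: de_Morgan_conj)
    qed
  qed (auto simp: r_def fun_eq_iff)
  have rs: "r (s c) = c" if "c \<in> carrier ?Q" for c
  proof (intro ext)
    fix I z
    show "r (s c) I z = c I z"
      using koszul_carrierD(1,2)[OF that, of I z]
      by (cases "c I z = 0") (simp_all add: r_def s_def lt inv_f_f[OF inj])
  qed
  show ?thesis
    unfolding fg_projective_def
  proof (intro conjI koszul_right_module exI bexI ballI)
    show "restrict s (carrier ?Q) \<in> module_hom ?A ?Q (right_free ?A n)"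
      by (rule restrict_module_hom[OF koszul_operator_group s])
    show "restrict r (carrier (right_free ?A n)) \<in> module_hom ?A (right_free ?A n) ?Q"
      by (rule restrict_module_hom[OF right_module_operator_group[OF right_module_right_free[OF A.ring_axioms]] r])
    show "restrict r (carrier (right_free ?A n)) (restrict s (carrier ?Q) c) = c" if "c \<in> carrier ?Q" for c
      using that operator_hom_closed[OF s that] rs[OF that] by simp
  qed
qed

lemma koszul_boundary_support:
  assumes "koszul_boundary e S c J \<noteq> 0"
  obtains i where "i \<in> S" "i \<notin> J" "c (insert i J) \<noteq> 0"
  using assms unfolding koszul_boundary_def
  by (metis (no_types, lifting) contract_def mult_zero_right sum.neutral)

lemma koszul_boundary_add:
  "koszul_boundary e S (\<lambda>I. c I + d I) J = koszul_boundary e S c J + koszul_boundary e S d J"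
  unfolding koszul_boundary_def sum.distrib[symmetric]
  by (rule sum.cong) (auto simp: contract_def distrib_left)

lemma koszul_boundary_sum:
  "koszul_boundary e S (\<lambda>I. \<Sum>w\<in>W. c I w * a w) J =
    (\<Sum>w\<in>W. koszul_boundary e S (\<lambda>I. c I w) J * a w)"
  unfolding koszul_boundary_def contract_sum sum_distrib_right
  by (subst sum.swap, intro sum.cong) (auto simp: contract_def)

lemma koszul_diff_hom:
  "koszul_diff e x i \<in> module_hom incidence_algebra (koszul_module x (Suc i)) (koszul_module x i)"
  unfolding koszul_diff_def
proof (intro restrict_module_hom koszul_operator_group operator_homI)
  fix c :: "'a set \<Rightarrow> 'a \<Rightarrow> 'b" assume c: "c \<in> carrier (koszul_module x (Suc i))"
  show "(\<lambda>J z. koszul_boundary e (covers x) (\<lambda>I. c I z) J) \<in> carrier (koszul_module x i)"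
    unfolding koszul_carrier
  proof (intro allI impI)
    fix J z assume "koszul_boundary e (covers x) (\<lambda>I. c I z) J \<noteq> 0"
    then obtain j where "j \<notin> J" "c (insert j J) z \<noteq> 0"
      by (rule koszul_boundary_support)
    then show "J \<subseteq> covers x \<and> card J = i \<and> joins x J \<le> z"
      using koszul_carrierD[OF c, of "insert j J" z] by (simp add: joins_le_iff)
  qed
qed (simp_all add: koszul_boundary_add koszul_boundary_sum)

lemma koszul_diff_closed:
  "c \<in> carrier (koszul_module x (Suc i)) \<Longrightarrow> koszul_diff e x i c \<in> carrier (koszul_module x i)"
  by (rule operator_hom_closed[OF conjunct1[OF koszul_diff_hom[unfolded module_hom_iff]]])

text \<open>For \<open>z\<close> above \<open>x\<close> a cover below \<open>z\<close> may be
  inserted into any set without losing \<open>joins x I \<le> z\<close>, so the homotopy stays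
  inside the complex. At the remaining \<open>z\<close> only the coefficient of the empty set at
  \<open>x\<close> could survive, and \<open>c0\<close> excludes it.\<close>

lemma koszul_exact:
  fixes c :: "'l::{finite,distrib_lattice} set \<Rightarrow> 'l \<Rightarrow> 'k::field"
  assumes e: "inj e" and c: "c \<in> carrier (koszul_module x i)" and c0: "i = 0 \<Longrightarrow> c {} x = 0"
    and cycle: "\<And>J z. koszul_boundary e (covers x) (\<lambda>I. c I z) J = 0"
  shows "c \<in> koszul_diff e x i ` carrier (koszul_module x (Suc i))"
proof -
  have "\<exists>j. x < z \<longrightarrow> j \<in> covers x \<and> j \<le> z" for z
    by (meson cover_below)
  then obtain j where j: "\<And>z. x < z \<Longrightarrow> j z \<in> covers x" "\<And>z. x < z \<Longrightarrow> j z \<le> z"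
    by metis
  \<comment> \<open>The preimage: multiply by the chosen cover \<open>j z\<close>, independently for
    each \<open>z\<close>.\<close>
  define b where "b I z = (if x < z then expand e (j z) (\<lambda>I. c I z) I else 0)" for I z
  have "b \<in> carrier (koszul_module x (Suc i))"
    unfolding koszul_carrier
  proof (intro allI impI)
    fix I z assume "b I z \<noteq> 0"
    then have *: "x < z" "j z \<in> I" "c (I - {j z}) z \<noteq> 0"
      by (auto simp: b_def expand_def split: if_splits)
    then show "I \<subseteq> covers x \<and> card I = Suc i \<and> joins x I \<le> z"
      using c j[OF *(1)] card_Suc_Diff1[OF finite *(2)] by (fastforce simp: koszul_carrier joins_le_iff)
  qed
  moreover have "koszul_boundary e (covers x) (\<lambda>I. b I z) J = c J z" for J z
  proof (cases "x < z")
    case True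
    have "expand e (j z) (koszul_boundary e (covers x) (\<lambda>I. c I z)) J = 0"
      by (simp add: expand_def cycle)
    then show ?thesis
      using koszul_boundary_homotopy[OF e j(1)[OF True], of "\<lambda>I. c I z" J] True
      by (simp add: b_def)
  next
    case False
    have "c J z = 0"
    proof (rule ccontr)
      assume "c J z \<noteq> 0"
      then have J: "J \<subseteq> covers x" "card J = i" "joins x J \<le> z"
        using c by (auto simp: koszul_carrier)
      then have "z = x"
        using False by (auto simp: joins_le_iff)
      moreover from this have "J = {}"
        using J by (force simp: joins_le_iff dest: covers_less)
      ultimately show False
        using J c0 \<open>c J z \<noteq> 0\<close> by auto
    qed
    then show ?thesis
      using False by (auto simp: b_def koszul_boundary_def contract_def intro: sum.neutral)
  qed
  ultimately show ?thesis
    by (intro image_eqI[of _ _ b]) (auto simp: koszul_diff_def)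
qed

lemma koszul_resolution:
  assumes e: "inj e"
  shows "resolution incidence_algebra (incidence_line x) (koszul_module x :: nat \<Rightarrow> (_ \<Rightarrow> _ \<Rightarrow> 'k::field, _) module)
    (koszul_diff e x) (koszul_aug x)"
proof -
  let ?Q = "koszul_module x :: nat \<Rightarrow> (_ \<Rightarrow> _ \<Rightarrow> 'k, _) module"
  let ?k = "incidence_line x :: (_ \<Rightarrow> _ \<Rightarrow> 'k, _) module"
  note diff = koszul_diff_closed[of _ x _ e]
  have "projective_resolution incidence_algebra ?k ?Q (koszul_diff e x) (koszul_aug x)"
    unfolding projective_resolution_def
  proof (intro conjI allI koszul_fg_projective koszul_diff_hom)
    show "koszul_aug x \<in> module_hom incidence_algebra (?Q 0) ?k"
      unfolding koszul_aug_def
    proof (intro restrict_module_hom koszul_operator_group operator_homI)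
      fix a :: "'a \<Rightarrow> 'a \<Rightarrow> 'k" and c
      assume a: "a \<in> carrier incidence_algebra" and c: "c \<in> carrier (?Q 0)"
      \<comment> \<open>A nonzero term has \<open>x \<le> w\<close> from \<open>c\<close> and
        \<open>w \<le> x\<close> from \<open>a\<close>.\<close>
      have "(\<Sum>w\<in>UNIV. c {} w * a w x) = (\<Sum>w\<in>{x}. c {} w * a w x)"
        using koszul_carrierD(3)[OF c, of "{}"] a
        by (intro sum.mono_neutral_right) (fastforce simp: incidence_carrier intro: order_antisym)+
      then show "(a \<odot>\<^bsub>?Q 0\<^esub> c) {} x = a \<odot>\<^bsub>?k\<^esub> c {} x"
        by simp
    qed auto
    have "k \<in> koszul_aug x ` carrier (?Q 0)" for k :: 'k
      by (intro image_eqI[of _ _ "\<lambda>I z. if I = {} \<and> z = x then k else 0"])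
         (auto simp: koszul_aug_def koszul_carrier)
    then show "koszul_aug x ` carrier (?Q 0) = carrier ?k"
      by auto
    show "koszul_diff e x 0 ` carrier (?Q 1) = a_kernel (?Q 0) ?k (koszul_aug x)"
    proof (intro equalityI subsetI)
      fix b assume "b \<in> koszul_diff e x 0 ` carrier (?Q 1)"
      then obtain c where c: "c \<in> carrier (?Q 1)" "b = koszul_diff e x 0 c"
        by auto
      \<comment> \<open>A cover of \<open>x\<close> is not below \<open>x\<close>, so sets with one
        element have no coefficient at \<open>x\<close>.\<close>
      have "koszul_boundary e (covers x) (\<lambda>I. c I x) {} = 0"
      proof (rule ccontr)
        assume "koszul_boundary e (covers x) (\<lambda>I. c I x) {} \<noteq> 0"
        then obtain i where "i \<in> covers x" "c {i} x \<noteq> 0"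
          by (rule koszul_boundary_support)
        then show False
          using koszul_carrierD(3)[OF c(1), of "{i}" x] by (auto simp: joins_le_iff dest: covers_less)
      qed
      then show "b \<in> a_kernel (?Q 0) ?k (koszul_aug x)"
        using c diff[of c 0] by (simp add: a_kernel_def' koszul_aug_def) (simp add: koszul_diff_def)
    next
      fix c assume "c \<in> a_kernel (?Q 0) ?k (koszul_aug x)"
      then have c: "c \<in> carrier (?Q 0)" "c {} x = 0"
        by (auto simp: a_kernel_def' koszul_aug_def)
      \<comment> \<open>In degree zero the coefficients live on the empty set only, so the cycle
        condition of \<open>koszul_exact\<close> holds automatically.\<close>
      have "koszul_boundary e (covers x) (\<lambda>I. c I z) J = 0" for J z
      proof (rule ccontr)
        assume "koszul_boundary e (covers x) (\<lambda>I. c I z) J \<noteq> 0"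
        then obtain i where "c (insert i J) z \<noteq> 0"
          by (rule koszul_boundary_support)
        then show False
          using c(1) by (auto simp: koszul_carrier)
      qed
      then show "c \<in> koszul_diff e x 0 ` carrier (?Q 1)"
        using koszul_exact[OF e c(1)] c(2) by simp
    qed
    show "koszul_diff e x (Suc i) ` carrier (?Q (Suc (Suc i))) = a_kernel (?Q (Suc i)) (?Q i) (koszul_diff e x i)" for i
    proof (intro equalityI subsetI)
      fix b assume "b \<in> koszul_diff e x (Suc i) ` carrier (?Q (Suc (Suc i)))"
      then show "b \<in> a_kernel (?Q (Suc i)) (?Q i) (koszul_diff e x i)"
        using diff[of _ "Suc i"] by (auto simp: a_kernel_def') (auto simp: koszul_diff_def koszul_boundary_square[OF e])
    next
      fix c assume "c \<in> a_kernel (?Q (Suc i)) (?Q i) (koszul_diff e x i)"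
      then have "c \<in> carrier (?Q (Suc i))" "koszul_boundary e (covers x) (\<lambda>I. c I z) J = 0" for J z
        by (auto simp: a_kernel_def' koszul_diff_def fun_eq_iff)
      then show "c \<in> koszul_diff e x (Suc i) ` carrier (?Q (Suc (Suc i)))"
        by (intro koszul_exact[OF e]) auto
    qed
  qed
  then show ?thesis
    using operator_group.axioms(1)[OF incidence_line_operator_group]
    by (simp add: resolution_def resolution_axioms_def ring_incidence_algebra)
qed

section \<open>Cohomology of the dual Koszul complex\<close>

text \<open>Matrices act on column vectors, and the result is truncated to \<open>S\<close>. The
  empty set gives the zero module, so one description covers vanishing and nonvanishing Ext.\<close>

definition support_module :: "'l::{finite,order} set \<Rightarrow> ('l \<Rightarrow> 'l \<Rightarrow> 'k::field, 'l \<Rightarrow> 'k) module" where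
  "support_module S =
    \<lparr>carrier = {c. \<forall>u. c u \<noteq> 0 \<longrightarrow> u \<in> S}, mult = undefined, one = undefined, zero = (\<lambda>u. 0),
     add = (\<lambda>c d u. c u + d u), smult = (\<lambda>a c u. if u \<in> S then \<Sum>w\<in>UNIV. a u w * c w else 0)\<rparr>"

lemma support_module_simps [simp]:
  "\<zero>\<^bsub>support_module S\<^esub> = (\<lambda>u. 0)"
  "c \<oplus>\<^bsub>support_module S\<^esub> d = (\<lambda>u. c u + d u)"
  "a \<odot>\<^bsub>support_module S\<^esub> c = (\<lambda>u. if u \<in> S then \<Sum>w\<in>UNIV. a u w * c w else 0)"
  "c \<in> carrier (support_module S) \<longleftrightarrow> (\<forall>u. c u \<noteq> 0 \<longrightarrow> u \<in> S)"
  by (simp_all add: support_module_def)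

lemma support_module_operator_group: "operator_group A (support_module S :: (_ \<Rightarrow> _ \<Rightarrow> 'k::field, _) module)"
proof -
  let ?C = "support_module S :: (_ \<Rightarrow> _ \<Rightarrow> 'k, _) module"
  have "abelian_group ?C"
  proof (rule abelian_groupI)
    show "\<exists>d\<in>carrier ?C. d \<oplus>\<^bsub>?C\<^esub> c = \<zero>\<^bsub>?C\<^esub>" if "c \<in> carrier ?C" for c
      using that by (intro bexI[of _ "\<lambda>u. - c u"]) auto
    show "c \<oplus>\<^bsub>?C\<^esub> d \<in> carrier ?C" if "c \<in> carrier ?C" "d \<in> carrier ?C" for c d
      using that unfolding support_module_simps by (metis add_0)
  qed (auto simp: ac_simps)
  then show ?thesis
    by (auto simp: operator_group_def operator_group_axioms_def distrib_left sum.distrib)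
qed

text \<open>The idempotent generator of the summand of \<open>I\<close>.\<close>

definition koszul_gen :: "'l::{finite,distrib_lattice} \<Rightarrow> 'l set \<Rightarrow> 'l set \<Rightarrow> 'l \<Rightarrow> 'k::field" where
  "koszul_gen x I = (\<lambda>J z. if J = I \<and> z = joins x I then 1 else 0)"

text \<open>A homomorphism from \<open>e_y A\<close> to \<open>A\<close> is determined by the image
  of its generator, a matrix supported in column \<open>y\<close>; this is the entry of that column
  in row \<open>u\<close>. The default zero makes it a cochain on all sets.\<close>

definition koszul_coeff ::
    "'l::{finite,distrib_lattice} \<Rightarrow> nat \<Rightarrow> (('l set \<Rightarrow> 'l \<Rightarrow> 'k::field) \<Rightarrow> 'l \<Rightarrow> 'l \<Rightarrow> 'k) \<Rightarrow> 'l \<Rightarrow> 'l set \<Rightarrow> 'k"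
  where
  "koszul_coeff x i f u I =
    (if I \<subseteq> covers x \<and> card I = i then f (koszul_gen x I) u (joins x I) else 0)"

text \<open>The inverse construction: a homomorphism with prescribed coefficients. Its values lie in
  the incidence algebra as soon as \<open>\<eta> u I\<close> is supported on
  \<open>u \<le> joins x I\<close>.\<close>

definition koszul_hom ::
    "'l::{finite,distrib_lattice} \<Rightarrow> nat \<Rightarrow> ('l \<Rightarrow> 'l set \<Rightarrow> 'k::field) \<Rightarrow> ('l set \<Rightarrow> 'l \<Rightarrow> 'k) \<Rightarrow> 'l \<Rightarrow> 'l \<Rightarrow> 'k" where
  "koszul_hom x i \<eta> = (\<lambda>q\<in>carrier (koszul_module x i). \<lambda>u z. \<Sum>I\<in>UNIV. q I z * \<eta> u I)"

text \<open>
  As a left module, \<open>Ext\<^sup>i(S\<^sub>x, A)\<close> turns out to be spanned by basis elements indexed by \<open>koszul_support x i\<close>;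
  \<open>koszul_class\<close> reads off the class of a cocycle.
\<close>

definition koszul_support :: "'l::{finite,distrib_lattice} \<Rightarrow> nat \<Rightarrow> 'l set" where
  "koszul_support x i = (if i = card (covers x) then {row x..joins x (covers x)} else {})"

definition koszul_class ::
    "'l::{finite,distrib_lattice} \<Rightarrow> nat \<Rightarrow> (('l set \<Rightarrow> 'l \<Rightarrow> 'k::field) \<Rightarrow> 'l \<Rightarrow> 'l \<Rightarrow> 'k) \<Rightarrow> 'l \<Rightarrow> 'k" where
  "koszul_class x i f u =
    (if u \<in> koszul_support x i then f (koszul_gen x (covers x)) u (joins x (covers x)) else 0)"

lemma koszul_gen_carrier: "I \<subseteq> covers x \<Longrightarrow> koszul_gen x I \<in> carrier (koszul_module x (card I))"
  by (auto simp: koszul_gen_def koszul_carrier)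

lemma koszul_hom_module_hom:
  fixes \<eta> :: "'l::{finite,distrib_lattice} \<Rightarrow> 'l set \<Rightarrow> 'k::field"
  assumes "\<And>u I. \<eta> u I \<noteq> 0 \<Longrightarrow> u \<le> joins x I"
  shows "koszul_hom x i \<eta> \<in>
    module_hom incidence_algebra (koszul_module x i) (right_regular incidence_algebra)"
  unfolding koszul_hom_def
proof (intro restrict_module_hom koszul_operator_group operator_homI)
  have carr: "(\<lambda>u z. \<Sum>I\<in>UNIV. q I z * \<eta> u I) \<in> carrier incidence_algebra"
    if q: "q \<in> carrier (koszul_module x i)" for q :: "'l set \<Rightarrow> 'l \<Rightarrow> 'k"
    unfolding incidence_carrier
  proof (intro allI impI)
    fix u z assume "(\<Sum>I\<in>UNIV. q I z * \<eta> u I) \<noteq> 0"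
    then obtain I where "q I z * \<eta> u I \<noteq> 0"
      by (meson sum.not_neutral_contains_not_neutral)
    then show "u \<le> z"
      using koszul_carrierD(3)[OF q, of I z] assms[of u I] by (auto intro: order_trans)
  qed
  then show "(\<lambda>u z. \<Sum>I\<in>UNIV. q I z * \<eta> u I) \<in> carrier (right_regular incidence_algebra)"
    if "q \<in> carrier (koszul_module x i)" for q :: "'l set \<Rightarrow> 'l \<Rightarrow> 'k"
    using that by simp
  fix a :: "'l \<Rightarrow> 'l \<Rightarrow> 'k" and q :: "'l set \<Rightarrow> 'l \<Rightarrow> 'k"
  assume a: "a \<in> carrier incidence_algebra" and q: "q \<in> carrier (koszul_module x i)"
  show "(\<lambda>u z. \<Sum>I\<in>UNIV. (a \<odot>\<^bsub>koszul_module x i\<^esub> q) I z * \<eta> u I) =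
      a \<odot>\<^bsub>right_regular incidence_algebra\<^esub> (\<lambda>u z. \<Sum>I\<in>UNIV. q I z * \<eta> u I)"
  proof (intro ext)
    fix u z
    have "(\<Sum>I\<in>UNIV. \<Sum>w\<in>UNIV. q I w * a w z * \<eta> u I) = (\<Sum>w\<in>UNIV. \<Sum>I\<in>UNIV. q I w * a w z * \<eta> u I)"
      by (rule sum.swap)
    moreover have "(a \<odot>\<^bsub>right_regular incidence_algebra\<^esub> (\<lambda>u z. \<Sum>I\<in>UNIV. q I z * \<eta> u I)) u z =
        (\<Sum>w\<in>UNIV. (\<Sum>I\<in>UNIV. q I w * \<eta> u I) * a w z)"
      by (simp add: incidence_mult[OF carr[OF q] a])
    ultimately show "(\<Sum>I\<in>UNIV. (a \<odot>\<^bsub>koszul_module x i\<^esub> q) I z * \<eta> u I) =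
        (a \<odot>\<^bsub>right_regular incidence_algebra\<^esub> (\<lambda>u z. \<Sum>I\<in>UNIV. q I z * \<eta> u I)) u z"
      by (simp add: sum_distrib_right sum_distrib_left mult_ac)
  qed
qed (simp add: distrib_right sum.distrib)

lemma regular_hom_zero:
  assumes "f \<in> module_hom A M (right_regular A)" "ring A" "operator_group A M"
  shows "f \<zero>\<^bsub>M\<^esub> = \<zero>\<^bsub>A\<^esub>"
  using operator_hom_zero[of M "right_regular A" A f] operator_group_right_regular[OF assms(2)] assms
  by (simp add: module_hom_iff operator_group_def)

text \<open>Additivity splits \<open>c\<close> into its summands, and each summand is its generator
  times a matrix supported in a single row.\<close>

lemma koszul_hom_eval:
  fixes x :: "'l::{finite,distrib_lattice}"
  assumes f: "f \<in> module_hom incidence_algebra (koszul_module x i) (right_regular incidence_algebra)"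
    and c: "c \<in> carrier (koszul_module x i)"
  shows "f c u z = (\<Sum>I\<in>UNIV. c I z * koszul_coeff x i f u I :: 'k::field)"
proof -
  let ?A = "incidence_algebra :: ('k, 'l \<Rightarrow> 'l \<Rightarrow> 'k) module"
  have f': "operator_hom ?A (koszul_module x i) (right_regular ?A) f"
    using f by (simp add: module_hom_iff)
  have f0: "f (\<lambda>I z. 0) = (\<lambda>u z. 0)"
    using regular_hom_zero[OF f ring_incidence_algebra koszul_operator_group] by simp
  have "f c u z = (\<Sum>I\<in>T. c I z * koszul_coeff x i f u I)"
    if "finite T" "c \<in> carrier (koszul_module x i)" "\<forall>I. I \<notin> T \<longrightarrow> c I = (\<lambda>z. 0)" for T c
    using that
  proof (induction arbitrary: c)
    case empty
    then have "c = (\<lambda>I z. 0)" by auto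
    then show ?case by (simp add: f0)
  next
    case (insert I T)
    let ?c1 = "\<lambda>J. if J = I then c I else (\<lambda>z. 0)" and ?c2 = "\<lambda>J. if J = I then (\<lambda>z. 0) else c J"
    have c12: "?c1 \<in> carrier (koszul_module x i)" "?c2 \<in> carrier (koszul_module x i)"
      using insert.prems(1) by (auto simp: koszul_carrier)
    have "f c = f (?c1 \<oplus>\<^bsub>koszul_module x i\<^esub> ?c2)"
      by (rule arg_cong[of _ _ f]) (auto simp: fun_eq_iff)
    also have "\<dots> = (\<lambda>u z. f ?c1 u z + f ?c2 u z)"
      using operator_hom_add[OF f' c12] by simp
    finally have "f c u z = f ?c1 u z + f ?c2 u z" by simp
    moreover have "f ?c2 u z = (\<Sum>J\<in>T. ?c2 J z * koszul_coeff x i f u J)"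
      using insert.prems(2) by (intro insert.IH[OF c12(2)]) auto
    moreover have "(\<Sum>J\<in>T. ?c2 J z * koszul_coeff x i f u J) = (\<Sum>J\<in>T. c J z * koszul_coeff x i f u J)"
      using insert.hyps by (intro sum.cong) auto
    moreover have "f ?c1 u z = c I z * koszul_coeff x i f u I"
    proof (cases "I \<subseteq> covers x \<and> card I = i")
      case True
      \<comment> \<open>The matrix whose row \<open>joins x I\<close> is \<open>c I\<close>: it
        carries the generator to the component of \<open>c\<close> at \<open>I\<close>.\<close>
      define a where "a = (\<lambda>w z. if w = joins x I then c I z else 0)"
      have a: "a \<in> carrier ?A"
        using koszul_carrierD(3)[OF insert.prems(1)] by (auto simp: a_def incidence_carrier)
      have g: "koszul_gen x I \<in> carrier (koszul_module x i)"
        using True koszul_gen_carrier by auto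
      have "?c1 = a \<odot>\<^bsub>koszul_module x i\<^esub> koszul_gen x I"
        by (auto simp: fun_eq_iff a_def koszul_gen_def if_distrib[of "\<lambda>y. y * _"] cong: if_cong)
      then have "f ?c1 = f (koszul_gen x I) \<otimes>\<^bsub>?A\<^esub> a"
        using operator_hom_smult[OF f' a g] by simp
      moreover have "f (koszul_gen x I) \<in> carrier ?A"
        using operator_hom_closed[OF f' g] by simp
      ultimately have "f ?c1 u z = (\<Sum>w\<in>UNIV. f (koszul_gen x I) u w * a w z)"
        using a by (simp add: incidence_mult)
      then show ?thesis
        using True by (simp add: a_def koszul_coeff_def if_distrib[of "(*) _"] mult.commute cong: if_cong)
    next
      case False
      then have "c I z = 0" for z
        using koszul_carrierD(1,2)[OF insert.prems(1), of I z] by blast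
      then have "c I = (\<lambda>z. 0)" by auto
      then have "?c1 = (\<lambda>J z. 0)" by auto
      moreover have "koszul_coeff x i f u I = 0"
        unfolding koszul_coeff_def using False by (rule if_not_P)
      ultimately show ?thesis
        using f0 by simp
    qed
    ultimately show ?case
      using insert.hyps by simp
  qed
  from this[of UNIV c] show ?thesis
    using c by simp
qed

lemma koszul_coeff_support:
  assumes f: "f \<in> module_hom incidence_algebra (koszul_module x i) (right_regular incidence_algebra)"
    and "koszul_coeff x i f u I \<noteq> 0"
  shows "I \<subseteq> covers x" "card I = i" "u \<le> joins x I"
proof -
  show I: "I \<subseteq> covers x" "card I = i"
    using assms(2) by (auto simp: koszul_coeff_def split: if_splits)
  then have "f (koszul_gen x I) \<in> carrier incidence_algebra"
    using f koszul_gen_carrier[OF I(1)] by (auto simp: module_hom_def)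
  then show "u \<le> joins x I"
    using assms(2) by (auto simp: koszul_coeff_def incidence_carrier split: if_splits)
qed

text \<open>By \<open>koszul_adjoint\<close>, pulling back along the differential becomes the
  coboundary on coefficients, separately in each row \<open>u\<close>.\<close>

lemma koszul_hom_diff:
  fixes x :: "'l::{finite,distrib_lattice}"
  assumes f: "f \<in> module_hom incidence_algebra (koszul_module x i) (right_regular incidence_algebra)"
    and c: "c \<in> carrier (koszul_module x (Suc i))"
  shows "f (koszul_diff e x i c) u z =
    (\<Sum>I\<in>UNIV. c I z * koszul_coboundary e (covers x) (koszul_coeff x i f u) I :: 'k::field)"
proof -
  show ?thesis
    using c koszul_diff_closed[OF c, of e] by (simp add: koszul_hom_eval[OF f] koszul_adjoint[symmetric] koszul_diff_def)
qed

lemma koszul_coboundary_zero: "(\<And>I. c I = 0) \<Longrightarrow> koszul_coboundary e S c J = 0"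
  by (auto simp: koszul_coboundary_def expand_def intro: sum.neutral)

section \<open>Cocycles and coboundaries in coefficients, row by row\<close>

context
  fixes e :: "'l::{finite,distrib_lattice} \<Rightarrow> nat" and x :: 'l
  assumes e: "inj e"
begin

interpretation R: resolution "incidence_algebra :: ('k::field, _) module" "incidence_line x" "koszul_module x"
    "koszul_diff e x" "koszul_aug x"
  by (rule koszul_resolution[OF e])

text \<open>Evaluating the cocycle condition at the generator of the summand of \<open>J\<close>
  gives the coboundary at \<open>J\<close>; for other sets \<open>J\<close> each term of the
  coboundary vanishes by support.\<close>

lemma koszul_coeff_cocycle:
  assumes f: "f \<in> cocycles incidence_algebra (koszul_module x) (koszul_diff e x) i"
  shows "koszul_coboundary e (covers x) (koszul_coeff x i f u) J = (0 :: 'k::field)"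
proof (cases "J \<subseteq> covers x \<and> card J = Suc i")
  case True
  let ?g = "koszul_gen x J :: _ \<Rightarrow> _ \<Rightarrow> 'k"
  have fh: "f \<in> module_hom incidence_algebra (koszul_module x i) (right_regular incidence_algebra)"
    using f by (simp add: R.cocycles_iff)
  have g: "?g \<in> carrier (koszul_module x (Suc i))"
    using True koszul_gen_carrier[of J x] by simp
  then have "f (koszul_diff e x i ?g) = (\<lambda>u z. 0)"
    using f by (simp add: R.cocycles_iff)
  then have "(\<Sum>I\<in>UNIV. ?g I (joins x J) * koszul_coboundary e (covers x) (koszul_coeff x i f u) I) = 0"
    using koszul_hom_diff[OF fh g, of e u "joins x J"] by simp
  then show ?thesis
    by (simp add: koszul_gen_def if_distrib[of "\<lambda>y. y * _"] cong: if_cong)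
next
  case False
  have "expand e i' (koszul_coeff x i f u) J = 0" if "i' \<in> covers x" for i'
    using False that card_Suc_Diff1[of J i'] by (auto simp: expand_def koszul_coeff_def)
  then show ?thesis
    by (simp add: koszul_coboundary_def)
qed

text \<open>In rows not above \<open>row x\<close> a removable cover gives a contraction. In rows
  above \<open>row x\<close> the only possible coefficient is that of all covers, which
  \<open>top\<close> annihilates.\<close>

lemma koszul_cocycle_exact:
  fixes f :: "('l set \<Rightarrow> 'l \<Rightarrow> 'k::field) \<Rightarrow> 'l \<Rightarrow> 'l \<Rightarrow> 'k"
  assumes f: "f \<in> cocycles incidence_algebra (koszul_module x) (koszul_diff e x) i"
    and top: "\<And>u. row x \<le> u \<Longrightarrow> u \<le> joins x (covers x) \<Longrightarrow> koszul_coeff x i f u (covers x) = 0"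
  shows "f \<in> coboundaries incidence_algebra (koszul_module x) (koszul_diff e x) i"
proof -
  have fh: "f \<in> module_hom incidence_algebra (koszul_module x i) (right_regular incidence_algebra)"
    using f by (simp add: R.cocycles_iff)
  note supp = koszul_coeff_support[OF fh]
  \<comment> \<open>The cover is \<open>sup x p\<close> for a \<open>p\<close> in
    \<open>minimal_new x\<close> that is not below \<open>u\<close>.\<close>
  have "\<exists>j. \<not> row x \<le> u \<longrightarrow> j \<in> covers x \<and> (\<forall>I. u \<le> joins x I \<longrightarrow> u \<le> joins x (I - {j}))" for u
    using row_le_iff sup_minimal_new le_joins_remove by metis
  then obtain j where j: "\<And>u. \<not> row x \<le> u \<Longrightarrow> j u \<in> covers x"
      "\<And>u I. \<not> row x \<le> u \<Longrightarrow> u \<le> joins x I \<Longrightarrow> u \<le> joins x (I - {j u})"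
    by metis
  \<comment> \<open>The primitive of \<open>f\<close> in coefficients; zero serves above
    \<open>row x\<close> because all coefficients of \<open>f\<close> vanish there.\<close>
  define \<eta> where "\<eta> u I = (if row x \<le> u then 0 else contract e (j u) (koszul_coeff x i f u) I)" for u I
  have \<eta>: "koszul_coboundary e (covers x) (\<eta> u) J = koszul_coeff x i f u J" for u J
  proof (cases "row x \<le> u")
    case True
    have "koszul_coeff x i f u J = 0"
    proof (rule ccontr)
      assume nz: "koszul_coeff x i f u J \<noteq> 0"
      have "J = covers x" "u \<le> joins x J"
        by (rule joins_eq_covers[OF True supp(3)[OF nz] supp(1)[OF nz]], rule supp(3)[OF nz])
      then show False
        using nz top[OF True] by simp
    qed
    then show ?thesis
      using True by (simp add: \<eta>_def koszul_coboundary_zero)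
  next
    case False
    have "contract e (j u) (koszul_coboundary e (covers x) (koszul_coeff x i f u)) J = 0"
      by (simp add: contract_def koszul_coeff_cocycle[OF f])
    moreover have "\<eta> u = contract e (j u) (koszul_coeff x i f u)"
      using False by (simp add: \<eta>_def fun_eq_iff)
    ultimately show ?thesis
      using koszul_coboundary_homotopy[OF e j(1)[OF False], of "koszul_coeff x i f u" J] by simp
  qed
  \<comment> \<open>Removing \<open>j u\<close> preserves \<open>u \<le> joins x I\<close>, so
    \<open>\<eta>\<close> defines a homomorphism one degree lower.\<close>
  have \<eta>_supp: "u \<le> joins x I \<and> Suc (card I) = i" if "\<eta> u I \<noteq> 0" for u I
  proof -
    have u: "\<not> row x \<le> u" "j u \<notin> I" "koszul_coeff x i f u (insert (j u) I) \<noteq> 0"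
      using that by (auto simp: \<eta>_def contract_def split: if_splits)
    then have "insert (j u) I - {j u} = I"
      by auto
    then show ?thesis
      using supp(2,3)[OF u(3)] j(2)[OF u(1), of "insert (j u) I"] u(2) by simp
  qed
  show ?thesis
  proof (cases i)
    \<comment> \<open>There is no lower degree: \<open>\<eta>\<close> vanishes, and with it
      \<open>f\<close>.\<close>
    case 0
    then have "\<eta> u I = 0" for u I
      using \<eta>_supp[of u I] by auto
    then have "koszul_coeff x i f u J = 0" for u J
      using \<eta>[of u J] by (simp add: koszul_coboundary_zero)
    then have "f c = (\<lambda>u z. 0)" if "c \<in> carrier (koszul_module x i)" for c
      using koszul_hom_eval[OF fh that] by (simp add: fun_eq_iff)
    moreover have "f \<in> extensional (carrier (koszul_module x i))"
      using fh by (simp add: module_hom_iff)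
    ultimately have "f = (\<lambda>c\<in>carrier (koszul_module x 0). \<lambda>u z. 0)"
      unfolding 0 by (auto intro!: extensionalityI[of f "carrier (koszul_module x 0)"])
    then show ?thesis
      by (simp add: 0)
  next
    case (Suc i')
    have g: "koszul_hom x i' \<eta> \<in> module_hom incidence_algebra (koszul_module x i') (right_regular incidence_algebra)"
      using \<eta>_supp by (intro koszul_hom_module_hom) auto
    have "f c = koszul_hom x i' \<eta> (koszul_diff e x i' c)" if c: "c \<in> carrier (koszul_module x i)" for c
      using c R.closed[of c i'] koszul_hom_eval[OF fh c]
      by (simp add: fun_eq_iff Suc koszul_hom_def koszul_diff_def koszul_adjoint \<eta>[unfolded Suc])
    moreover have "f \<in> extensional (carrier (koszul_module x i))"
      using fh by (simp add: module_hom_iff)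
    ultimately have "f = compose (carrier (koszul_module x i)) (koszul_hom x i' \<eta>) (koszul_diff e x i')"
      by (intro extensionalityI[of f "carrier (koszul_module x i)"]) (auto simp: compose_def)
    then show ?thesis
      using g unfolding Suc R.coboundaries_iff by blast
  qed
qed

text \<open>A row above \<open>row x\<close> admits no set but that of all covers, so cochains one
  degree lower have no coefficients in it.\<close>

lemma koszul_coboundary_top:
  fixes f :: "('l set \<Rightarrow> 'l \<Rightarrow> 'k::field) \<Rightarrow> 'l \<Rightarrow> 'l \<Rightarrow> 'k"
  assumes f: "f \<in> coboundaries incidence_algebra (koszul_module x) (koszul_diff e x) (card (covers x))"
    and u: "row x \<le> u"
  shows "f (koszul_gen x (covers x)) u (joins x (covers x)) = 0"
proof -
  let ?g = "koszul_gen x (covers x) :: _ \<Rightarrow> _ \<Rightarrow> 'k"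
  have g: "?g \<in> carrier (koszul_module x (card (covers x)))"
    by (rule koszul_gen_carrier) simp
  show ?thesis
  proof (cases "card (covers x)")
    case 0
    then show ?thesis
      using f g by simp
  next
    case (Suc i)
    obtain h where h: "h \<in> module_hom incidence_algebra (koszul_module x i) (right_regular incidence_algebra)"
        "f = compose (carrier (koszul_module x (Suc i))) h (koszul_diff e x i)"
      using f unfolding Suc R.coboundaries_iff by blast
    have "koszul_coeff x i h u I = 0" for I
    proof (rule ccontr)
      assume nz: "koszul_coeff x i h u I \<noteq> 0"
      have "I = covers x"
        by (rule joins_eq_covers[OF u koszul_coeff_support(3)[OF h(1) nz] koszul_coeff_support(1)[OF h(1) nz]])
      then show False
        using koszul_coeff_support(2)[OF h(1) nz] Suc by simp
    qed
    then show ?thesis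
      using g koszul_hom_diff[OF h(1), of ?g e u "joins x (covers x)"]
      by (simp add: Suc h(2) compose_def koszul_coboundary_zero)
  qed
qed

lemma koszul_class_hom:
  "operator_hom incidence_algebra
    ((hom_to_ring incidence_algebra (koszul_module x i))
      \<lparr>carrier := cocycles incidence_algebra (koszul_module x) (koszul_diff e x) i\<rparr>)
    (support_module (koszul_support x i)) (koszul_class x i :: _ \<Rightarrow> 'l \<Rightarrow> 'k::field)"
proof (rule operator_homI)
  let ?g = "koszul_gen x (covers x) :: _ \<Rightarrow> _ \<Rightarrow> 'k"
  let ?A = "incidence_algebra :: ('k, 'l \<Rightarrow> 'l \<Rightarrow> 'k) module"
  have g: "?g \<in> carrier (koszul_module x i)" if "u \<in> koszul_support x i" for u
    using that koszul_gen_carrier[of "covers x" x] by (auto simp: koszul_support_def split: if_splits)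
  fix f f' :: "('l set \<Rightarrow> 'l \<Rightarrow> 'k) \<Rightarrow> 'l \<Rightarrow> 'l \<Rightarrow> 'k" and a
  show "koszul_class x i f \<in> carrier (support_module (koszul_support x i))"
    by (simp add: koszul_class_def)
  show "koszul_class x i (f \<oplus>\<^bsub>(hom_to_ring ?A (koszul_module x i))
      \<lparr>carrier := cocycles ?A (koszul_module x) (koszul_diff e x) i\<rparr>\<^esub> f') =
      koszul_class x i f \<oplus>\<^bsub>support_module (koszul_support x i)\<^esub> koszul_class x i f'"
    using g by (auto simp: koszul_class_def fun_eq_iff)
  assume a: "a \<in> carrier ?A"
    and f: "f \<in> carrier ((hom_to_ring ?A (koszul_module x i))
      \<lparr>carrier := cocycles ?A (koszul_module x) (koszul_diff e x) i\<rparr>)"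
  show "koszul_class x i (a \<odot>\<^bsub>(hom_to_ring ?A (koszul_module x i))
      \<lparr>carrier := cocycles ?A (koszul_module x) (koszul_diff e x) i\<rparr>\<^esub> f) =
      a \<odot>\<^bsub>support_module (koszul_support x i)\<^esub> koszul_class x i f"
  proof
    fix u
    show "koszul_class x i (a \<odot>\<^bsub>(hom_to_ring ?A (koszul_module x i))
      \<lparr>carrier := cocycles ?A (koszul_module x) (koszul_diff e x) i\<rparr>\<^esub> f) u =
      (a \<odot>\<^bsub>support_module (koszul_support x i)\<^esub> koszul_class x i f) u"
    proof (cases "u \<in> koszul_support x i")
      case True
      have fg: "f ?g \<in> carrier ?A"
        using f g[OF True] by (auto simp: R.cocycles_iff module_hom_def)
      \<comment> \<open>A nonzero left-hand side has \<open>u \<le> w\<close> from \<open>a\<close>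
        and \<open>w\<close> below the join of all covers from \<open>f\<close>; as \<open>u\<close>
        is above \<open>row x\<close>, so is \<open>w\<close>, and the truncation loses
        nothing.\<close>
      have "a u w * f ?g w (joins x (covers x)) = a u w * koszul_class x i f w" for w
        using a fg True by (auto simp: koszul_class_def koszul_support_def incidence_carrier
            split: if_splits intro: order_trans)
      then have "(\<Sum>w\<in>UNIV. a u w * f ?g w (joins x (covers x))) = (\<Sum>w\<in>UNIV. a u w * koszul_class x i f w)"
        by (rule sum.cong[OF refl])
      then show ?thesis
        using True g[OF True] by (simp add: koszul_class_def[of x i "\<lambda>p\<in>_. _ p"] incidence_mult[OF a fg])
    qed (simp add: koszul_class_def)
  qed
qed

lemma koszul_class_surj:
  "koszul_class x i ` cocycles incidence_algebra (koszul_module x) (koszul_diff e x) i =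
    carrier (support_module (koszul_support x i) :: (_ \<Rightarrow> _ \<Rightarrow> 'k::field, _) module)"
proof (intro equalityI subsetI)
  fix c :: "'l \<Rightarrow> 'k" assume c: "c \<in> carrier (support_module (koszul_support x i))"
  \<comment> \<open>The vector \<open>c\<close> is placed on the set of all covers.\<close>
  define \<eta> where "\<eta> u I = (if I = covers x then c u else 0)" for u I
  let ?f = "koszul_hom x i \<eta>"
  have fh: "?f \<in> module_hom incidence_algebra (koszul_module x i) (right_regular incidence_algebra)"
    using c by (intro koszul_hom_module_hom) (auto simp: \<eta>_def koszul_support_def split: if_splits)
  moreover have "?f (koszul_diff e x i q) = (\<lambda>u z. 0)" if q: "q \<in> carrier (koszul_module x (Suc i))" for q
  proof -
    \<comment> \<open>No cover is left to insert into the set of all covers, so every boundary has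
      coefficient zero there. Hence \<open>?f\<close> is a cocycle.\<close>
    have "koszul_boundary e (covers x) (\<lambda>I. q I z) (covers x) = 0" for z
      by (meson koszul_boundary_support)
    then have "(\<Sum>I\<in>UNIV. koszul_diff e x i q I z * \<eta> u I) = 0" for u z
      using q by (intro sum.neutral) (simp add: koszul_diff_def \<eta>_def)
    then show ?thesis
      using R.closed[OF q] by (simp add: koszul_hom_def)
  qed
  ultimately have "?f \<in> cocycles incidence_algebra (koszul_module x) (koszul_diff e x) i"
    by (simp add: R.cocycles_iff)
  moreover have "koszul_class x i ?f = c"
  proof
    fix u
    show "koszul_class x i ?f u = c u"
    proof (cases "u \<in> koszul_support x i")
      case True
      then have "(koszul_gen x (covers x) :: _ \<Rightarrow> _ \<Rightarrow> 'k) \<in> carrier (koszul_module x i)"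
        using koszul_gen_carrier[of "covers x" x] by (auto simp: koszul_support_def split: if_splits)
      then have "koszul_class x i ?f u =
          (\<Sum>I\<in>UNIV. koszul_gen x (covers x) I (joins x (covers x)) * \<eta> u I)"
        using True by (simp add: koszul_class_def koszul_hom_def)
      then show ?thesis
        by (simp add: koszul_gen_def \<eta>_def if_distrib[of "\<lambda>y. y * _"] cong: if_cong)
    next
      case False
      then show ?thesis
        using c by (auto simp: koszul_class_def)
    qed
  qed
  ultimately show "c \<in> koszul_class x i ` cocycles incidence_algebra (koszul_module x) (koszul_diff e x) i"
    by blast
qed (auto simp: koszul_class_def split: if_splits)

lemma koszul_class_kernel:
  assumes f: "f \<in> cocycles incidence_algebra (koszul_module x) (koszul_diff e x) i"
  shows "koszul_class x i f = \<zero>\<^bsub>support_module (koszul_support x i) :: (_ \<Rightarrow> _ \<Rightarrow> 'k::field, _) module\<^esub> \<longleftrightarrow>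
    f \<in> coboundaries incidence_algebra (koszul_module x) (koszul_diff e x) i"
proof
  assume 0: "koszul_class x i f = \<zero>\<^bsub>support_module (koszul_support x i) :: (_ \<Rightarrow> _ \<Rightarrow> 'k, _) module\<^esub>"
  show "f \<in> coboundaries incidence_algebra (koszul_module x) (koszul_diff e x) i"
  proof (rule koszul_cocycle_exact[OF f])
    fix u assume "row x \<le> u" "u \<le> joins x (covers x)"
    then show "koszul_coeff x i f u (covers x) = 0"
      using fun_cong[OF 0, of u]
      by (cases "i = card (covers x)") (simp_all add: koszul_coeff_def koszul_class_def koszul_support_def)
  qed
next
  assume "f \<in> coboundaries incidence_algebra (koszul_module x) (koszul_diff e x) i"
  then show "koszul_class x i f = \<zero>\<^bsub>support_module (koszul_support x i) :: (_ \<Rightarrow> _ \<Rightarrow> 'k, _) module\<^esub>"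
    using koszul_coboundary_top[of f]
    by (auto simp: koszul_class_def koszul_support_def fun_eq_iff)
qed

end

section \<open>Duals and tops\<close>

text \<open>Linearity of \<open>L\<close> is stated on the carrier only, since \<open>L\<close> will
  be a functional composed with an inverse identification.\<close>

lemma support_module_expansion:
  fixes L :: "('l::{finite,order} \<Rightarrow> 'k::field) \<Rightarrow> 'k" and S :: "'l set"
  defines "C \<equiv> carrier (support_module S :: (_ \<Rightarrow> _ \<Rightarrow> 'k, _) module)"
  assumes add: "\<And>v w. v \<in> C \<Longrightarrow> w \<in> C \<Longrightarrow> L (\<lambda>u. v u + w u) = L v + L w"
    and scale: "\<And>c v. v \<in> C \<Longrightarrow> L (\<lambda>u. c * v u) = c * L v" and v: "v \<in> C"
  shows "L v = (\<Sum>w\<in>S. v w * L (\<lambda>u. if u = w then 1 else 0))"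
proof -
  have "L v = (\<Sum>w\<in>T. v w * L (\<lambda>u. if u = w then 1 else 0))"
    if "finite T" "T \<subseteq> S" "\<And>u. v u \<noteq> 0 \<Longrightarrow> u \<in> T" for T v
    using that
  proof (induction arbitrary: v)
    case empty
    then have "v = (\<lambda>u. 0 * v u)" by auto
    moreover have "v \<in> C"
      using empty by (auto simp: C_def)
    ultimately have "L v = 0"
      using scale[of v 0] by simp
    then show ?case by simp
  next
    case (insert w T)
    let ?d = "\<lambda>u. if u = w then 1 else 0 :: 'k"
    have d: "?d \<in> C" "(\<lambda>u. v w * ?d u) \<in> C" and v': "v(w := 0) \<in> C"
      using insert.prems by (auto simp: C_def)
    have "v = (\<lambda>u. v w * ?d u + (v(w := 0)) u)"
      by auto
    then have "L v = L (\<lambda>u. v w * ?d u + (v(w := 0)) u)"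
      by (rule arg_cong)
    also have "\<dots> = v w * L ?d + L (v(w := 0))"
      by (simp only: add[OF d(2) v'] scale[OF d(1)])
    also have "L (v(w := 0)) = (\<Sum>z\<in>T. (v(w := 0)) z * L (\<lambda>u. if u = z then 1 else 0))"
      using insert.prems by (intro insert.IH) (auto split: if_splits)
    also have "\<dots> = (\<Sum>z\<in>T. v z * L (\<lambda>u. if u = z then 1 else 0))"
      using insert.hyps by (intro sum.cong) auto
    finally show ?case
      using insert.hyps by simp
  qed
  from this[of S v] show ?thesis
    using v by (simp add: C_def)
qed

lemma dual_module_simps [simp]:
  "\<zero>\<^bsub>dual_module A M\<^esub> = (\<lambda>m\<in>carrier M. 0)"
  "\<phi> \<oplus>\<^bsub>dual_module A M\<^esub> \<psi> = (\<lambda>m\<in>carrier M. \<phi> m + \<psi> m)"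
  "a \<odot>\<^bsub>dual_module A M\<^esub> \<phi> = (\<lambda>m\<in>carrier M. \<phi> (a \<odot>\<^bsub>M\<^esub> m))"
  by (simp_all add: dual_module_def)

lemma dual_carrier:
  "\<phi> \<in> carrier (dual_module A M) \<longleftrightarrow> \<phi> \<in> extensional (carrier M) \<and>
    (\<forall>m\<in>carrier M. \<forall>n\<in>carrier M. \<phi> (m \<oplus>\<^bsub>M\<^esub> n) = \<phi> m + \<phi> n) \<and>
    (\<forall>c. \<forall>m\<in>carrier M. \<phi> ((c \<odot>\<^bsub>A\<^esub> \<one>\<^bsub>A\<^esub>) \<odot>\<^bsub>M\<^esub> m) = c * \<phi> m)"
  by (simp add: dual_module_def)

text \<open>Linearity over the field is expressed by the elements \<open>c 1\<close> of the algebra,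
  so these must commute with every operator for the dual to be stable. Operator groups forget the
  multiplication of the algebra, which makes this a hypothesis.\<close>

lemma dual_operator_group:
  assumes M: "operator_group A M"
    and scalar: "\<And>c. c \<odot>\<^bsub>A\<^esub> \<one>\<^bsub>A\<^esub> \<in> carrier A"
    and central: "\<And>a c m. a \<in> carrier A \<Longrightarrow> m \<in> carrier M \<Longrightarrow>
      a \<odot>\<^bsub>M\<^esub> ((c \<odot>\<^bsub>A\<^esub> \<one>\<^bsub>A\<^esub>) \<odot>\<^bsub>M\<^esub> m) = (c \<odot>\<^bsub>A\<^esub> \<one>\<^bsub>A\<^esub>) \<odot>\<^bsub>M\<^esub> (a \<odot>\<^bsub>M\<^esub> m)"
  shows "operator_group A (dual_module A M)"
proof -
  interpret M: operator_group A M by fact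
  let ?D = "dual_module A M"
  have sc: "(c \<odot>\<^bsub>A\<^esub> \<one>\<^bsub>A\<^esub>) \<odot>\<^bsub>M\<^esub> m \<in> carrier M" if "m \<in> carrier M" for c m
    by (rule M.op_closed[OF scalar that])
  have "abelian_group ?D"
  proof (rule abelian_groupI)
    show "\<phi> \<oplus>\<^bsub>?D\<^esub> \<psi> \<in> carrier ?D" if "\<phi> \<in> carrier ?D" "\<psi> \<in> carrier ?D" for \<phi> \<psi>
      using that by (auto simp: dual_carrier sc distrib_left)
    show "\<exists>\<psi>\<in>carrier ?D. \<psi> \<oplus>\<^bsub>?D\<^esub> \<phi> = \<zero>\<^bsub>?D\<^esub>" if "\<phi> \<in> carrier ?D" for \<phi>
      using that by (intro bexI[of _ "\<lambda>m\<in>carrier M. - \<phi> m"]) (auto simp: dual_carrier sc intro!: restrict_ext)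
    show "\<zero>\<^bsub>?D\<^esub> \<oplus>\<^bsub>?D\<^esub> \<phi> = \<phi>" if "\<phi> \<in> carrier ?D" for \<phi>
      using that by (auto simp: dual_carrier intro!: extensionalityI[of _ "carrier M"])
  qed (auto simp: dual_carrier sc add_ac intro!: restrict_ext)
  then show ?thesis
    by (auto simp: operator_group_def operator_group_axioms_def dual_carrier sc M.op_closed
        M.op_distr central intro!: restrict_ext)
qed

text \<open>On the dual basis the right action carries the functional at \<open>r\<close> to the
  functional at any \<open>z\<close> of the interval, as \<open>r\<close> is its least element.
  Hence every functional not vanishing on the basis vector at \<open>r\<close> generates the dual,
  and \<open>module_top_iso\<close> applies to evaluation there.\<close>

lemma top_dual_interval:
  fixes H :: "('l::{finite,order} \<Rightarrow> 'l \<Rightarrow> 'k::field, 'h) module"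
  assumes H: "operator_group incidence_algebra H"
    and h: "operator_hom incidence_algebra H (support_module {r..m}) h"
    and bij: "bij_betw h (carrier H) (carrier (support_module {r..m} :: (_ \<Rightarrow> _ \<Rightarrow> 'k, _) module))"
    and le: "r \<le> m"
  shows "operator_group incidence_algebra (module_top incidence_algebra (dual_module incidence_algebra H))"
    and "\<exists>g. operator_hom incidence_algebra (module_top incidence_algebra (dual_module incidence_algebra H))
        (incidence_line r) g \<and>
      bij_betw g (carrier (module_top incidence_algebra (dual_module incidence_algebra H)))
        (carrier (incidence_line r :: (_ \<Rightarrow> _ \<Rightarrow> 'k, _) module))"
proof -
  let ?A = "incidence_algebra :: ('k, 'l \<Rightarrow> 'l \<Rightarrow> 'k) module"
  let ?C = "support_module {r..m} :: ('l \<Rightarrow> 'l \<Rightarrow> 'k, _) module"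
  let ?D = "dual_module ?A H"
  let ?k = "incidence_line r :: ('l \<Rightarrow> 'l \<Rightarrow> 'k, _) module"
  let ?\<delta> = "\<lambda>w u. if u = w then 1 else 0 :: 'k"
  interpret H: operator_group ?A H by fact
  define t where "t = inv_into (carrier H) h"
  have t: "operator_hom ?A ?C H t"
    unfolding t_def by (rule operator_hom_inv_into[OF H h bij])
  note tc = operator_hom_closed[OF t] and hc = operator_hom_closed[OF h]
  have th: "t (h n) = n" if "n \<in> carrier H" for n
    using that bij by (simp add: t_def bij_betw_def)
  have ht: "h (t v) = v" if "v \<in> carrier ?C" for v
    using that bij by (simp add: t_def bij_betw_def f_inv_into_f)
  \<comment> \<open>The scalar \<open>c\<close> as a diagonal matrix, the form in which
    \<open>dual_module\<close> refers to it.\<close>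
  define s where "s c = c \<odot>\<^bsub>?A\<^esub> \<one>\<^bsub>?A\<^esub>" for c
  have s: "s c \<in> carrier ?A" for c
    by (simp add: s_def incidence_one incidence_carrier)
  have s_C: "s c \<odot>\<^bsub>?C\<^esub> v = (\<lambda>u. c * v u)" if "v \<in> carrier ?C" for c v
    using that by (auto simp: s_def incidence_one fun_eq_iff if_distrib[of "\<lambda>y. y * _"] if_distrib[of "(*) _"] cong: if_cong)
  have C_closed: "a \<odot>\<^bsub>?C\<^esub> v \<in> carrier ?C" for a v
    by simp
  have central: "a \<odot>\<^bsub>H\<^esub> (s c \<odot>\<^bsub>H\<^esub> n) = s c \<odot>\<^bsub>H\<^esub> (a \<odot>\<^bsub>H\<^esub> n)"
    if a: "a \<in> carrier ?A" and n: "n \<in> carrier H" for a c n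
  proof -
    have "h (a \<odot>\<^bsub>H\<^esub> (s c \<odot>\<^bsub>H\<^esub> n)) = a \<odot>\<^bsub>?C\<^esub> (s c \<odot>\<^bsub>?C\<^esub> h n)"
      by (simp only: operator_hom_smult[OF h] a s n H.op_closed)
    also have "\<dots> = (\<lambda>u. c * (a \<odot>\<^bsub>?C\<^esub> h n) u)"
      by (simp only: s_C[OF hc[OF n]]) (auto simp: fun_eq_iff sum_distrib_left mult_ac)
    also have "\<dots> = s c \<odot>\<^bsub>?C\<^esub> (a \<odot>\<^bsub>?C\<^esub> h n)"
      by (rule s_C[OF C_closed, symmetric])
    also have "\<dots> = h (s c \<odot>\<^bsub>H\<^esub> (a \<odot>\<^bsub>H\<^esub> n))"
      by (simp only: operator_hom_smult[OF h] a s n H.op_closed)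
    finally show ?thesis
      using th a s n H.op_closed by metis
  qed
  have D: "operator_group ?A ?D"
    by (rule dual_operator_group[OF H s[unfolded s_def] central[unfolded s_def]])
  have \<delta>: "?\<delta> w \<in> carrier ?C" if "w \<in> {r..m}" for w
    using that by simp
  have r: "r \<in> {r..m}" using le by simp
  have expansion: "\<phi> (t v) = (\<Sum>w\<in>{r..m}. v w * \<phi> (t (?\<delta> w)))" if \<phi>: "\<phi> \<in> carrier ?D" and v: "v \<in> carrier ?C" for \<phi> v
  proof (rule support_module_expansion[where L = "\<lambda>v. \<phi> (t v)"])
    show "\<phi> (t (\<lambda>u. v u + w u)) = \<phi> (t v) + \<phi> (t w)" if "v \<in> carrier ?C" "w \<in> carrier ?C" for v w
    proof -
      have "t (\<lambda>u. v u + w u) = t v \<oplus>\<^bsub>H\<^esub> t w"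
        using operator_hom_add[OF t that] by simp
      then show ?thesis
        using \<phi> tc that by (simp only: dual_carrier)
    qed
    show "\<phi> (t (\<lambda>u. c * v u)) = c * \<phi> (t v)" if "v \<in> carrier ?C" for c v
    proof -
      have "t (\<lambda>u. c * v u) = s c \<odot>\<^bsub>H\<^esub> t v"
        using operator_hom_smult[OF t s that] s_C[OF that] by simp
      then show ?thesis
        using \<phi> tc that by (simp only: dual_carrier s_def)
    qed
  qed (rule v)
  define F where "F \<phi> = \<phi> (t (?\<delta> r))" for \<phi> :: "'h \<Rightarrow> 'k"
  have F: "operator_hom ?A ?D ?k F"
  proof (rule operator_homI)
    show "F (\<phi> \<oplus>\<^bsub>?D\<^esub> \<psi>) = F \<phi> \<oplus>\<^bsub>?k\<^esub> F \<psi>" for \<phi> \<psi>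
      using tc[OF \<delta>[OF r]] by (simp add: F_def)
    show "F (a \<odot>\<^bsub>?D\<^esub> \<phi>) = a \<odot>\<^bsub>?k\<^esub> F \<phi>" if a: "a \<in> carrier ?A" and \<phi>: "\<phi> \<in> carrier ?D" for a \<phi>
    proof -
      \<comment> \<open>Column \<open>r\<close> of \<open>a\<close> has no entry strictly above
        \<open>r\<close>, so inside the interval only the diagonal entry acts on the basis vector at
        \<open>r\<close>.\<close>
      have a0: "a w r = 0" if "r \<le> w" "w \<noteq> r" for w
        using a that unfolding incidence_carrier by (metis order_antisym)
      have "F (a \<odot>\<^bsub>?D\<^esub> \<phi>) = \<phi> (t (a \<odot>\<^bsub>?C\<^esub> ?\<delta> r))"
        using tc[OF \<delta>[OF r]] operator_hom_smult[OF t a \<delta>[OF r]] by (simp only: F_def dual_module_simps restrict_apply if_True)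
      also have "\<dots> = (\<Sum>w\<in>{r..m}. (a \<odot>\<^bsub>?C\<^esub> ?\<delta> r) w * \<phi> (t (?\<delta> w)))"
        by (rule expansion[OF \<phi> C_closed])
      also have "\<dots> = (\<Sum>w\<in>{r..m}. if w = r then a r r * \<phi> (t (?\<delta> r)) else 0)"
        using a0 by (intro sum.cong) (auto simp: if_distrib[of "(*) _"] cong: if_cong)
      also have "\<dots> = a r r * \<phi> (t (?\<delta> r))"
        using le by simp
      finally show ?thesis
        by (simp add: F_def mult.commute)
    qed
  qed simp
  have surj: "F ` carrier ?D = carrier ?k"
  proof -
    have "c \<in> F ` carrier ?D" for c
    proof
      \<comment> \<open>A multiple of the coordinate functional at \<open>r\<close>.\<close>
      let ?\<phi> = "\<lambda>n\<in>carrier H. c * h n r"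
      show "?\<phi> \<in> carrier ?D"
        unfolding dual_carrier s_def[symmetric]
      proof (intro conjI ballI allI)
        fix n n' d assume n: "n \<in> carrier H" "n' \<in> carrier H"
        show "?\<phi> (n \<oplus>\<^bsub>H\<^esub> n') = ?\<phi> n + ?\<phi> n'"
          using n operator_hom_add[OF h n] by (simp add: distrib_left)
      next
        fix n d assume n: "n \<in> carrier H"
        have "h (s d \<odot>\<^bsub>H\<^esub> n) = (\<lambda>u. d * h n u)"
          using operator_hom_smult[OF h s n] s_C[OF hc[OF n]] by simp
        then show "?\<phi> (s d \<odot>\<^bsub>H\<^esub> n) = d * ?\<phi> n"
          using n H.op_closed[OF s n] by simp
      qed simp
      show "c = F ?\<phi>"
        using tc[OF \<delta>[OF r]] ht[OF \<delta>[OF r]] by (simp add: F_def)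
    qed
    then show ?thesis by auto
  qed
  have gen: "\<exists>a\<in>carrier ?A. a \<odot>\<^bsub>?D\<^esub> \<phi> = \<psi>"
    if \<phi>: "\<phi> \<in> carrier ?D" "F \<phi> \<noteq> \<zero>\<^bsub>?k\<^esub>" and \<psi>: "\<psi> \<in> carrier ?D" for \<phi> \<psi>
  proof
    \<comment> \<open>This matrix sends the basis vector at \<open>z\<close> to the multiple of the
      one at \<open>r\<close> on which \<open>\<phi>\<close> takes the value of
      \<open>\<psi>\<close> at \<open>z\<close>.\<close>
    define a where "a = (\<lambda>u z. if u = r \<and> z \<in> {r..m} then \<psi> (t (?\<delta> z)) / F \<phi> else 0)"
    show a: "a \<in> carrier ?A"
      by (auto simp: a_def incidence_carrier)
    have "\<phi> (a \<odot>\<^bsub>H\<^esub> n) = \<psi> n" if n: "n \<in> carrier H" for n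
    proof -
      let ?v = "h n"
      have v: "?v \<in> carrier ?C" by (rule hc[OF n])
      have av: "(a \<odot>\<^bsub>?C\<^esub> ?v) u = (if u = r then (\<Sum>w\<in>{r..m}. \<psi> (t (?\<delta> w)) / F \<phi> * ?v w) else 0)" for u
        using le by (auto simp: a_def intro!: sum.mono_neutral_cong_right)
      have "a \<odot>\<^bsub>H\<^esub> n = t (a \<odot>\<^bsub>?C\<^esub> ?v)"
        using operator_hom_smult[OF t a v] th[OF n] by simp
      then have "\<phi> (a \<odot>\<^bsub>H\<^esub> n) = (\<Sum>w\<in>{r..m}. (a \<odot>\<^bsub>?C\<^esub> ?v) w * \<phi> (t (?\<delta> w)))"
        using expansion[OF \<phi>(1) C_closed] by simp
      also have "\<dots> = (\<Sum>w\<in>{r..m}. if w = r then (\<Sum>w\<in>{r..m}. \<psi> (t (?\<delta> w)) / F \<phi> * ?v w) * F \<phi> else 0)"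
        by (rule sum.cong) (simp_all only: av F_def if_distrib[of "\<lambda>y. y * _"] mult_zero_left cong: if_cong)
      also have "\<dots> = (\<Sum>w\<in>{r..m}. \<psi> (t (?\<delta> w)) / F \<phi> * ?v w) * F \<phi>"
        using le by simp
      also have "\<dots> = (\<Sum>w\<in>{r..m}. ?v w * \<psi> (t (?\<delta> w)))"
        unfolding sum_distrib_right using \<phi>(2) by (intro sum.cong) (auto simp: field_simps)
      also have "\<dots> = \<psi> (t ?v)"
        by (rule expansion[OF \<psi> v, symmetric])
      finally show ?thesis
        by (simp add: th[OF n])
    qed
    moreover have "\<psi> \<in> extensional (carrier H)"
      using \<psi> by (simp add: dual_carrier)
    ultimately show "a \<odot>\<^bsub>?D\<^esub> \<phi> = \<psi>"
      by (auto intro!: extensionalityI[of _ "carrier H"])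
  qed
  have nontrivial: "carrier ?k \<noteq> {\<zero>\<^bsub>?k\<^esub>}"
    using zero_neq_one by (metis UNIV_I incidence_line_simps(1,2) singletonD)
  show "operator_group ?A (module_top ?A ?D)"
    and "\<exists>g. operator_hom ?A (module_top ?A ?D) ?k g \<and> bij_betw g (carrier (module_top ?A ?D)) (carrier ?k)"
    using module_top_iso[OF D incidence_line_operator_group F surj nontrivial gen] by blast+
qed

text \<open>\<open>e_r A\<close> consists of the matrices supported in row \<open>r\<close>. Any of
  them with nonzero diagonal entry generates it, so the diagonal entry is the projection onto the
  top.\<close>

lemma incidence_simple_iso:
  fixes r :: "'l::{finite,order}"
  shows "operator_group incidence_algebra (incidence_simple r :: ('l \<Rightarrow> 'l \<Rightarrow> 'k::field, _) module)"
    and "\<exists>g. operator_hom incidence_algebra (incidence_simple r) (incidence_line r) g \<and>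
      bij_betw g (carrier (incidence_simple r)) (carrier (incidence_line r :: ('l \<Rightarrow> 'l \<Rightarrow> 'k, _) module))"
proof -
  let ?A = "incidence_algebra :: ('k, 'l \<Rightarrow> 'l \<Rightarrow> 'k) module"
  let ?P = "incidence_projective r :: ('l \<Rightarrow> 'l \<Rightarrow> 'k, _) module"
  let ?k = "incidence_line r :: ('l \<Rightarrow> 'l \<Rightarrow> 'k, _) module"
  interpret A: ring ?A by (rule ring_incidence_algebra)
  have e: "incidence_basis r r \<in> carrier ?A"
    by (simp add: incidence_basis_def incidence_carrier)
  have P_ops: "\<zero>\<^bsub>?P\<^esub> = (\<lambda>u z. 0)" "f \<oplus>\<^bsub>?P\<^esub> g = (\<lambda>u z. f u z + g u z)" "a \<odot>\<^bsub>?P\<^esub> f = f \<otimes>\<^bsub>?A\<^esub> a" for f g a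
    by (simp_all add: incidence_projective_def right_regular_def)
  have em: "(incidence_basis r r \<otimes>\<^bsub>?A\<^esub> a) = (\<lambda>u z. if u = r then a r z else 0)" if "a \<in> carrier ?A" for a
  proof (intro ext)
    fix u z
    show "(incidence_basis r r \<otimes>\<^bsub>?A\<^esub> a) u z = (if u = r then a r z else 0)"
      unfolding incidence_mult[OF e that]
      by (cases "u = r") (simp_all add: incidence_basis_def if_distrib[of "\<lambda>y. y * _"] cong: if_cong)
  qed
  have P: "f \<in> carrier ?P \<longleftrightarrow> f \<in> carrier ?A \<and> (\<forall>u z. u \<noteq> r \<longrightarrow> f u z = 0)" for f
  proof
    assume "f \<in> carrier ?P"
    then obtain a where "a \<in> carrier ?A" "f = incidence_basis r r \<otimes>\<^bsub>?A\<^esub> a"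
      by (auto simp: incidence_projective_def)
    then show "f \<in> carrier ?A \<and> (\<forall>u z. u \<noteq> r \<longrightarrow> f u z = 0)"
      using A.m_closed[OF e] by (auto simp: em)
  next
    assume f: "f \<in> carrier ?A \<and> (\<forall>u z. u \<noteq> r \<longrightarrow> f u z = 0)"
    then have "f = incidence_basis r r \<otimes>\<^bsub>?A\<^esub> f"
      by (auto simp: em fun_eq_iff)
    then show "f \<in> carrier ?P"
      using f by (auto simp: incidence_projective_def)
  qed
  have mult: "(f \<otimes>\<^bsub>?A\<^esub> a) u z = (\<Sum>w\<in>UNIV. f u w * a w z)" if "f \<in> carrier ?P" "a \<in> carrier ?A" for f a u z
    using that by (simp add: P incidence_mult)
  have closed: "f \<otimes>\<^bsub>?A\<^esub> a \<in> carrier ?P" if "f \<in> carrier ?P" "a \<in> carrier ?A" for f a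
    unfolding P using that by (simp add: mult) (simp add: P)
  have "abelian_group ?P"
  proof (rule abelian_groupI)
    show "f \<oplus>\<^bsub>?P\<^esub> g \<in> carrier ?P" if "f \<in> carrier ?P" "g \<in> carrier ?P" for f g
      using that unfolding P P_ops incidence_carrier by (metis add_0)
    show "\<exists>g\<in>carrier ?P. g \<oplus>\<^bsub>?P\<^esub> f = \<zero>\<^bsub>?P\<^esub>" if "f \<in> carrier ?P" for f
      using that by (intro bexI[of _ "\<lambda>u z. - f u z"]) (auto simp: P P_ops incidence_carrier)
  qed (auto simp: P P_ops incidence_carrier ac_simps)
  moreover have "operator_group_axioms ?A ?P"
  proof
    show "a \<odot>\<^bsub>?P\<^esub> f \<in> carrier ?P" if "a \<in> carrier ?A" "f \<in> carrier ?P" for a f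
      unfolding P_ops by (rule closed[OF that(2,1)])
    show "a \<odot>\<^bsub>?P\<^esub> (f \<oplus>\<^bsub>?P\<^esub> g) = a \<odot>\<^bsub>?P\<^esub> f \<oplus>\<^bsub>?P\<^esub> a \<odot>\<^bsub>?P\<^esub> g"
      if "a \<in> carrier ?A" "f \<in> carrier ?P" "g \<in> carrier ?P" for a f g
      using A.l_distr[of f g a] that by (simp add: P P_ops)
  qed
  ultimately have og: "operator_group ?A ?P"
    by (simp add: operator_group_def)
  define F where "F f = f r r" for f :: "'l \<Rightarrow> 'l \<Rightarrow> 'k"
  have F: "operator_hom ?A ?P ?k F"
  proof (rule operator_homI)
    show "F (a \<odot>\<^bsub>?P\<^esub> f) = a \<odot>\<^bsub>?k\<^esub> F f" if a: "a \<in> carrier ?A" and f: "f \<in> carrier ?P" for a f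
    proof -
      have "f r w * a w r = 0" if "w \<noteq> r" for w
        using a f that unfolding P incidence_carrier by (metis mult_eq_0_iff order_antisym)
      then have "(\<Sum>w\<in>UNIV. f r w * a w r) = (\<Sum>w\<in>{r}. f r w * a w r)"
        by (intro sum.mono_neutral_right) auto
      then show ?thesis
        by (simp add: F_def P_ops mult[OF f a])
    qed
  qed (simp_all add: F_def P_ops)
  have "c \<in> F ` carrier ?P" for c
    by (intro image_eqI[of _ _ "\<lambda>u z. if u = r \<and> z = r then c else 0"]) (auto simp: F_def P incidence_carrier)
  then have surj: "F ` carrier ?P = carrier ?k"
    by auto
  have gen: "\<exists>a\<in>carrier ?A. a \<odot>\<^bsub>?P\<^esub> f = g"
    if f: "f \<in> carrier ?P" "F f \<noteq> \<zero>\<^bsub>?k\<^esub>" and g: "g \<in> carrier ?P" for f g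
  proof
    \<comment> \<open>Supported in row \<open>r\<close>, it picks the diagonal entry of
      \<open>f\<close>, divides by it and produces row \<open>r\<close> of \<open>g\<close>.\<close>
    let ?a = "\<lambda>u z. if u = r then g r z / f r r else 0"
    show a: "?a \<in> carrier ?A"
      using g by (auto simp: P incidence_carrier)
    show "?a \<odot>\<^bsub>?P\<^esub> f = g"
    proof (intro ext)
      fix u z
      show "(?a \<odot>\<^bsub>?P\<^esub> f) u z = g u z"
        unfolding P_ops mult[OF f(1) a] using f g
        by (cases "u = r") (simp_all add: P F_def if_distrib[of "(*) _"] cong: if_cong)
    qed
  qed
  have nontrivial: "carrier ?k \<noteq> {\<zero>\<^bsub>?k\<^esub>}"
    using zero_neq_one by (metis UNIV_I incidence_line_simps(1,2) singletonD)
  show "operator_group ?A (incidence_simple r)"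
    and "\<exists>g. operator_hom ?A (incidence_simple r) ?k g \<and> bij_betw g (carrier (incidence_simple r)) (carrier ?k)"
    unfolding incidence_simple_def
    using module_top_iso[OF og incidence_line_operator_group F surj nontrivial gen] by blast+
qed

section \<open>The grade bijection\<close>

lemma Ext_incidence_simple:
  fixes x :: "'l::{finite,distrib_lattice}"
  shows "operator_group incidence_algebra (Ext incidence_algebra i (incidence_simple x :: ('l \<Rightarrow> 'l \<Rightarrow> 'k::field, _) module))"
    and "\<exists>h. operator_hom incidence_algebra (Ext incidence_algebra i (incidence_simple x)) (support_module (koszul_support x i)) h \<and>
      bij_betw h (carrier (Ext incidence_algebra i (incidence_simple x)))
        (carrier (support_module (koszul_support x i) :: ('l \<Rightarrow> 'l \<Rightarrow> 'k, _) module))"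
proof -
  \<comment> \<open>The numbering enters only through the signs of the complex; neither the simple
    module nor \<open>koszul_support\<close> depends on it.\<close>
  obtain e :: "'l \<Rightarrow> nat" where e: "inj e"
    using finite_imp_inj_to_nat_seg[of "UNIV :: 'l set"] by auto
  obtain g where g: "operator_hom incidence_algebra (incidence_simple x) (incidence_line x) g"
      "bij_betw g (carrier (incidence_simple x)) (carrier (incidence_line x :: ('l \<Rightarrow> 'l \<Rightarrow> 'k, _) module))"
    using incidence_simple_iso(2) by blast
  show "operator_group incidence_algebra (Ext incidence_algebra i (incidence_simple x :: ('l \<Rightarrow> 'l \<Rightarrow> 'k, _) module))"
    and "\<exists>h. operator_hom incidence_algebra (Ext incidence_algebra i (incidence_simple x)) (support_module (koszul_support x i)) h \<and>
      bij_betw h (carrier (Ext incidence_algebra i (incidence_simple x)))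
        (carrier (support_module (koszul_support x i) :: ('l \<Rightarrow> 'l \<Rightarrow> 'k, _) module))"
    using Ext_iso[OF ring_incidence_algebra incidence_simple_iso(1) incidence_line_operator_group g
        koszul_resolution[OF e] support_module_operator_group koszul_class_hom[OF e]
        koszul_class_surj[OF e] koszul_class_kernel[OF e]]
    by blast+
qed

text \<open>The support is empty outside degree \<open>card (covers x)\<close>, while in that degree
  it contains \<open>row x\<close>, whose indicator function gives a nonzero class.\<close>

lemma grade_incidence_simple:
  fixes x :: "'l::{finite,distrib_lattice}"
  shows "grade incidence_algebra (incidence_simple x :: ('l \<Rightarrow> 'l \<Rightarrow> 'k::field, _) module) = enat (card (covers x))"
proof -
  let ?E = "\<lambda>i. Ext incidence_algebra i (incidence_simple x :: ('l \<Rightarrow> 'l \<Rightarrow> 'k, _) module)"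
  let ?C = "\<lambda>i. support_module (koszul_support x i) :: ('l \<Rightarrow> 'l \<Rightarrow> 'k, _) module"
  have "carrier (?E i) \<noteq> {\<zero>\<^bsub>?E i\<^esub>} \<longleftrightarrow> i = card (covers x)" for i
  proof -
    interpret E: operator_group incidence_algebra "?E i" by (rule Ext_incidence_simple(1))
    interpret C: operator_group incidence_algebra "?C i" by (rule support_module_operator_group)
    obtain h where h: "operator_hom incidence_algebra (?E i) (?C i) h" "bij_betw h (carrier (?E i)) (carrier (?C i))"
      using Ext_incidence_simple(2) by blast
    have h0: "h \<zero>\<^bsub>?E i\<^esub> = (\<lambda>u. 0)"
      using operator_hom_zero[OF E.abelian_group_axioms C.abelian_group_axioms h(1)] by simp
    show ?thesis
    proof (cases "i = card (covers x)")
      case True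
      have "(\<lambda>u. if u = row x then 1 else 0) \<in> h ` carrier (?E i)"
        unfolding bij_betw_imp_surj_on[OF h(2)]
        using row_le_joins[of x] True by (simp add: koszul_support_def)
      then obtain z where z: "z \<in> carrier (?E i)" "(\<lambda>u. if u = row x then 1 else 0) = h z"
        by (rule imageE)
      have "z \<noteq> \<zero>\<^bsub>?E i\<^esub>"
        using fun_cong[OF z(2), of "row x"] h0 by auto
      then show ?thesis
        using z(1) True by auto
    next
      case False
      have "z = \<zero>\<^bsub>?E i\<^esub>" if z: "z \<in> carrier (?E i)" for z
      proof -
        have "h z = (\<lambda>u. 0)"
          using operator_hom_closed[OF h(1) z] False by (auto simp: koszul_support_def)
        then show ?thesis
          using h0 by (intro inj_onD[OF bij_betw_imp_inj_on[OF h(2)] _ z E.zero_closed]) simp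
      qed
      then show ?thesis
        using False E.zero_closed by auto
    qed
  qed
  then show ?thesis
    by (simp add: grade_def)
qed

theorem theorem4p4:
  fixes A :: "('k::field, 'l::{finite,distrib_lattice} \<Rightarrow> 'l \<Rightarrow> 'k) module"
    and x :: 'l
  assumes "card (UNIV :: 'l set) \<ge> 2"
    and "A = incidence_algebra"
  shows "module_isomorphic A (grade_bijection A (incidence_simple x)) (incidence_simple (row x))"
proof -
  let ?E = "Ext A (card (covers x)) (incidence_simple x)"
  have supp: "koszul_support x (card (covers x)) = {row x..joins x (covers x)}"
    by (simp add: koszul_support_def)
  obtain h where h: "operator_hom A ?E (support_module {row x..joins x (covers x)}) h"
      "bij_betw h (carrier ?E) (carrier (support_module {row x..joins x (covers x)} :: ('l \<Rightarrow> 'l \<Rightarrow> 'k, _) module))"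
    using Ext_incidence_simple(2)[of "card (covers x)" x] unfolding supp assms(2) by blast
  \<comment> \<open>The least element \<open>row x\<close> of the supporting interval determines the
    simple top of the dual.\<close>
  note top = top_dual_interval[OF Ext_incidence_simple(1) h[unfolded assms(2)] row_le_joins]
  have "grade_bijection A (incidence_simple x) = module_top A (dual_module A ?E)"
    by (simp add: grade_bijection_def grade_incidence_simple assms(2))
  then show ?thesis
    using top incidence_simple_iso[of "row x"] unfolding assms(2)
    by (auto intro: module_isomorphicI)
qed

end
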